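(* Let $H=(H_n)_{n\in\mathbb N_0}$ be a simplicial group, viewed as a Hopf monoid in $\mathrm{SSet}$, and $\Sigma$ an oriented closed surface of genus $g\ge1$. Then the action of $\mathrm{Map}(\Sigma)$ on the representation varieties $\mathrm{Hom}(\pi_1(\Sigma),H_n)/H_n$, $n\in\mathbb N_0$, induces an action of $\mathrm{Map}(\Sigma)$ on the protected object $M_{inv}$ of $H$ and $\Sigma$ by simplicial maps, and this coincides with the action of $\mathrm{Map}(\Sigma)$ on $M_{inv}$ induced by edge slides.
   Context: A simplicial group is a simplicial set $H:\Delta^{op}\to\mathrm{Set}$ with group structures on all $H_n$ such that all face maps and degeneracies are group homomorphisms, i.e. a group object in $(\mathrm{SSet},\times)$. Protected object. $\pi_1(\Sigma)=\langle\alpha_1,\beta_1,\dots,\alpha_g,\beta_g\mid[\beta_g^{-1},\alpha_g]\cdots[\beta_1^{-1},\alpha_1]=1\rangle$, $[x,y]=xyx^{-1}y^{-1}$. Let $M=H^{\times 2g}$ with $\triangleright:H\times M\to M$ the diagonal conjugation action $h\triangleright(a_1,\dots,b_g)=(ha_1h^{-1},\dots,hb_gh^{-1})$ and $F:M\to H$, $F(a_1,b_1,\dots,a_g,b_g)=[b_g^{-1},a_g]\cdots[b_1^{-1},a_1]$. $\iota:M^{coH}\to M$ is the equaliser in $\mathrm{SSet}$ of $x\mapsto(F(x),x)$ and $x\mapsto(e,x)$, $\pi:M\to M^H$ the coequaliser of $\triangleright$ and the projection $H\times M\to M$, and the protected object $M_{inv}$ is the image of $\pi\circ\iota$ (smallest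 subobject of $M^H$ through which $\pi\circ\iota$ factorises). It is the simplicial set with $(M_{inv})_n=\mathrm{Hom}(\pi_1(\Sigma),H_n)/H_n$ (quotient by conjugation) and face maps and degeneracies given by post-composing homomorphisms with those of $H$. Mapping class group. $\mathrm{Map}(\Sigma)$ is the group of orientation preserving homeomorphisms of $\Sigma$ modulo those homotopic to the identity, acting on $\pi_1(\Sigma)$ by outer automorphisms. For a group $G$ it acts on $\mathrm{Hom}(\pi_1(\Sigma),G)/G$ by $\varphi\triangleright[\rho]=[\rho\circ\tilde\varphi^{-1}]$, with $\tilde\varphi\in\mathrm{Aut}(\pi_1(\Sigma))$ representing $\varphi$. Action by edge slides. The standard graph of $\Sigma$ has a single vertex $v$, edges $\alpha_1,\beta_1,\dots,\alpha_g,\beta_g$ and ordering of edge ends at $v$ (counterclockwise) $s(\alpha_1)<s(\beta_1)<t(\alpha_1)<t(\beta_1)<\dots<s(\alpha_g)<s(\beta_g)<t(\alpha_g)<t(\beta_g)$; its complement in $\Sigma$ is a disc. Remove an open disc $D$ in this face and represent the linear ordering by an arc (cilium) from $v$ to $\partial D$. If the starting end of an edge $\alpha$ comes directly before the target end of an edge $\beta\neq\alpha$, sliding the target end of $\beta$ along $\alpha$ moves it to $t(\alpha)$, directly before the target end of $\alpha$; the associated automorphism of $H^{\times2g}$ (factors labelled by edges) replaces $(\alpha,\beta)$ by $(\alpha,\alpha\beta)$. Other slides arise from these and their inverses by reversing edge orientations before and after the slide (inverting the corresponding factor). Only slides not moving edge ends over the cilium are considered. If after a finite sequence of slides the resulting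 embedded graph, with edges labelled by those of the standard graph, has the same linear ordering of edge ends, there is a unique mapping class $f$ of $\Sigma\setminus D$ (fixing $\partial D$) mapping the standard graph to it edge by edge; the sequence realises $f^{-1}$. The composite of the associated automorphisms of $H^{\times 2g}$ respects $\triangleright$ and $F$ and hence induces an automorphism of $M_{inv}$. The action of $\mathrm{Map}(\Sigma)$ on $M_{inv}$ induced by edge slides assigns to the image in $\mathrm{Map}(\Sigma)$ of a mapping class $\varphi$ of $\Sigma\setminus D$ the automorphism induced by a finite sequence of edge slides realising $\varphi$.
   Formalization: The standard graph's edge ends are ordered t(α_i)<t(β_i)<s(α_i)<s(β_i) (all edges reversed): with the printed order, sliding t(α_1) along β_1 gives a_1→b_1a_1, which for g≥2 does not preserve F or F=1, so no automorphism of M_inv is induced. *)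

theory Defs
  imports "HOL-Homology.Homology" "HOL-Algebra.Group_Action"
begin

section \<open>Simplicial sets\<close>

text \<open>The ordinal \<open>[n]\<close> is \<open>{..n}\<close>; \<open>Delta m n\<close> is the set of morphisms \<open>[m] \<rightarrow> [n]\<close> of the
  simplex category. The map \<open>smap X m n \<theta>\<close> goes from \<open>cells X n\<close> to \<open>cells X m\<close>.\<close>

definition Delta :: "nat \<Rightarrow> nat \<Rightarrow> (nat \<Rightarrow> nat) set" where
  "Delta m n = {\<theta> \<in> {..m} \<rightarrow>\<^sub>E {..n}. mono_on {..m} \<theta>}"

record 'a sset =
  cells :: "nat \<Rightarrow> 'a set"
  smap :: "nat \<Rightarrow> nat \<Rightarrow> (nat \<Rightarrow> nat) \<Rightarrow> 'a \<Rightarrow> 'a"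

definition simplicial_set :: "'a sset \<Rightarrow> bool" where
  "simplicial_set X \<longleftrightarrow>
     (\<forall>m n. \<forall>\<theta>\<in>Delta m n. smap X m n \<theta> \<in> cells X n \<rightarrow> cells X m) \<and>
     (\<forall>n. \<forall>x\<in>cells X n. smap X n n (\<lambda>i\<in>{..n}. i) x = x) \<and>
     (\<forall>k m n. \<forall>\<theta>\<in>Delta k m. \<forall>\<eta>\<in>Delta m n. \<forall>x\<in>cells X n.
        smap X k n (compose {..k} \<eta> \<theta>) x = smap X k m \<theta> (smap X m n \<eta> x))"

definition simplicial_map :: "'a sset \<Rightarrow> 'b sset \<Rightarrow> (nat \<Rightarrow> 'a \<Rightarrow> 'b) \<Rightarrow> bool" where
  "simplicial_map X Y f \<longleftrightarrow>
     (\<forall>n. f n \<in> cells X n \<rightarrow> cells Y n) \<and>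
     (\<forall>m n. \<forall>\<theta>\<in>Delta m n. \<forall>x\<in>cells X n. f m (smap X m n \<theta> x) = smap Y m n \<theta> (f n x))"

definition simplicial_iso :: "'a sset \<Rightarrow> 'b sset \<Rightarrow> (nat \<Rightarrow> 'a \<Rightarrow> 'b) \<Rightarrow> bool" where
  "simplicial_iso X Y f \<longleftrightarrow>
     simplicial_map X Y f \<and> (\<forall>n. bij_betw (f n) (cells X n) (cells Y n))"

definition simplicial_action ::
    "('k, 'c) monoid_scheme \<Rightarrow> 'a sset \<Rightarrow> ('k \<Rightarrow> nat \<Rightarrow> 'a \<Rightarrow> 'a) \<Rightarrow> bool" where
  "simplicial_action K X A \<longleftrightarrow>
     (\<forall>n. group_action K (cells X n) (\<lambda>k. A k n)) \<and>
     (\<forall>k\<in>carrier K. simplicial_map X X (A k))"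

text \<open>Limits, colimits and images of simplicial sets are formed degreewise.\<close>

definition sset_prod :: "'a sset \<Rightarrow> 'b sset \<Rightarrow> ('a \<times> 'b) sset" where
  "sset_prod X Y = \<lparr>cells = (\<lambda>n. cells X n \<times> cells Y n),
                    smap = (\<lambda>m n \<theta>. map_prod (smap X m n \<theta>) (smap Y m n \<theta>))\<rparr>"

definition sset_power :: "'i set \<Rightarrow> 'a sset \<Rightarrow> ('i \<Rightarrow> 'a) sset" where
  "sset_power I X = \<lparr>cells = (\<lambda>n. I \<rightarrow>\<^sub>E cells X n),
                     smap = (\<lambda>m n \<theta> x. \<lambda>i\<in>I. smap X m n \<theta> (x i))\<rparr>"

definition sset_equaliser ::
    "'a sset \<Rightarrow> (nat \<Rightarrow> 'a \<Rightarrow> 'b) \<Rightarrow> (nat \<Rightarrow> 'a \<Rightarrow> 'b) \<Rightarrow> 'a sset" where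
  "sset_equaliser X f f' = \<lparr>cells = (\<lambda>n. {x \<in> cells X n. f n x = f' n x}), smap = smap X\<rparr>"

definition coeq_rel ::
    "'a sset \<Rightarrow> 'b sset \<Rightarrow> (nat \<Rightarrow> 'a \<Rightarrow> 'b) \<Rightarrow> (nat \<Rightarrow> 'a \<Rightarrow> 'b) \<Rightarrow> nat \<Rightarrow> ('b \<times> 'b) set" where
  "coeq_rel X Y f f' n =
     (let R = {(f n x, f' n x) | x. x \<in> cells X n}
      in (R \<union> R\<inverse>)\<^sup>* \<inter> cells Y n \<times> cells Y n)"

definition sset_coequaliser ::
    "'a sset \<Rightarrow> 'b sset \<Rightarrow> (nat \<Rightarrow> 'a \<Rightarrow> 'b) \<Rightarrow> (nat \<Rightarrow> 'a \<Rightarrow> 'b) \<Rightarrow> 'b set sset" where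
  "sset_coequaliser X Y f f' =
     \<lparr>cells = (\<lambda>n. cells Y n // coeq_rel X Y f f' n),
      smap = (\<lambda>m n \<theta> C. coeq_rel X Y f f' m `` (smap Y m n \<theta> ` C))\<rparr>"

definition sset_image :: "'a sset \<Rightarrow> 'b sset \<Rightarrow> (nat \<Rightarrow> 'a \<Rightarrow> 'b) \<Rightarrow> 'b sset" where
  "sset_image X Y f = \<lparr>cells = (\<lambda>n. f n ` cells X n), smap = smap Y\<rparr>"


section \<open>Simplicial groups\<close>

record 'h simplicial_group_data =
  grp :: "nat \<Rightarrow> 'h monoid"
  gmap :: "nat \<Rightarrow> nat \<Rightarrow> (nat \<Rightarrow> nat) \<Rightarrow> 'h \<Rightarrow> 'h"

definition underlying_sset :: "'h simplicial_group_data \<Rightarrow> 'h sset" where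
  "underlying_sset H = \<lparr>cells = (\<lambda>n. carrier (grp H n)), smap = gmap H\<rparr>"

definition coface :: "nat \<Rightarrow> nat \<Rightarrow> nat \<Rightarrow> nat" where
  "coface n i = (\<lambda>j\<in>{..n}. if j < i then j else Suc j)"

definition codegeneracy :: "nat \<Rightarrow> nat \<Rightarrow> nat \<Rightarrow> nat" where
  "codegeneracy n i = (\<lambda>j\<in>{..Suc n}. if j \<le> i then j else j - 1)"

definition simplicial_group :: "'h simplicial_group_data \<Rightarrow> bool" where
  "simplicial_group H \<longleftrightarrow>
     simplicial_set (underlying_sset H) \<and>
     (\<forall>n. group (grp H n)) \<and>
     (\<forall>n. \<forall>i\<le>Suc n. gmap H n (Suc n) (coface n i) \<in> hom (grp H (Suc n)) (grp H n)) \<and>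
     (\<forall>n. \<forall>i\<le>n. gmap H (Suc n) n (codegeneracy n i) \<in> hom (grp H n) (grp H (Suc n)))"


section \<open>The protected object\<close>

text \<open>\<open>Alpha i\<close> and \<open>Beta i\<close> for \<open>i < g\<close> stand for \<open>\<alpha>\<^sub>i\<^sub>+\<^sub>1\<close> and \<open>\<beta>\<^sub>i\<^sub>+\<^sub>1\<close>.\<close>

datatype edge = Alpha nat | Beta nat

definition edges :: "nat \<Rightarrow> edge set" where
  "edges g = Alpha ` {..<g} \<union> Beta ` {..<g}"

definition grp_commutator :: "('h, 'c) monoid_scheme \<Rightarrow> 'h \<Rightarrow> 'h \<Rightarrow> 'h" where
  "grp_commutator G x y = x \<otimes>\<^bsub>G\<^esub> y \<otimes>\<^bsub>G\<^esub> inv\<^bsub>G\<^esub> x \<otimes>\<^bsub>G\<^esub> inv\<^bsub>G\<^esub> y"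

primrec face_word :: "('h, 'c) monoid_scheme \<Rightarrow> nat \<Rightarrow> (edge \<Rightarrow> 'h) \<Rightarrow> 'h" where
  "face_word G 0 a = \<one>\<^bsub>G\<^esub>"
| "face_word G (Suc k) a =
     grp_commutator G (inv\<^bsub>G\<^esub> (a (Beta k))) (a (Alpha k)) \<otimes>\<^bsub>G\<^esub> face_word G k a"

definition conj_tuple :: "('h, 'c) monoid_scheme \<Rightarrow> nat \<Rightarrow> 'h \<Rightarrow> (edge \<Rightarrow> 'h) \<Rightarrow> edge \<Rightarrow> 'h" where
  "conj_tuple G g h a = (\<lambda>e\<in>edges g. h \<otimes>\<^bsub>G\<^esub> a e \<otimes>\<^bsub>G\<^esub> inv\<^bsub>G\<^esub> h)"

definition M_obj :: "'h simplicial_group_data \<Rightarrow> nat \<Rightarrow> (edge \<Rightarrow> 'h) sset" where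
  "M_obj H g = sset_power (edges g) (underlying_sset H)"

definition M_coinv :: "'h simplicial_group_data \<Rightarrow> nat \<Rightarrow> (edge \<Rightarrow> 'h) sset" where
  "M_coinv H g = sset_equaliser (M_obj H g)
     (\<lambda>n a. (face_word (grp H n) g a, a)) (\<lambda>n a. (\<one>\<^bsub>grp H n\<^esub>, a))"

definition M_quot :: "'h simplicial_group_data \<Rightarrow> nat \<Rightarrow> (edge \<Rightarrow> 'h) set sset" where
  "M_quot H g = sset_coequaliser (sset_prod (underlying_sset H) (M_obj H g)) (M_obj H g)
     (\<lambda>n (h, a). conj_tuple (grp H n) g h a) (\<lambda>n (h, a). a)"

definition M_proj ::
    "'h simplicial_group_data \<Rightarrow> nat \<Rightarrow> nat \<Rightarrow> (edge \<Rightarrow> 'h) \<Rightarrow> (edge \<Rightarrow> 'h) set" where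
  "M_proj H g n a = coeq_rel (sset_prod (underlying_sset H) (M_obj H g)) (M_obj H g)
     (\<lambda>n (h, a). conj_tuple (grp H n) g h a) (\<lambda>n (h, a). a) n `` {a}"

definition M_inv :: "'h simplicial_group_data \<Rightarrow> nat \<Rightarrow> (edge \<Rightarrow> 'h) set sset" where
  "M_inv H g = sset_image (M_coinv H g) (M_quot H g) (M_proj H g)"


section \<open>Fundamental group and representation varieties\<close>

definition loop_class :: "'p::topological_space set \<Rightarrow> (real \<Rightarrow> 'p) \<Rightarrow> (real \<Rightarrow> 'p) set" where
  "loop_class S p = {p'. homotopic_paths S p p'}"

definition based_loops :: "'p::topological_space set \<Rightarrow> 'p \<Rightarrow> (real \<Rightarrow> 'p) set" where
  "based_loops S v = {p. path p \<and> path_image p \<subseteq> S \<and> pathstart p = v \<and> pathfinish p = v}"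

text \<open>Paths compose from right to left: the product of \<open>[p]\<close> and \<open>[p']\<close> runs first along \<open>p'\<close>,
  then along \<open>p\<close>.\<close>

definition pi1 :: "'p::topological_space set \<Rightarrow> 'p \<Rightarrow> (real \<Rightarrow> 'p) set monoid" where
  "pi1 S v = \<lparr>carrier = loop_class S ` based_loops S v,
              mult = (\<lambda>P P'. {r. \<exists>p\<in>P. \<exists>p'\<in>P'. homotopic_paths S (p' +++ p) r}),
              one = loop_class S (\<lambda>_. v)\<rparr>"

definition reps :: "('k, 'c) monoid_scheme \<Rightarrow> ('h, 'd) monoid_scheme \<Rightarrow> ('k \<Rightarrow> 'h) set" where
  "reps P G = hom P G \<inter> extensional (carrier P)"

definition rep_class ::
    "('k, 'c) monoid_scheme \<Rightarrow> ('h, 'd) monoid_scheme \<Rightarrow> ('k \<Rightarrow> 'h) \<Rightarrow> ('k \<Rightarrow> 'h) set" where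
  "rep_class P G \<rho> = {(\<lambda>x\<in>carrier P. h \<otimes>\<^bsub>G\<^esub> \<rho> x \<otimes>\<^bsub>G\<^esub> inv\<^bsub>G\<^esub> h) | h. h \<in> carrier G}"

definition rep_variety ::
    "('k, 'c) monoid_scheme \<Rightarrow> ('h, 'd) monoid_scheme \<Rightarrow> ('k \<Rightarrow> 'h) set set" where
  "rep_variety P G = rep_class P G ` reps P G"

definition rep_sset :: "('k, 'c) monoid_scheme \<Rightarrow> 'h simplicial_group_data \<Rightarrow> ('k \<Rightarrow> 'h) set sset" where
  "rep_sset P H = \<lparr>cells = (\<lambda>n. rep_variety P (grp H n)),
     smap = (\<lambda>m n \<theta> C. \<Union>\<rho>\<in>C. rep_class P (grp H m) (compose (carrier P) (gmap H m n \<theta>) \<rho>))\<rparr>"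


section \<open>Closed oriented surfaces\<close>

text \<open>A closed oriented surface of genus \<open>g\<close> is presented by the characteristic map
  \<open>q\<close> of its 2-cell, i.e. as the unit disc regarded as a \<open>4g\<close>-gon with sides identified in pairs;
  its orientation is the one transported from the complex plane.
  Read clockwise from the corner 1, the sides spell
  \<open>\<alpha>\<^sub>1\<inverse>, \<beta>\<^sub>1, \<alpha>\<^sub>1, \<beta>\<^sub>1\<inverse>, \<alpha>\<^sub>2\<inverse>, \<dots>, \<beta>\<^sub>g\<inverse>\<close>, which composed from right to left is the word
  \<open>[\<beta>\<^sub>g\<inverse>, \<alpha>\<^sub>g] \<cdots> [\<beta>\<^sub>1\<inverse>, \<alpha>\<^sub>1]\<close>. The closure below also identifies all corners. No quotient topology
  needs to be imposed, as \<open>q\<close> is a closed map into a Hausdorff space.\<close>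

definition side :: "nat \<Rightarrow> nat \<Rightarrow> real \<Rightarrow> complex" where
  "side g k t = cis (- (2 * pi * (real k + t) / (4 * real g)))"

definition side_pairing :: "nat \<Rightarrow> (complex \<times> complex) set" where
  "side_pairing g =
     {(side g (4 * i + j) t, side g (4 * i + j + 2) (1 - t)) | i j t. i < g \<and> j < 2 \<and> t \<in> {0..1}}"

definition closed_surface :: "nat \<Rightarrow> 'p::t2_space set \<Rightarrow> (complex \<Rightarrow> 'p) \<Rightarrow> bool" where
  "closed_surface g S q \<longleftrightarrow>
     1 \<le> g \<and> continuous_on (cball 0 1) q \<and> q ` cball 0 1 = S \<and>
     (\<forall>x\<in>cball 0 1. \<forall>y\<in>cball 0 1.
        q x = q y \<longleftrightarrow> (x, y) \<in> (side_pairing g \<union> (side_pairing g)\<inverse>)\<^sup>*)"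

abbreviation vertex :: "(complex \<Rightarrow> 'p) \<Rightarrow> 'p" where
  "vertex q \<equiv> q 1"

primrec std_graph :: "nat \<Rightarrow> (complex \<Rightarrow> 'p) \<Rightarrow> edge \<Rightarrow> real \<Rightarrow> 'p" where
  "std_graph g q (Alpha i) = (\<lambda>t. q (side g (4 * i + 2) t))"
| "std_graph g q (Beta i) = (\<lambda>t. q (side g (4 * i + 1) t))"

text \<open>The identification \<open>Hom(\<pi>\<^sub>1(\<Sigma>), H\<^sub>n)/H\<^sub>n \<rightarrow> (M\<^sub>i\<^sub>n\<^sub>v)\<^sub>n\<close>, by evaluation on the generators.\<close>

definition eval_class ::
    "nat \<Rightarrow> 'p::t2_space set \<Rightarrow> (complex \<Rightarrow> 'p) \<Rightarrow> ((real \<Rightarrow> 'p) set \<Rightarrow> 'h) set \<Rightarrow> (edge \<Rightarrow> 'h) set" where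
  "eval_class g S q C = (\<lambda>\<rho>. \<lambda>e\<in>edges g. \<rho> (loop_class S (std_graph g q e))) ` C"


section \<open>Mapping class groups\<close>

text \<open>A homeomorphism of a closed connected oriented surface preserves the orientation iff it
  preserves the fundamental class, which generates the second homology group.\<close>

definition orientation_preserving :: "'p::topological_space set \<Rightarrow> ('p \<Rightarrow> 'p) \<Rightarrow> bool" where
  "orientation_preserving S f \<longleftrightarrow>
     (\<forall>c\<in>carrier (homology_group 2 (top_of_set S)).
        hom_induced 2 (top_of_set S) {} (top_of_set S) {} f c = c)"

definition homeo_group :: "'p::topological_space set \<Rightarrow> ('p \<Rightarrow> 'p) monoid" where
  "homeo_group S = (BijGroup S)\<lparr>carrier :=
     {f \<in> Bij S. homeomorphic_map (top_of_set S) (top_of_set S) f \<and> orientation_preserving S f}\<rparr>"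

definition homeo_null :: "'p::topological_space set \<Rightarrow> ('p \<Rightarrow> 'p) set" where
  "homeo_null S = {f \<in> carrier (homeo_group S).
     homotopic_with (\<lambda>_. True) (top_of_set S) (top_of_set S) f id}"

definition mcg :: "'p::topological_space set \<Rightarrow> ('p \<Rightarrow> 'p) set monoid" where
  "mcg S = homeo_group S Mod homeo_null S"

text \<open>\<open>represents S v \<phi> \<sigma>\<close>: the automorphism \<open>\<sigma>\<close> of the fundamental group represents the outer
  automorphism given by \<open>\<phi>\<close>. Since a homeomorphism need not fix the base point,
  this involves a path \<open>p\<close> joining \<open>v\<close> to its image.\<close>

definition represents ::
    "'p::topological_space set \<Rightarrow> 'p \<Rightarrow> ('p \<Rightarrow> 'p) set \<Rightarrow> ((real \<Rightarrow> 'p) set \<Rightarrow> (real \<Rightarrow> 'p) set) \<Rightarrow> bool" where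
  "represents S v \<phi> \<sigma> \<longleftrightarrow>
     \<sigma> \<in> auto (pi1 S v) \<and>
     (\<exists>f\<in>\<phi>. \<exists>p. path p \<and> path_image p \<subseteq> S \<and> pathstart p = v \<and> pathfinish p = f v \<and>
        (\<forall>c\<in>based_loops S v. \<sigma> (loop_class S c) = loop_class S (p +++ (f \<circ> c) +++ reversepath p)))"

text \<open>\<open>\<phi> \<triangleright> [\<rho>] = [\<rho> \<circ> \<sigma>\<inverse>]\<close>; the union runs over all choices of \<open>\<rho>\<close> and \<open>\<sigma>\<close>, which all give the
  same class.\<close>

definition rep_action ::
    "'p::topological_space set \<Rightarrow> 'p \<Rightarrow> ('h, 'd) monoid_scheme \<Rightarrow> ('p \<Rightarrow> 'p) set \<Rightarrow>
      ((real \<Rightarrow> 'p) set \<Rightarrow> 'h) set \<Rightarrow> ((real \<Rightarrow> 'p) set \<Rightarrow> 'h) set" where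
  "rep_action S v G \<phi> = (\<lambda>C\<in>rep_variety (pi1 S v) G.
     \<Union>\<rho>\<in>C. \<Union>\<sigma>\<in>{\<sigma>. represents S v \<phi> \<sigma>}.
       rep_class (pi1 S v) G
         (compose (carrier (pi1 S v)) \<rho> (inv_into (carrier (pi1 S v)) \<sigma>)))"

definition induced_action ::
    "nat \<Rightarrow> 'p::t2_space set \<Rightarrow> (complex \<Rightarrow> 'p) \<Rightarrow> 'h simplicial_group_data \<Rightarrow>
      ('p \<Rightarrow> 'p) set \<Rightarrow> nat \<Rightarrow> (edge \<Rightarrow> 'h) set \<Rightarrow> (edge \<Rightarrow> 'h) set" where
  "induced_action g S q H \<phi> n = (\<lambda>c\<in>cells (M_inv H g) n.
     eval_class g S q (rep_action S (vertex q) (grp H n) \<phi>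
       (inv_into (rep_variety (pi1 S (vertex q)) (grp H n)) (eval_class g S q) c)))"


section \<open>The surface with a disc removed\<close>

text \<open>Any disc in the face and any cilium ending in the
  same corner of the polygon have this form after composing \<open>q\<close> with a homeomorphism of
  the unit disc that fixes the unit circle.\<close>

definition disc :: "(complex \<Rightarrow> 'p) \<Rightarrow> 'p set" where
  "disc q = q ` ball 0 (1/2)"

definition disc_boundary :: "(complex \<Rightarrow> 'p) \<Rightarrow> 'p set" where
  "disc_boundary q = q ` sphere 0 (1/2)"

definition cilium :: "(complex \<Rightarrow> 'p) \<Rightarrow> 'p set" where
  "cilium q = q ` closed_segment 1 (1/2)"

definition cap :: "'p set \<Rightarrow> (complex \<Rightarrow> 'p) \<Rightarrow> ('p \<Rightarrow> 'p) \<Rightarrow> 'p \<Rightarrow> 'p" where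
  "cap S q f = (\<lambda>x\<in>S. if x \<in> disc q then x else f x)"

definition homeo_group_disc :: "'p::t2_space set \<Rightarrow> (complex \<Rightarrow> 'p) \<Rightarrow> ('p \<Rightarrow> 'p) monoid" where
  "homeo_group_disc S q = (BijGroup (S - disc q))\<lparr>carrier :=
     {f \<in> Bij (S - disc q).
        homeomorphic_map (top_of_set (S - disc q)) (top_of_set (S - disc q)) f \<and>
        (\<forall>x\<in>disc_boundary q. f x = x) \<and> orientation_preserving S (cap S q f)}\<rparr>"

definition homeo_null_disc :: "'p::t2_space set \<Rightarrow> (complex \<Rightarrow> 'p) \<Rightarrow> ('p \<Rightarrow> 'p) set" where
  "homeo_null_disc S q = {f \<in> carrier (homeo_group_disc S q).
     homotopic_with (\<lambda>h. \<forall>x\<in>disc_boundary q. h x = x)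
       (top_of_set (S - disc q)) (top_of_set (S - disc q)) f id}"

definition mcg_disc :: "'p::t2_space set \<Rightarrow> (complex \<Rightarrow> 'p) \<Rightarrow> ('p \<Rightarrow> 'p) set monoid" where
  "mcg_disc S q = homeo_group_disc S q Mod homeo_null_disc S q"

text \<open>The homomorphism from the mapping class group of the surface with a disc removed to
  that of the closed surface.\<close>

definition cap_class :: "'p::t2_space set \<Rightarrow> (complex \<Rightarrow> 'p) \<Rightarrow> ('p \<Rightarrow> 'p) set \<Rightarrow> ('p \<Rightarrow> 'p) set" where
  "cap_class S q \<phi> = (\<Union>f\<in>\<phi>. homeo_null S #>\<^bsub>homeo_group S\<^esub> cap S q f)"


section \<open>Edge slides\<close>

datatype edge_end = Src edge | Tgt edge

text \<open>A dart is an edge with a choice of orientation; \<open>False\<close> reverses the given one. Working with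
  darts accounts for reversing edge orientations before and after a slide.\<close>

type_synonym dart = "edge \<times> bool"

fun dart_src :: "dart \<Rightarrow> edge_end" where
  "dart_src (e, b) = (if b then Src e else Tgt e)"

fun dart_tgt :: "dart \<Rightarrow> edge_end" where
  "dart_tgt (e, b) = (if b then Tgt e else Src e)"

fun dart_path :: "(edge \<Rightarrow> real \<Rightarrow> 'p::topological_space) \<Rightarrow> dart \<Rightarrow> real \<Rightarrow> 'p" where
  "dart_path \<Gamma> (e, b) = (if b then \<Gamma> e else reversepath (\<Gamma> e))"

fun dart_label :: "('h, 'c) monoid_scheme \<Rightarrow> (edge \<Rightarrow> 'h) \<Rightarrow> dart \<Rightarrow> 'h" where
  "dart_label G a (e, b) = (if b then a e else inv\<^bsub>G\<^esub> (a e))"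

fun set_dart_label :: "('h, 'c) monoid_scheme \<Rightarrow> (edge \<Rightarrow> 'h) \<Rightarrow> dart \<Rightarrow> 'h \<Rightarrow> (edge \<Rightarrow> 'h)" where
  "set_dart_label G a (e, b) h = a(e := (if b then h else inv\<^bsub>G\<^esub> h))"

text \<open>\<open>Slide x y\<close> slides the target end of \<open>y\<close> along \<open>x\<close>; \<open>Unslide x y\<close> is the inverse of
  such a slide.\<close>

datatype slide = Slide dart dart | Unslide dart dart

text \<open>The ends at the vertex, counterclockwise from the cilium, for the polygon \<open>side_pairing\<close>.
  Targets precede sources here because of the form of the face relation: if sources came
  first, the face of the graph would read \<open>[\<beta>\<^sub>g, \<alpha>\<^sub>g\<inverse>] \<cdots> [\<beta>\<^sub>1, \<alpha>\<^sub>1\<inverse>]\<close>, and the slide of the target end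
  of \<open>\<alpha>\<^sub>1\<close> along \<open>\<beta>\<^sub>1\<close>, which would preserve the ordering of ends and replace \<open>a\<^sub>1\<close> by \<open>b\<^sub>1a\<^sub>1\<close>,
  would not preserve \<open>face_word\<close>.\<close>

definition std_order :: "nat \<Rightarrow> edge_end list" where
  "std_order g =
     concat (map (\<lambda>i. [Tgt (Alpha i), Tgt (Beta i), Src (Alpha i), Src (Beta i)]) [0..<g])"

text \<open>As the orderings are linear and start at the cilium, no end is moved over the cilium.\<close>

definition slide_order :: "dart \<Rightarrow> dart \<Rightarrow> edge_end list \<Rightarrow> edge_end list \<Rightarrow> bool" where
  "slide_order x y L L' \<longleftrightarrow>
     fst x \<noteq> fst y \<and>
     (\<exists>us ws us' ws'. L = us @ [dart_src x, dart_tgt y] @ ws \<and>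
        us @ [dart_src x] @ ws = us' @ [dart_tgt x] @ ws' \<and>
        L' = us' @ [dart_tgt y, dart_tgt x] @ ws')"

definition embedded_graph ::
    "nat \<Rightarrow> 'p::t2_space set \<Rightarrow> (complex \<Rightarrow> 'p) \<Rightarrow> (edge \<Rightarrow> real \<Rightarrow> 'p) \<Rightarrow> bool" where
  "embedded_graph g S q \<Gamma> \<longleftrightarrow>
     (\<forall>e\<in>edges g. simple_path (\<Gamma> e) \<and> pathstart (\<Gamma> e) = vertex q \<and> pathfinish (\<Gamma> e) = vertex q \<and>
        path_image (\<Gamma> e) \<subseteq> S - disc q \<and> path_image (\<Gamma> e) \<inter> cilium q = {vertex q}) \<and>
     (\<forall>e\<in>edges g. \<forall>e'\<in>edges g. e \<noteq> e' \<longrightarrow> path_image (\<Gamma> e) \<inter> path_image (\<Gamma> e') = {vertex q})"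

text \<open>Geometrically, sliding the target end of \<open>y\<close> along \<open>x\<close> sweeps out a triangle with sides \<open>y\<close>,
  \<open>x\<close> and the slid edge, whose interior contains no point of the graph, the cilium or the
  disc.\<close>

definition slide_graph ::
    "nat \<Rightarrow> 'p::t2_space set \<Rightarrow> (complex \<Rightarrow> 'p) \<Rightarrow> dart \<Rightarrow> dart \<Rightarrow>
      (edge \<Rightarrow> real \<Rightarrow> 'p) \<Rightarrow> (edge \<Rightarrow> real \<Rightarrow> 'p) \<Rightarrow> bool" where
  "slide_graph g S q x y \<Gamma> \<Gamma>' \<longleftrightarrow>
     embedded_graph g S q \<Gamma> \<and> embedded_graph g S q \<Gamma>' \<and> (\<forall>e. e \<noteq> fst y \<longrightarrow> \<Gamma>' e = \<Gamma> e) \<and>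
     (\<exists>\<tau>. continuous_on (convex hull {0, 1, \<i>}) \<tau> \<and>
        inj_on \<tau> (interior (convex hull {0, 1, \<i>})) \<and>
        \<tau> ` interior (convex hull {0, 1, \<i>}) \<subseteq>
          S - disc q - cilium q - (\<Union>e\<in>edges g. path_image (\<Gamma> e) \<union> path_image (\<Gamma>' e)) \<and>
        (\<forall>t\<in>{0..1}. \<tau> (linepath 0 1 t) = dart_path \<Gamma> y t \<and>
                    \<tau> (linepath 1 \<i> t) = dart_path \<Gamma> x t \<and>
                    \<tau> (linepath 0 \<i> t) = dart_path \<Gamma>' y t))"

type_synonym 'p ciliated_graph = "edge_end list \<times> (edge \<Rightarrow> real \<Rightarrow> 'p)"

fun slide_step ::
    "nat \<Rightarrow> 'p::t2_space set \<Rightarrow> (complex \<Rightarrow> 'p) \<Rightarrow> slide \<Rightarrow>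
      'p ciliated_graph \<Rightarrow> 'p ciliated_graph \<Rightarrow> bool" where
  "slide_step g S q (Slide x y) (L, \<Gamma>) (L', \<Gamma>') \<longleftrightarrow>
     slide_order x y L L' \<and> slide_graph g S q x y \<Gamma> \<Gamma>'"
| "slide_step g S q (Unslide x y) (L, \<Gamma>) (L', \<Gamma>') \<longleftrightarrow>
     slide_order x y L' L \<and> slide_graph g S q x y \<Gamma>' \<Gamma>"

primrec slide_steps ::
    "nat \<Rightarrow> 'p::t2_space set \<Rightarrow> (complex \<Rightarrow> 'p) \<Rightarrow> slide list \<Rightarrow>
      'p ciliated_graph \<Rightarrow> 'p ciliated_graph \<Rightarrow> bool" where
  "slide_steps g S q [] X Y \<longleftrightarrow> X = Y"
| "slide_steps g S q (s # ss) X Y \<longleftrightarrow> (\<exists>Z. slide_step g S q s X Z \<and> slide_steps g S q ss Z Y)"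

text \<open>The sequence realises the inverse of the mapping class of \<open>f\<close>. The cilium belongs to the
  embedded graph; without the condition on it, \<open>f\<close> would be determined only up to Dehn twists
  along the boundary of the disc.\<close>

definition realises ::
    "nat \<Rightarrow> 'p::t2_space set \<Rightarrow> (complex \<Rightarrow> 'p) \<Rightarrow> slide list \<Rightarrow> ('p \<Rightarrow> 'p) set \<Rightarrow> bool" where
  "realises g S q ss \<phi> \<longleftrightarrow>
     (\<exists>\<Gamma> f. slide_steps g S q ss (std_order g, std_graph g q) (std_order g, \<Gamma>) \<and>
        f \<in> carrier (homeo_group_disc S q) \<and>
        (\<forall>e\<in>edges g. \<forall>t\<in>{0..1}. f (std_graph g q e t) = \<Gamma> e t) \<and>
        (\<forall>x\<in>cilium q. f x = x) \<and>
        \<phi> = homeo_null_disc S q #>\<^bsub>homeo_group_disc S q\<^esub> (m_inv (homeo_group_disc S q) f))"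

primrec slide_aut :: "('h, 'c) monoid_scheme \<Rightarrow> slide \<Rightarrow> (edge \<Rightarrow> 'h) \<Rightarrow> (edge \<Rightarrow> 'h)" where
  "slide_aut G (Slide x y) a =
     set_dart_label G a y (dart_label G a x \<otimes>\<^bsub>G\<^esub> dart_label G a y)"
| "slide_aut G (Unslide x y) a =
     set_dart_label G a y (inv\<^bsub>G\<^esub> (dart_label G a x) \<otimes>\<^bsub>G\<^esub> dart_label G a y)"

text \<open>The first slide of the sequence acts first. Elements of \<open>M\<^sub>i\<^sub>n\<^sub>v\<close> are conjugation orbits of
  tuples, so the induced map is the direct image.\<close>

definition slides_induced ::
    "'h simplicial_group_data \<Rightarrow> slide list \<Rightarrow> nat \<Rightarrow> (edge \<Rightarrow> 'h) set \<Rightarrow> (edge \<Rightarrow> 'h) set" where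
  "slides_induced H ss n c = fold (slide_aut (grp H n)) ss ` c"

text \<open>\<open>A\<close> is the action of the mapping class group on \<open>M\<^sub>i\<^sub>n\<^sub>v\<close> induced by edge slides: it assigns
  to the image of a mapping class \<open>\<phi>\<close> of the surface with a disc removed the automorphism
  induced by a sequence of slides that realises \<open>\<phi>\<close>.\<close>

definition edge_slide_action ::
    "nat \<Rightarrow> 'p::t2_space set \<Rightarrow> (complex \<Rightarrow> 'p) \<Rightarrow> 'h simplicial_group_data \<Rightarrow>
      (('p \<Rightarrow> 'p) set \<Rightarrow> nat \<Rightarrow> (edge \<Rightarrow> 'h) set \<Rightarrow> (edge \<Rightarrow> 'h) set) \<Rightarrow> bool" where
  "edge_slide_action g S q H A \<longleftrightarrow>
     (\<forall>\<psi>\<in>carrier (mcg S). \<exists>\<phi>\<in>carrier (mcg_disc S q). \<exists>ss.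
        cap_class S q \<phi> = \<psi> \<and> realises g S q ss \<phi> \<and>
        (\<forall>n. \<forall>c\<in>cells (M_inv H g) n. A \<psi> n c = slides_induced H ss n c))"

end

theory Submission
  imports Defs "HOL-Analysis.Complex_Transcendental"
begin

text \<open>
  The surface is a quotient of a \<open>4g\<close>-gon. In polar coordinates every point of the polygon lies in the open disc, in the
  union of the sectors around the midpoints of the sides, or in the union of the sectors around the corners, and each of
  these three sets contracts compatibly with the side pairing onto a set with finite image. Subdividing
  loops accordingly shows that the edge classes generate the fundamental group. Conversely, a tuple of elements of a group
  \<open>G\<close> satisfying the face relation glues the product of the polygon with \<open>G\<close> to a local system, whose holonomy is a
  homomorphism with the prescribed values on the edges. Hence \<open>Hom(\<pi>\<^sub>1(\<Sigma>), H\<^sub>n)\<close> is the set of zeros of the face relation in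
  \<open>H\<^sub>n\<close>, and since this identification is natural in the group, the action by precomposition commutes with all
  structure maps. When the edge \<open>y\<close> slides along \<open>x\<close>, the swept triangle shows that the class of the new edge is the
  product of the classes of \<open>x\<close> and \<open>y\<close>; so if a homomorphism takes given values on the edges of the old graph, its
  values on the new graph are obtained by the automorphism associated with the slide. A sequence of slides from the
  standard graph to its image under \<open>f\<close> therefore acts by precomposition with \<open>f\<close>, that is, as \<open>f\<inverse>\<close>.
\<close>

section \<open>The fundamental group\<close>

text \<open>Products in \<open>pi1\<close> read from right to left, so that the boundary of the
  polygon spells the face relation and holonomy is a homomorphism rather than an antihomomorphism.
  The pieces of a subdivided loop do not end at the base point; \<open>loopify\<close> therefore
  sends every path to the fundamental group, and calculations with paths become calculations in one
  group. The main obstacle is that a point of the surface may have several preimages in the polygon,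
  and the class of a segment from corner 1 depends on the preimage. For two preimages of one point
  the quotient of these classes is a product of corner words and their inverses, which is what
  generation rests on. Conversely, a tuple of labels prescribes how the fibres over such preimages
  are identified, and going once round the boundary closes up exactly by the face relation. Finally,
  each slide formula uses the labels of the current graph and not those of the standard graph; this
  is why the slide automorphisms are applied in the order of the sequence while their composite acts
  by precomposition.\<close>

lemma homotopic_paths_compose_interval:
  assumes "path p" "path_image p \<subseteq> S"
    and "path a" "path_image a \<subseteq> {0..1}" "path b" "path_image b \<subseteq> {0..1}"
    and "pathstart a = pathstart b" "pathfinish a = pathfinish b"
  shows "homotopic_paths S (p \<circ> a) (p \<circ> b)"
proof -
  have "simply_connected {0..1::real}"
    by (intro convex_imp_simply_connected) auto
  with assms have "homotopic_paths {0..1} a b"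
    by (simp add: simply_connected_eq_homotopic_paths)
  moreover have "continuous_on {0..1} p" "p \<in> {0..1} \<rightarrow> S"
    using assms by (auto simp: path_def path_image_def)
  ultimately show ?thesis
    by (rule homotopic_paths_continuous_image)
qed

text \<open>Convex sets are simply connected, and continuous images inherit homotopies. The
  relations read off from triangles, squares and the polygon all come from here.\<close>

lemma homotopic_paths_in_convex:
  fixes K :: "'a::real_normed_vector set"
  assumes "convex K" "continuous_on K f" "f ` K \<subseteq> S"
    and "path a" "path_image a \<subseteq> K" "path b" "path_image b \<subseteq> K"
    and "pathstart a = pathstart b" "pathfinish a = pathfinish b"
  shows "homotopic_paths S (f \<circ> a) (f \<circ> b)"
proof -
  have "simply_connected K"
    by (intro convex_imp_simply_connected assms)
  with assms have "homotopic_paths K a b"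
    by (simp add: simply_connected_eq_homotopic_paths)
  then show ?thesis
    using assms by (intro homotopic_paths_continuous_image) auto
qed

text \<open>Joining a path with a constant or with its reverse only reparametrises or retraces it,
  so the result is \<open>p\<close> after a path in the unit interval. The unit and inverse laws
  then follow from simple connectedness of the interval.\<close>

lemma join_compose_interval:
  "p +++ (\<lambda>_. pathfinish p) = p \<circ> ((\<lambda>t. t) +++ (\<lambda>_. 1))"
  "(\<lambda>_. pathstart p) +++ p = p \<circ> ((\<lambda>_. 0) +++ (\<lambda>t. t))"
  "p +++ reversepath p = p \<circ> ((\<lambda>t. t) +++ (\<lambda>t. 1 - t))"
  "reversepath p +++ p = p \<circ> ((\<lambda>t. 1 - t) +++ (\<lambda>t. t))"
  by (auto simp: fun_eq_iff joinpaths_def pathstart_def pathfinish_def reversepath_def)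

lemma unit_interval_paths [simp]:
  "path (\<lambda>t::real. t)" "path (\<lambda>t::real. 1 - t)" "path (\<lambda>t::real. c)"
  "path_image (\<lambda>t::real. t) = {0..1}" "path_image (\<lambda>t::real. 1 - t) = {0..1}"
  "path_image (\<lambda>t::real. d) = {d}"
  by (auto simp: path_def path_image_def intro!: continuous_intros image_eqI[of _ _ "1 - x" for x])

lemma homotopic_paths_join_const:
  assumes "path p" "path_image p \<subseteq> S"
  shows "homotopic_paths S (p +++ (\<lambda>_. pathfinish p)) p"
    and "homotopic_paths S ((\<lambda>_. pathstart p) +++ p) p"
    and "homotopic_paths S (p +++ reversepath p) (\<lambda>_. pathstart p)"
    and "homotopic_paths S (reversepath p +++ p) (\<lambda>_. pathfinish p)"
proof -
  have *: "homotopic_paths S (p \<circ> (a +++ b)) (p \<circ> c)"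
    if "path a" "path b" "path c" "path_image a \<subseteq> {0..1}" "path_image b \<subseteq> {0..1}" "path_image c \<subseteq> {0..1}"
      "pathfinish a = pathstart b" "pathstart a = pathstart c" "pathfinish b = pathfinish c" for a b c
    using that assms by (intro homotopic_paths_compose_interval) (auto simp: path_image_join)
  note P = pathstart_def pathfinish_def
  show "homotopic_paths S (p +++ (\<lambda>_. pathfinish p)) p"
    using *[of "\<lambda>t. t" "\<lambda>_. 1" "\<lambda>t. t"] by (simp add: join_compose_interval) (simp add: P o_def)
  show "homotopic_paths S ((\<lambda>_. pathstart p) +++ p) p"
    using *[of "\<lambda>_. 0" "\<lambda>t. t" "\<lambda>t. t"] by (simp add: join_compose_interval) (simp add: P o_def)
  show "homotopic_paths S (p +++ reversepath p) (\<lambda>_. pathstart p)"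
    using *[of "\<lambda>t. t" "\<lambda>t. 1 - t" "\<lambda>t. 0"] by (simp add: join_compose_interval) (simp add: P o_def)
  show "homotopic_paths S (reversepath p +++ p) (\<lambda>_. pathfinish p)"
    using *[of "\<lambda>t. 1 - t" "\<lambda>t. t" "\<lambda>t. 1"] by (simp add: join_compose_interval) (simp add: P o_def)
qed

section \<open>Paths with fixed ends, and the group structure on loop classes\<close>

definition paths_in :: "'p::topological_space set \<Rightarrow> 'p \<Rightarrow> 'p \<Rightarrow> (real \<Rightarrow> 'p) set" where
  "paths_in S x y = {p. path p \<and> path_image p \<subseteq> S \<and> pathstart p = x \<and> pathfinish p = y}"

lemma based_loops_eq: "based_loops S v = paths_in S v v"
  by (auto simp: based_loops_def paths_in_def)

lemma paths_in_join: "p \<in> paths_in S x y \<Longrightarrow> p' \<in> paths_in S y z \<Longrightarrow> p +++ p' \<in> paths_in S x z"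
  by (auto simp: paths_in_def path_image_join)

lemma paths_in_reverse: "p \<in> paths_in S x y \<Longrightarrow> reversepath p \<in> paths_in S y x"
  by (auto simp: paths_in_def)

lemma paths_in_const: "x \<in> S \<Longrightarrow> (\<lambda>_. x) \<in> paths_in S x x"
  by (auto simp: paths_in_def pathstart_def pathfinish_def)

lemma paths_in_subset: "p \<in> paths_in S x y \<Longrightarrow> x \<in> S \<and> y \<in> S"
  by (auto simp: paths_in_def)

lemma paths_in_compose:
  assumes "p \<in> paths_in S x y" "continuous_on S f" "f ` S \<subseteq> T"
  shows "f \<circ> p \<in> paths_in T (f x) (f y)"
proof -
  have "path (f \<circ> p)"
    using assms by (intro path_continuous_image) (auto simp: paths_in_def intro: continuous_on_subset)
  then show ?thesis
    using assms by (auto simp: paths_in_def path_image_compose pathstart_compose pathfinish_compose)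
qed

lemma loop_class_eq_iff:
  assumes "p \<in> paths_in S x y"
  shows "loop_class S p = loop_class S p' \<longleftrightarrow> homotopic_paths S p p'"
proof -
  have "homotopic_paths S p p" using assms by (simp add: paths_in_def)
  then show ?thesis
    unfolding loop_class_def by (blast intro: homotopic_paths_sym homotopic_paths_trans)
qed

lemma loop_class_eqI: "homotopic_paths S p p' \<Longrightarrow> loop_class S p = loop_class S p'"
  unfolding loop_class_def by (blast intro: homotopic_paths_sym homotopic_paths_trans)

text \<open>The product in \<open>pi1\<close> ranges over all representatives; it is a single class
  because joining respects homotopies. The order of the factors is opposite to the order in which
  the paths are run.\<close>

lemma pi1_mult:
  assumes "p \<in> paths_in S y z" "p' \<in> paths_in S x y"
  shows "loop_class S p \<otimes>\<^bsub>pi1 S v\<^esub> loop_class S p' = loop_class S (p' +++ p)"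
proof -
  have p: "homotopic_paths S p p" "homotopic_paths S p' p'" "pathfinish p' = pathstart p"
    using assms by (auto simp: paths_in_def)
  have "homotopic_paths S (p' +++ p) (r' +++ r)"
    if "homotopic_paths S p r" "homotopic_paths S p' r'" for r r'
    using that p by (intro homotopic_paths_join) auto
  then show ?thesis
    unfolding pi1_def loop_class_def monoid.simps mem_Collect_eq Bex_def
    using p(1,2) by (blast intro: homotopic_paths_trans)
qed

lemma carrier_pi1: "carrier (pi1 S v) = loop_class S ` paths_in S v v"
  by (simp add: pi1_def based_loops_eq)

lemma pi1_group:
  assumes "v \<in> S"
  shows "group (pi1 S v)"
proof (rule groupI)
  have one: "\<one>\<^bsub>pi1 S v\<^esub> = loop_class S (\<lambda>_. v)"
    by (simp add: pi1_def)
  show "\<one>\<^bsub>pi1 S v\<^esub> \<in> carrier (pi1 S v)"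
    using assms by (auto simp: one carrier_pi1 paths_in_const)
  show "x \<otimes>\<^bsub>pi1 S v\<^esub> y \<in> carrier (pi1 S v)" if H: "x \<in> carrier (pi1 S v)" "y \<in> carrier (pi1 S v)" for x y
    using that by (auto simp: carrier_pi1 pi1_mult paths_in_join)
  show "x \<otimes>\<^bsub>pi1 S v\<^esub> y \<otimes>\<^bsub>pi1 S v\<^esub> z = x \<otimes>\<^bsub>pi1 S v\<^esub> (y \<otimes>\<^bsub>pi1 S v\<^esub> z)"
    if H: "x \<in> carrier (pi1 S v)" "y \<in> carrier (pi1 S v)" "z \<in> carrier (pi1 S v)" for x y z
  proof -
    obtain a b c where "a \<in> paths_in S v v" "b \<in> paths_in S v v" "c \<in> paths_in S v v"
      "x = loop_class S a" "y = loop_class S b" "z = loop_class S c"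
      using H unfolding carrier_pi1 by blast
    moreover from this have "homotopic_paths S (c +++ b +++ a) ((c +++ b) +++ a)"
      by (intro homotopic_paths_assoc) (auto simp: paths_in_def)
    ultimately show ?thesis
      by (simp add: pi1_mult pi1_mult[OF paths_in_join] pi1_mult[OF _ paths_in_join] loop_class_eqI)
  qed
  show "\<one>\<^bsub>pi1 S v\<^esub> \<otimes>\<^bsub>pi1 S v\<^esub> x = x" if H: "x \<in> carrier (pi1 S v)" for x
  proof -
    obtain a where "a \<in> paths_in S v v" "x = loop_class S a" using H by (auto simp: carrier_pi1)
    moreover from this have "homotopic_paths S (a +++ (\<lambda>_. v)) a"
      using homotopic_paths_join_const(1)[of a S] by (simp add: paths_in_def)
    ultimately show ?thesis
      using assms by (simp add: one pi1_mult[OF paths_in_const] loop_class_eqI)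
  qed
  show "\<exists>y\<in>carrier (pi1 S v). y \<otimes>\<^bsub>pi1 S v\<^esub> x = \<one>\<^bsub>pi1 S v\<^esub>" if H: "x \<in> carrier (pi1 S v)" for x
  proof -
    obtain a where a: "a \<in> paths_in S v v" "x = loop_class S a" using H by (auto simp: carrier_pi1)
    moreover from this have "homotopic_paths S (a +++ reversepath a) (\<lambda>_. v)"
      using homotopic_paths_join_const(3)[of a S] by (simp add: paths_in_def)
    ultimately have "loop_class S (reversepath a) \<otimes>\<^bsub>pi1 S v\<^esub> x = \<one>\<^bsub>pi1 S v\<^esub>"
      by (simp add: one pi1_mult[OF paths_in_reverse] loop_class_eqI)
    then show ?thesis
      using a by (auto simp: carrier_pi1 paths_in_reverse)
  qed
qed

text \<open>At the base point the constant path is prescribed instead of an arbitrary choice, so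
  that \<open>loopify\<close> fixes the classes of loops at \<open>v\<close>.\<close>

definition connecting_path :: "'p::topological_space set \<Rightarrow> 'p \<Rightarrow> 'p \<Rightarrow> real \<Rightarrow> 'p" where
  "connecting_path S v x = (if x = v then (\<lambda>_. v) else (SOME p. p \<in> paths_in S v x))"

text \<open>A functor from the fundamental groupoid to the fundamental group that is the identity on
  loops at the base point; it turns computations with paths into computations in a group.\<close>

definition loopify :: "'p::topological_space set \<Rightarrow> 'p \<Rightarrow> (real \<Rightarrow> 'p) \<Rightarrow> (real \<Rightarrow> 'p) set" where
  "loopify S v p = loop_class S
     (connecting_path S v (pathstart p) +++ p +++ reversepath (connecting_path S v (pathfinish p)))"

section \<open>Calculus of paths in a path-connected space with base point\<close>

locale pointed_space =
  fixes S :: "'p::topological_space set" and v :: 'p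
  assumes v_in: "v \<in> S" and path_conn: "path_connected S"
begin

abbreviation "\<pi>\<^sub>1 \<equiv> pi1 S v"

sublocale pi1: group \<pi>\<^sub>1
  by (rule pi1_group[OF v_in])

lemma connecting_path: "x \<in> S \<Longrightarrow> connecting_path S v x \<in> paths_in S v x"
proof -
  assume "x \<in> S"
  then have "\<exists>p. p \<in> paths_in S v x"
    using path_conn v_in by (auto simp: path_connected_def paths_in_def)
  then have "(SOME p. p \<in> paths_in S v x) \<in> paths_in S v x"
    by (rule someI_ex)
  then show ?thesis
    using v_in by (auto simp: connecting_path_def paths_in_const)
qed

lemma loopify_eq:
  assumes "p \<in> paths_in S x y"
  shows "loopify S v p = loop_class S (connecting_path S v x +++ p +++ reversepath (connecting_path S v y))"
  using assms by (simp add: loopify_def paths_in_def)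

lemma loopify_closed [simp]:
  assumes "p \<in> paths_in S x y"
  shows "loopify S v p \<in> carrier \<pi>\<^sub>1"
  unfolding loopify_eq[OF assms] carrier_pi1
  using paths_in_subset[OF assms] assms connecting_path
  by (intro imageI paths_in_join[of _ _ _ x] paths_in_join[of _ _ _ y] paths_in_reverse) auto

lemma loopify_homotopic:
  assumes "homotopic_paths S p p'"
  shows "loopify S v p = loopify S v p'"
proof -
  have p: "p \<in> paths_in S (pathstart p) (pathfinish p)"
    using homotopic_paths_imp_path[OF assms] homotopic_paths_imp_subset[OF assms] by (simp add: paths_in_def)
  have e: "pathstart p' = pathstart p" "pathfinish p' = pathfinish p"
    using assms by (auto simp: homotopic_paths_imp_pathstart homotopic_paths_imp_pathfinish)
  have c: "connecting_path S v (pathstart p) \<in> paths_in S v (pathstart p)"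
     "connecting_path S v (pathfinish p) \<in> paths_in S v (pathfinish p)"
    using paths_in_subset[OF p] connecting_path by auto
  then show ?thesis
    unfolding loopify_def e
    by (intro loop_class_eqI homotopic_paths_join assms) (auto simp: paths_in_def)
qed

text \<open>Between the two transported paths the connecting path to \<open>y\<close> is run
  backwards and then forwards, and cancels.\<close>

lemma loopify_join:
  assumes p: "p \<in> paths_in S x y" and p': "p' \<in> paths_in S y z"
  shows "loopify S v (p +++ p') = loopify S v p' \<otimes>\<^bsub>\<pi>\<^sub>1\<^esub> loopify S v p"
proof -
  note [trans] = homotopic_paths_trans
  let ?c = "connecting_path S v"
  define a b d where "a = ?c x" and "b = ?c y" and "d = reversepath (?c z)"
  have a: "a \<in> paths_in S v x" and b: "b \<in> paths_in S v y" and d: "d \<in> paths_in S z v"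
    using paths_in_subset[OF p] paths_in_subset[OF p'] connecting_path
    by (auto simp: a_def b_def d_def paths_in_reverse)
  have rb: "reversepath b \<in> paths_in S y v" using b by (rule paths_in_reverse)
  have assoc: "homotopic_paths S (r +++ s +++ t) ((r +++ s) +++ t)"
    if "r \<in> paths_in S x1 x2" "s \<in> paths_in S x2 x3" "t \<in> paths_in S x3 x4" for r s t x1 x2 x3 x4
    using that by (intro homotopic_paths_assoc) (auto simp: paths_in_def)
  note J = paths_in_join
  have "homotopic_paths S ((a +++ p +++ reversepath b) +++ b +++ p' +++ d) (a +++ (p +++ reversepath b) +++ b +++ p' +++ d)"
    by (rule homotopic_paths_sym, rule assoc) (fact a J[OF p rb] J[OF b J[OF p' d]])+
  also have "homotopic_paths S \<dots> (a +++ p +++ reversepath b +++ b +++ p' +++ d)"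
    by (rule homotopic_paths_join, use a in \<open>simp add: paths_in_def\<close>, rule homotopic_paths_sym, rule assoc[OF p rb J[OF b J[OF p' d]]])
       (use a p in \<open>auto simp: paths_in_def\<close>)
  also have "homotopic_paths S \<dots> (a +++ p +++ p' +++ d)"
  proof (rule homotopic_paths_join, use a in \<open>simp add: paths_in_def\<close>, rule homotopic_paths_join, use p in \<open>simp add: paths_in_def\<close>)
    have "homotopic_paths S (reversepath b +++ b +++ p' +++ d) ((reversepath b +++ b) +++ p' +++ d)"
      by (rule assoc[OF rb b J[OF p' d]])
    also have "homotopic_paths S \<dots> ((\<lambda>_. y) +++ p' +++ d)"
    proof (rule homotopic_paths_join)
      show "homotopic_paths S (reversepath b +++ b) (\<lambda>_. y)"
        using homotopic_paths_join_const(4)[of b S] b by (simp add: paths_in_def)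
    qed (use b J[OF p' d] in \<open>auto simp: paths_in_def\<close>)
    also have "homotopic_paths S \<dots> (p' +++ d)"
      using homotopic_paths_join_const(2)[of "p' +++ d" S] J[OF p' d] by (simp add: paths_in_def)
    finally show "homotopic_paths S (reversepath b +++ b +++ p' +++ d) (p' +++ d)" .
  qed (use a p b in \<open>auto simp: paths_in_def\<close>)
  also have "homotopic_paths S \<dots> (a +++ (p +++ p') +++ d)"
    by (rule homotopic_paths_join, use a in \<open>simp add: paths_in_def\<close>, rule assoc[OF p p' d])
       (use a p in \<open>auto simp: paths_in_def\<close>)
  finally show ?thesis
    unfolding loopify_eq[OF p] loopify_eq[OF p'] loopify_eq[OF J[OF p p']]
    using pi1_mult[OF J[OF b J[OF p' d]] J[OF a J[OF p rb]]]
    unfolding a_def b_def d_def by (simp add: loop_class_eqI)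
qed

text \<open>A constant path joined with itself is homotopic to itself, so its class is an idempotent
  of a group.\<close>

lemma loopify_const [simp]:
  assumes "x \<in> S"
  shows "loopify S v (\<lambda>_. x) = \<one>\<^bsub>\<pi>\<^sub>1\<^esub>"
proof -
  have c: "(\<lambda>_. x) \<in> paths_in S x x" using assms by (rule paths_in_const)
  have "homotopic_paths S ((\<lambda>_. x) +++ (\<lambda>_. x)) (\<lambda>_. x)"
    using homotopic_paths_join_const(1)[of "\<lambda>_. x" S] c by (simp add: paths_in_def)
  then have "loopify S v (\<lambda>_. x) \<otimes>\<^bsub>\<pi>\<^sub>1\<^esub> loopify S v (\<lambda>_. x) = loopify S v (\<lambda>_. x)"
    unfolding loopify_join[OF c c, symmetric] by (rule loopify_homotopic)
  then show ?thesis
    using loopify_closed[OF c] by (simp add: pi1.l_cancel_one)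
qed

lemma loopify_reverse:
  assumes "p \<in> paths_in S x y"
  shows "loopify S v (reversepath p) = inv\<^bsub>\<pi>\<^sub>1\<^esub> (loopify S v p)"
proof -
  have "homotopic_paths S (p +++ reversepath p) (\<lambda>_. x)"
    using homotopic_paths_join_const(3)[of p S] assms by (simp add: paths_in_def)
  from loopify_homotopic[OF this]
  have "loopify S v (reversepath p) \<otimes>\<^bsub>\<pi>\<^sub>1\<^esub> loopify S v p = \<one>\<^bsub>\<pi>\<^sub>1\<^esub>"
    using loopify_join[OF assms paths_in_reverse[OF assms]] paths_in_subset[OF assms] by simp
  then show ?thesis
    using assms paths_in_reverse[OF assms] pi1.inv_equality by (metis loopify_closed)
qed

lemma loopify_loop:
  assumes "p \<in> paths_in S v v"
  shows "loopify S v p = loop_class S p"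
proof -
  note [trans] = homotopic_paths_trans
  have p: "path p" "path_image p \<subseteq> S" "pathstart p = v" "pathfinish p = v"
    using assms by (auto simp: paths_in_def)
  have c: "connecting_path S v v = (\<lambda>_. v)" "reversepath (\<lambda>_. v) = (\<lambda>_. v)"
    by (auto simp: connecting_path_def reversepath_def)
  have "homotopic_paths S ((\<lambda>_. v) +++ p +++ (\<lambda>_. v)) (p +++ (\<lambda>_. v))"
    using homotopic_paths_join_const(2)[of "p +++ (\<lambda>_. v)" S] paths_in_join[OF assms paths_in_const[OF v_in]]
    by (simp add: paths_in_def)
  also have "homotopic_paths S \<dots> p"
    using homotopic_paths_join_const(1)[of p S] p by simp
  finally show ?thesis
    unfolding loopify_eq[OF assms] c by (rule loop_class_eqI)
qed

lemma carrier_pi1_loopify: "carrier \<pi>\<^sub>1 = loopify S v ` paths_in S v v"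
  by (simp add: carrier_pi1 loopify_loop cong: image_cong)

lemma loopify_cong:
  assumes "p \<in> paths_in S x y" "\<And>t. t \<in> {0..1} \<Longrightarrow> p t = p' t"
  shows "loopify S v p = loopify S v p'"
  using assms by (intro loopify_homotopic homotopic_paths_eq) (auto simp: paths_in_def)

lemma paths_in_convex:
  fixes K :: "'a::real_normed_vector set"
  assumes "continuous_on K f" "f ` K \<subseteq> S" "path a" "path_image a \<subseteq> K"
  shows "f \<circ> a \<in> paths_in S (f (pathstart a)) (f (pathfinish a))"
  using assms by (intro paths_in_compose[of _ K]) (auto simp: paths_in_def)

lemma loopify_convex:
  fixes K :: "'a::real_normed_vector set"
  assumes "convex K" "continuous_on K f" "f ` K \<subseteq> S"
    and "path a" "path_image a \<subseteq> K" "path b" "path_image b \<subseteq> K"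
    and "pathstart a = pathstart b" "pathfinish a = pathfinish b"
  shows "loopify S v (f \<circ> a) = loopify S v (f \<circ> b)"
  by (intro loopify_homotopic homotopic_paths_in_convex[of K] assms)

text \<open>The two ways round a square are homotopic because the square is convex. This is the form
  in which homotopies with moving end points are used.\<close>

lemma loopify_square:
  fixes K :: "real \<times> real \<Rightarrow> 'p"
  assumes K: "continuous_on ({0..1} \<times> {0..1}) K" "K ` ({0..1} \<times> {0..1}) \<subseteq> S"
  shows "loopify S v (\<lambda>t. K (1, t)) \<otimes>\<^bsub>\<pi>\<^sub>1\<^esub> loopify S v (\<lambda>t. K (t, 0))
    = loopify S v (\<lambda>t. K (t, 1)) \<otimes>\<^bsub>\<pi>\<^sub>1\<^esub> loopify S v (\<lambda>t. K (0, t))"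
proof -
  let ?Q = "{0..1} \<times> {0..1} :: (real \<times> real) set"
  define a b c d where abcd: "a = (\<lambda>t::real. (t, 0::real))" "b = (\<lambda>t::real. (1::real, t))" "c = (\<lambda>t::real. (0::real, t))" "d = (\<lambda>t::real. (t, 1::real))"
  have P: "path a" "path b" "path c" "path d" "path_image a \<subseteq> ?Q" "path_image b \<subseteq> ?Q" "path_image c \<subseteq> ?Q" "path_image d \<subseteq> ?Q"
    "pathfinish a = pathstart b" "pathfinish c = pathstart d" "pathstart a = pathstart c" "pathfinish b = pathfinish d"
    unfolding abcd by (auto simp: path_def path_image_def pathstart_def pathfinish_def intro!: continuous_intros)
  have "loopify S v (K \<circ> (a +++ b)) = loopify S v (K \<circ> (c +++ d))"
    using P by (intro loopify_convex[OF _ K] convex_Times) (auto simp: path_image_join)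
  moreover note in1 = paths_in_convex[OF K P(1,5)] paths_in_convex[OF K P(2,6)] paths_in_convex[OF K P(3,7)] paths_in_convex[OF K P(4,8)]
  ultimately show ?thesis
    unfolding path_compose_join
    using loopify_join[OF in1(1), of "K \<circ> b" "K (pathfinish b)"] loopify_join[OF in1(3), of "K \<circ> d" "K (pathfinish d)"] in1 P
    by (simp add: abcd o_def)
qed

end

section \<open>Mapping class groups\<close>

lemma subgroup_BijGroup:
  assumes "K \<subseteq> Bij S" "(\<lambda>x\<in>S. x) \<in> K"
    and "\<And>f g. f \<in> K \<Longrightarrow> g \<in> K \<Longrightarrow> compose S f g \<in> K"
    and "\<And>f. f \<in> K \<Longrightarrow> (\<lambda>x\<in>S. inv_into S f x) \<in> K"
  shows "subgroup K (BijGroup S)"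
proof (rule group.subgroupI[OF group_BijGroup])
  show "inv\<^bsub>BijGroup S\<^esub> f \<in> K" if "f \<in> K" for f
    using assms that by (simp add: inv_BijGroup subset_iff)
  show "f \<otimes>\<^bsub>BijGroup S\<^esub> h \<in> K" if "f \<in> K" "h \<in> K" for f h
    using assms that by (auto simp: BijGroup_def)
qed (use assms in \<open>auto simp: BijGroup_def\<close>)

lemma homeomorphic_map_compose_restrict:
  assumes "homeomorphic_map (top_of_set S) (top_of_set S) f" "homeomorphic_map (top_of_set S) (top_of_set S) h"
  shows "homeomorphic_map (top_of_set S) (top_of_set S) (compose S f h)"
  using homeomorphic_map_compose[OF assms(2,1)] by (rule homeomorphic_map_eq) (simp add: compose_def)

lemma homeomorphic_map_inv_into:
  assumes "homeomorphic_map (top_of_set S) (top_of_set S) f"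
  shows "homeomorphic_map (top_of_set S) (top_of_set S) (\<lambda>x\<in>S. inv_into S f x)"
proof -
  obtain h where h: "homeomorphic_maps (top_of_set S) (top_of_set S) f h"
    using assms by (auto simp: homeomorphic_map_maps)
  then have "homeomorphic_map (top_of_set S) (top_of_set S) h"
    using homeomorphic_map_maps homeomorphic_maps_sym by blast
  then show ?thesis
  proof (rule homeomorphic_map_eq)
    fix x assume "x \<in> topspace (top_of_set S)"
    then have x: "x \<in> S" "h x \<in> S" "f (h x) = x"
      using h by (auto simp: homeomorphic_maps_def continuous_map_def)
    have "inj_on f S"
      using assms by (simp add: homeomorphic_eq_everything_map)
    from inv_into_f_f[OF this x(2)] show "h x = (\<lambda>x\<in>S. inv_into S f x) x"
      using x by simp
  qed
qed

lemma homeomorphic_map_continuous_on: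
  assumes "homeomorphic_map (top_of_set S) (top_of_set S) f"
  shows "continuous_on S f" "f ` S = S"
  using assms by (auto simp: homeomorphic_eq_everything_map)

section \<open>Orientation-preserving homeomorphisms and their homotopy classes\<close>

lemma orientation_preserving_cong:
  assumes "\<And>x. x \<in> S \<Longrightarrow> f x = h x"
  shows "orientation_preserving S f \<longleftrightarrow> orientation_preserving S h"
  unfolding orientation_preserving_def
  using hom_induced_eq[of "top_of_set S" f h] assms by simp

lemma orientation_preserving_compose:
  assumes "continuous_map (top_of_set S) (top_of_set S) f" "continuous_map (top_of_set S) (top_of_set S) h"
    and "orientation_preserving S f" "orientation_preserving S h"
  shows "orientation_preserving S (f \<circ> h)"
  using assms hom_induced_compose_empty[OF assms(2,1)]
  by (simp add: orientation_preserving_def)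

lemma orientation_preserving_id:
  assumes "continuous_map (top_of_set S) (top_of_set S) f" "\<And>x. x \<in> S \<Longrightarrow> f x = x"
  shows "orientation_preserving S f"
  using assms hom_induced_id_gen[of "top_of_set S" f] by (auto simp: orientation_preserving_def)

text \<open>On homology the composite is the identity and \<open>f\<close> already acts trivially,
  so nothing is left for \<open>h\<close> to do.\<close>

lemma orientation_preserving_left_inverse:
  assumes "continuous_map (top_of_set S) (top_of_set S) f" "continuous_map (top_of_set S) (top_of_set S) h"
    and "orientation_preserving S f" "\<And>x. x \<in> S \<Longrightarrow> h (f x) = x"
  shows "orientation_preserving S h"
proof -
  have "orientation_preserving S (h \<circ> f)"
    using assms by (intro orientation_preserving_id continuous_map_compose[of _ "top_of_set S"]) auto
  then show ?thesis
    using assms hom_induced_compose_empty[OF assms(1,2)] by (simp add: orientation_preserving_def)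
qed

lemma id_homeo: "homeomorphic_map (top_of_set S) (top_of_set S) (\<lambda>x\<in>S. x)"
  by (rule homeomorphic_map_eq[of _ _ id]) (auto simp: homeomorphic_map_id)

lemma subgroup_homeo_group: "subgroup (carrier (homeo_group S)) (BijGroup S)"
proof (rule subgroup_BijGroup)
  let ?X = "top_of_set S"
  note C = homeomorphic_imp_continuous_map
  show "(\<lambda>x\<in>S. x) \<in> carrier (homeo_group S)"
    using id_homeo[of S] by (auto simp: homeo_group_def id_Bij intro!: orientation_preserving_id C)
  fix f assume f: "f \<in> carrier (homeo_group S)"
  then have f': "f \<in> Bij S" "homeomorphic_map ?X ?X f" "orientation_preserving S f"
    by (auto simp: homeo_group_def)
  show "compose S f h \<in> carrier (homeo_group S)" if "h \<in> carrier (homeo_group S)" for h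
  proof -
    have h: "h \<in> Bij S" "homeomorphic_map ?X ?X h" "orientation_preserving S h"
      using that by (auto simp: homeo_group_def)
    have "orientation_preserving S (f \<circ> h)"
      using f' h by (intro orientation_preserving_compose C)
    then have "orientation_preserving S (compose S f h)"
      by (subst orientation_preserving_cong[of _ _ "f \<circ> h"]) (auto simp: compose_def)
    then show ?thesis
      using f' h by (auto simp: homeo_group_def compose_Bij homeomorphic_map_compose_restrict)
  qed
  have "orientation_preserving S (\<lambda>x\<in>S. inv_into S f x)"
  proof (rule orientation_preserving_left_inverse[of S f])
    show "(\<lambda>x\<in>S. inv_into S f x) (f x) = x" if "x \<in> S" for x
      using f'(1) that by (auto simp: Bij_def bij_betw_def)
  qed (fact C[OF f'(2)] C[OF homeomorphic_map_inv_into[OF f'(2)]] f'(3))+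
  then show "(\<lambda>x\<in>S. inv_into S f x) \<in> carrier (homeo_group S)"
    using f' by (auto simp: homeo_group_def restrict_inv_into_Bij homeomorphic_map_inv_into)
qed (auto simp: homeo_group_def)

lemma homeo_group_eq: "homeo_group S = (BijGroup S)\<lparr>carrier := carrier (homeo_group S)\<rparr>"
  by (simp add: homeo_group_def)

lemma group_homeo_group: "group (homeo_group S)"
  by (subst homeo_group_eq, rule subgroup.subgroup_is_group[OF subgroup_homeo_group group_BijGroup])

lemma homeo_groupD:
  assumes "f \<in> carrier (homeo_group S)"
  shows "f \<in> Bij S" "homeomorphic_map (top_of_set S) (top_of_set S) f"
    "continuous_on S f" "f ` S = S"
  using assms homeomorphic_map_continuous_on[of S f] by (auto simp: homeo_group_def)

lemma homeo_group_mult: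
  assumes "f \<in> carrier (homeo_group S)" "h \<in> carrier (homeo_group S)"
  shows "f \<otimes>\<^bsub>homeo_group S\<^esub> h = compose S f h"
  using assms by (simp add: homeo_group_def BijGroup_def)

lemma homeo_group_inv:
  assumes "f \<in> carrier (homeo_group S)"
  shows "inv\<^bsub>homeo_group S\<^esub> f = (\<lambda>x\<in>S. inv_into S f x)"
  using group.m_inv_consistent[OF group_BijGroup subgroup_homeo_group assms]
    inv_BijGroup[OF homeo_groupD(1)[OF assms]] by (metis homeo_group_eq)

lemma homeo_group_one: "\<one>\<^bsub>homeo_group S\<^esub> = (\<lambda>x\<in>S. x)"
  by (simp add: homeo_group_def BijGroup_def)

abbreviation homotopic_self :: "'p::topological_space set \<Rightarrow> ('p \<Rightarrow> 'p) \<Rightarrow> ('p \<Rightarrow> 'p) \<Rightarrow> bool" where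
  "homotopic_self S \<equiv> homotopic_with (\<lambda>_. True) (top_of_set S) (top_of_set S)"

lemma homotopic_self_refl: "f \<in> carrier (homeo_group S) \<Longrightarrow> homotopic_self S f f"
  using homeomorphic_imp_continuous_map[OF homeo_groupD(2)] unfolding homotopic_with_refl by blast

lemma homotopic_self_compose:
  assumes "homotopic_self S f f'" "homotopic_self S h h'"
  shows "homotopic_self S (f \<circ> h) (f' \<circ> h')"
proof (rule homotopic_with_trans)
  show "homotopic_self S (f \<circ> h) (f' \<circ> h)"
    using homotopic_with_imp_continuous_maps[OF assms(2)]
    by (intro homotopic_with_compose_continuous_map_right[OF assms(1)]) auto
  show "homotopic_self S (f' \<circ> h) (f' \<circ> h')"
    using homotopic_with_imp_continuous_maps[OF assms(1)]
    by (intro homotopic_with_compose_continuous_map_left[OF assms(2)]) auto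
qed

lemma homotopic_self_cong:
  assumes "\<And>x. x \<in> S \<Longrightarrow> f x = f' x" "\<And>x. x \<in> S \<Longrightarrow> h x = h' x"
  shows "homotopic_self S f h \<longleftrightarrow> homotopic_self S f' h'"
proof
  show "homotopic_self S f' h'" if "homotopic_self S f h"
    using that by (rule homotopic_with_eq) (simp_all add: assms)
  show "homotopic_self S f h" if "homotopic_self S f' h'"
    using that by (rule homotopic_with_eq) (simp_all add: assms)
qed

text \<open>Composition respects homotopies, so conjugating a map homotopic to the identity gives a
  map homotopic to the conjugate of the identity. Composing the homotopy with the inverse map
  settles inverses.\<close>

lemma normal_homeo_null: "homeo_null S \<lhd> homeo_group S"
proof -
  interpret G: group "homeo_group S" by (rule group_homeo_group)
  let ?G = "homeo_group S"
  note refl = homotopic_self_refl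
  have S: "h x \<in> S" if "h \<in> carrier ?G" "x \<in> S" for h x
    using homeo_groupD(4)[OF that(1)] that by auto
  have compose: "homotopic_self S (f \<otimes>\<^bsub>?G\<^esub> h) (f' \<circ> h')"
    if "f \<in> carrier ?G" "h \<in> carrier ?G" "homotopic_self S f f'" "homotopic_self S h h'" for f h f' h'
    using homotopic_self_compose[OF that(3,4)] that(1,2)
    by (subst homotopic_self_cong[of S _ "f \<circ> h" _ "f' \<circ> h'"]) (auto simp: homeo_group_mult compose_def)
  have inv: "(inv\<^bsub>?G\<^esub> f) (f x) = x" "f ((inv\<^bsub>?G\<^esub> f) x) = x" if "f \<in> carrier ?G" "x \<in> S" for f x
    using homeo_groupD(1)[OF that(1)] that S[OF that]
    by (auto simp: homeo_group_inv Bij_def bij_betw_def inv_into_f_f f_inv_into_f)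
  have "subgroup (homeo_null S) ?G"
  proof (rule G.subgroupI)
    show "homeo_null S \<subseteq> carrier ?G" by (auto simp: homeo_null_def)
    have "homotopic_self S \<one>\<^bsub>?G\<^esub> id"
      using refl[OF G.one_closed] by (subst homotopic_self_cong[of S _ "\<one>\<^bsub>?G\<^esub>" _ "\<one>\<^bsub>?G\<^esub>"]) (auto simp: homeo_group_one)
    then show "homeo_null S \<noteq> {}"
      using G.one_closed by (auto simp: homeo_null_def)
    fix f assume f: "f \<in> homeo_null S"
    then have f': "f \<in> carrier ?G" "homotopic_self S f id" by (auto simp: homeo_null_def)
    show "f \<otimes>\<^bsub>?G\<^esub> h \<in> homeo_null S" if "h \<in> homeo_null S" for h
      using compose[of f h id id] f' that by (auto simp: homeo_null_def)
    have "homotopic_self S (inv\<^bsub>?G\<^esub> f \<otimes>\<^bsub>?G\<^esub> f) (inv\<^bsub>?G\<^esub> f \<circ> id)"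
      using f' by (intro compose refl) auto
    then have "homotopic_self S id (inv\<^bsub>?G\<^esub> f)"
      using f' by (subst homotopic_self_cong[of S _ "\<one>\<^bsub>?G\<^esub>" _ "inv\<^bsub>?G\<^esub> f"]) (auto simp: homeo_group_one)
    then show "inv\<^bsub>?G\<^esub> f \<in> homeo_null S"
      using f' by (auto simp: homeo_null_def homotopic_with_sym)
  qed
  moreover have "h \<otimes>\<^bsub>?G\<^esub> f \<otimes>\<^bsub>?G\<^esub> inv\<^bsub>?G\<^esub> h \<in> homeo_null S"
    if "h \<in> carrier ?G" "f \<in> homeo_null S" for h f
  proof -
    have f': "f \<in> carrier ?G" "homotopic_self S f id" using that by (auto simp: homeo_null_def)
    have "homotopic_self S (h \<otimes>\<^bsub>?G\<^esub> f \<otimes>\<^bsub>?G\<^esub> inv\<^bsub>?G\<^esub> h) ((h \<circ> id) \<circ> inv\<^bsub>?G\<^esub> h)"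
      using f' that by (intro compose refl) auto
    then have "homotopic_self S (h \<otimes>\<^bsub>?G\<^esub> f \<otimes>\<^bsub>?G\<^esub> inv\<^bsub>?G\<^esub> h) id"
      by (rule homotopic_self_cong[THEN iffD1, rotated 2]) (use inv that in auto)
    then show ?thesis
      using f' that by (auto simp: homeo_null_def)
  qed
  ultimately show ?thesis
    unfolding G.normal_inv_iff by blast
qed

lemma group_mcg: "group (mcg S)"
  unfolding mcg_def by (rule normal.factorgroup_is_group[OF normal_homeo_null])

lemma mcg_class:
  assumes "\<phi> \<in> carrier (mcg S)"
  obtains f where "f \<in> carrier (homeo_group S)" "\<phi> = homeo_null S #>\<^bsub>homeo_group S\<^esub> f" "f \<in> \<phi>"
proof -
  interpret N: normal "homeo_null S" "homeo_group S" by (rule normal_homeo_null)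
  from assms obtain f where f: "f \<in> carrier (homeo_group S)" "\<phi> = homeo_null S #>\<^bsub>homeo_group S\<^esub> f"
    unfolding mcg_def FactGroup_def RCOSETS_def partial_object.simps by blast
  moreover from f have "f \<in> \<phi>"
    using N.rcos_self[OF f(1)] N.subgroup_axioms by simp
  ultimately show thesis by (rule that)
qed

lemma mcg_classI:
  "f \<in> carrier (homeo_group S) \<Longrightarrow> homeo_null S #>\<^bsub>homeo_group S\<^esub> f \<in> carrier (mcg S)"
  by (auto simp: mcg_def FactGroup_def RCOSETS_def)

lemma coset_homotopic:
  assumes "f \<in> carrier (homeo_group S)" "f' \<in> homeo_null S #>\<^bsub>homeo_group S\<^esub> f"
  shows "f' \<in> carrier (homeo_group S)" "homotopic_self S f' f"
proof -
  interpret G: group "homeo_group S" by (rule group_homeo_group)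
  obtain n where n: "n \<in> carrier (homeo_group S)" "homotopic_self S n id" "f' = n \<otimes>\<^bsub>homeo_group S\<^esub> f"
    using assms by (auto simp: r_coset_def homeo_null_def)
  then show "f' \<in> carrier (homeo_group S)" using assms by simp
  from homotopic_self_compose[OF n(2) homotopic_self_refl[OF assms(1)]] show "homotopic_self S f' f"
    by (rule homotopic_self_cong[THEN iffD1, rotated 2]) (use n assms in \<open>auto simp: homeo_group_mult compose_def\<close>)
qed

text \<open>The homotopy between two representatives may move the base point; this is where inner
  automorphisms come from later.\<close>

lemma mcg_elements:
  assumes "\<phi> \<in> carrier (mcg S)" "f \<in> \<phi>" "f' \<in> \<phi>"
  shows "f \<in> carrier (homeo_group S)" "homotopic_self S f f'"
proof -
  obtain h where h: "h \<in> carrier (homeo_group S)" "\<phi> = homeo_null S #>\<^bsub>homeo_group S\<^esub> h"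
    using assms(1) by (rule mcg_class)
  note f = coset_homotopic[OF h(1) assms(2)[unfolded h(2)]]
    and f' = coset_homotopic[OF h(1) assms(3)[unfolded h(2)]]
  show "f \<in> carrier (homeo_group S)" by (rule f(1))
  show "homotopic_self S f f'"
    by (rule homotopic_with_trans[OF f(2) homotopic_with_symD[OF f'(2)]])
qed

lemma mcg_mult:
  assumes "\<phi> \<in> carrier (mcg S)" "\<psi> \<in> carrier (mcg S)" "f \<in> \<phi>" "h \<in> \<psi>"
  shows "compose S f h \<in> \<phi> \<otimes>\<^bsub>mcg S\<^esub> \<psi>"
  unfolding homeo_group_mult[OF mcg_elements(1)[OF assms(1,3,3)] mcg_elements(1)[OF assms(2,4,4)], symmetric]
  using assms(3,4) by (auto simp: mcg_def FactGroup_def set_mult_def)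

lemma mcg_one: "(\<lambda>x\<in>S. x) \<in> \<one>\<^bsub>mcg S\<^esub>"
proof -
  interpret N: normal "homeo_null S" "homeo_group S" by (rule normal_homeo_null)
  show ?thesis
    using subgroup.one_closed[OF N.subgroup_axioms] by (simp add: mcg_def FactGroup_def homeo_group_one)
qed

section \<open>The action on representation varieties\<close>

text \<open>Bijectivity follows from the laws, with the action of the inverse as witness.
  Extensionality is asked for because the elements of \<open>BijGroup\<close> are extensional
  maps.\<close>

lemma group_actionI:
  assumes "group K" "\<And>k. k \<in> carrier K \<Longrightarrow> A k \<in> extensional E"
    and "\<And>k x. k \<in> carrier K \<Longrightarrow> x \<in> E \<Longrightarrow> A k x \<in> E"
    and "\<And>x. x \<in> E \<Longrightarrow> A \<one>\<^bsub>K\<^esub> x = x"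
    and "\<And>k l x. k \<in> carrier K \<Longrightarrow> l \<in> carrier K \<Longrightarrow> x \<in> E \<Longrightarrow> A (k \<otimes>\<^bsub>K\<^esub> l) x = A k (A l x)"
  shows "group_action K E A"
proof -
  interpret K: group K by (rule assms)
  have inv: "A (inv\<^bsub>K\<^esub> k) (A k x) = x" "A k (A (inv\<^bsub>K\<^esub> k) x) = x" if "k \<in> carrier K" "x \<in> E" for k x
    using that by (simp_all add: assms(4) flip: assms(5))
  have bij: "A k \<in> Bij E" if "k \<in> carrier K" for k
  proof -
    have "bij_betw (A k) E E"
      by (rule bij_betw_byWitness[of _ "A (inv\<^bsub>K\<^esub> k)"]) (use that inv assms(3) in auto)
    then show ?thesis using assms(2)[OF that] by (simp add: Bij_def)
  qed
  have "A \<in> hom K (BijGroup E)"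
  proof (rule homI)
    show "A k \<in> carrier (BijGroup E)" if "k \<in> carrier K" for k
      using bij[OF that] by (simp add: BijGroup_def)
    show "A (k \<otimes>\<^bsub>K\<^esub> l) = A k \<otimes>\<^bsub>BijGroup E\<^esub> A l" if "k \<in> carrier K" "l \<in> carrier K" for k l
    proof (rule extensionalityI[of _ E])
      show "A (k \<otimes>\<^bsub>K\<^esub> l) \<in> extensional E" using assms(2) that by simp
      show "A k \<otimes>\<^bsub>BijGroup E\<^esub> A l \<in> extensional E"
        using bij that by (simp add: BijGroup_def compose_def)
      show "A (k \<otimes>\<^bsub>K\<^esub> l) x = (A k \<otimes>\<^bsub>BijGroup E\<^esub> A l) x" if "x \<in> E" for x
        using bij \<open>k \<in> carrier K\<close> \<open>l \<in> carrier K\<close> that by (simp add: BijGroup_def compose_def assms(5))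
    qed
  qed
  then show ?thesis
    by (simp add: group_action_def group_hom_def group_hom_axioms_def group_BijGroup K.group_axioms)
qed

section \<open>Representations up to conjugation\<close>

lemma rep_class_self:
  assumes "group P" "group G" "\<rho> \<in> reps P G"
  shows "\<rho> \<in> rep_class P G \<rho>"
proof -
  interpret G: group G by fact
  have "\<rho> = (\<lambda>x\<in>carrier P. \<one>\<^bsub>G\<^esub> \<otimes>\<^bsub>G\<^esub> \<rho> x \<otimes>\<^bsub>G\<^esub> inv\<^bsub>G\<^esub> \<one>\<^bsub>G\<^esub>)"
    using assms(3) by (intro extensionalityI[of _ "carrier P"]) (auto simp: reps_def hom_def Pi_iff)
  then show ?thesis unfolding rep_class_def using G.one_closed by blast
qed

lemma conj_conj:
  assumes "group G" "h \<in> carrier G" "k \<in> carrier G" "x \<in> carrier G"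
  shows "k \<otimes>\<^bsub>G\<^esub> (h \<otimes>\<^bsub>G\<^esub> x \<otimes>\<^bsub>G\<^esub> inv\<^bsub>G\<^esub> h) \<otimes>\<^bsub>G\<^esub> inv\<^bsub>G\<^esub> k = (k \<otimes>\<^bsub>G\<^esub> h) \<otimes>\<^bsub>G\<^esub> x \<otimes>\<^bsub>G\<^esub> inv\<^bsub>G\<^esub> (k \<otimes>\<^bsub>G\<^esub> h)"
proof -
  interpret G: group G by fact
  show ?thesis using assms by (simp add: G.m_assoc G.inv_mult_group)
qed

lemma conj_mult:
  assumes "group G" "h \<in> carrier G" "x \<in> carrier G" "y \<in> carrier G"
  shows "h \<otimes>\<^bsub>G\<^esub> (x \<otimes>\<^bsub>G\<^esub> y) \<otimes>\<^bsub>G\<^esub> inv\<^bsub>G\<^esub> h = (h \<otimes>\<^bsub>G\<^esub> x \<otimes>\<^bsub>G\<^esub> inv\<^bsub>G\<^esub> h) \<otimes>\<^bsub>G\<^esub> (h \<otimes>\<^bsub>G\<^esub> y \<otimes>\<^bsub>G\<^esub> inv\<^bsub>G\<^esub> h)"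
proof -
  interpret G: group G by fact
  have "inv\<^bsub>G\<^esub> h \<otimes>\<^bsub>G\<^esub> (h \<otimes>\<^bsub>G\<^esub> z) = z" if "z \<in> carrier G" for z
    using that assms by (simp add: G.m_assoc[symmetric])
  then show ?thesis using assms by (simp add: G.m_assoc)
qed

lemma rep_conj:
  assumes "group P" "group G" "\<rho> \<in> reps P G" "h \<in> carrier G"
  shows "(\<lambda>x\<in>carrier P. h \<otimes>\<^bsub>G\<^esub> \<rho> x \<otimes>\<^bsub>G\<^esub> inv\<^bsub>G\<^esub> h) \<in> reps P G"
proof -
  interpret P: group P by fact
  interpret G: group G by fact
  show ?thesis
    using assms(3,4) conj_mult[OF assms(2,4)] unfolding reps_def hom_def by (simp add: Pi_iff)
qed

lemma rep_class_subset:
  assumes "group P" "group G" "\<rho> \<in> reps P G"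
  shows "rep_class P G \<rho> \<subseteq> reps P G"
  using rep_conj[OF assms] by (auto simp: rep_class_def)

lemma rep_class_conj:
  assumes "group P" "group G" "\<rho> \<in> reps P G" "h \<in> carrier G"
  shows "rep_class P G (\<lambda>x\<in>carrier P. h \<otimes>\<^bsub>G\<^esub> \<rho> x \<otimes>\<^bsub>G\<^esub> inv\<^bsub>G\<^esub> h) = rep_class P G \<rho>" (is "rep_class P G ?\<rho>' = _")
proof -
  interpret P: group P by fact
  interpret G: group G by fact
  have \<rho>: "\<rho> x \<in> carrier G" if "x \<in> carrier P" for x
    using assms(3) that by (auto simp: reps_def hom_def)
  have eq: "(\<lambda>x\<in>carrier P. k \<otimes>\<^bsub>G\<^esub> ?\<rho>' x \<otimes>\<^bsub>G\<^esub> inv\<^bsub>G\<^esub> k)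
      = (\<lambda>x\<in>carrier P. (k \<otimes>\<^bsub>G\<^esub> h) \<otimes>\<^bsub>G\<^esub> \<rho> x \<otimes>\<^bsub>G\<^esub> inv\<^bsub>G\<^esub> (k \<otimes>\<^bsub>G\<^esub> h))" if "k \<in> carrier G" for k
    using conj_conj[OF assms(2) assms(4) that] \<rho> by (auto simp: restrict_def)
  show ?thesis
  proof
    show "rep_class P G ?\<rho>' \<subseteq> rep_class P G \<rho>"
      unfolding rep_class_def using eq assms(4) by blast
    show "rep_class P G \<rho> \<subseteq> rep_class P G ?\<rho>'"
    proof
      fix \<rho>1 assume "\<rho>1 \<in> rep_class P G \<rho>"
      then obtain k where k: "k \<in> carrier G" "\<rho>1 = (\<lambda>x\<in>carrier P. k \<otimes>\<^bsub>G\<^esub> \<rho> x \<otimes>\<^bsub>G\<^esub> inv\<^bsub>G\<^esub> k)"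
        by (auto simp: rep_class_def)
      then have "\<rho>1 = (\<lambda>x\<in>carrier P. (k \<otimes>\<^bsub>G\<^esub> inv\<^bsub>G\<^esub> h) \<otimes>\<^bsub>G\<^esub> ?\<rho>' x \<otimes>\<^bsub>G\<^esub> inv\<^bsub>G\<^esub> (k \<otimes>\<^bsub>G\<^esub> inv\<^bsub>G\<^esub> h))"
        using assms(4) by (subst eq) (auto simp: G.m_assoc)
      then show "\<rho>1 \<in> rep_class P G ?\<rho>'"
        unfolding rep_class_def using k assms(4) by blast
    qed
  qed
qed

lemma rep_class_eq:
  assumes "group P" "group G" "\<rho> \<in> reps P G" "\<rho>' \<in> rep_class P G \<rho>"
  shows "rep_class P G \<rho>' = rep_class P G \<rho>"
proof -
  obtain h where "h \<in> carrier G" "\<rho>' = (\<lambda>x\<in>carrier P. h \<otimes>\<^bsub>G\<^esub> \<rho> x \<otimes>\<^bsub>G\<^esub> inv\<^bsub>G\<^esub> h)"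
    using assms(4) by (auto simp: rep_class_def)
  then show ?thesis using rep_class_conj[OF assms(1-3)] by simp
qed

lemma autoD:
  assumes "group P" "\<sigma> \<in> auto P" "x \<in> carrier P"
  shows "\<sigma> x \<in> carrier P" "inv_into (carrier P) \<sigma> x \<in> carrier P"
    "\<sigma> (inv_into (carrier P) \<sigma> x) = x" "inv_into (carrier P) \<sigma> (\<sigma> x) = x"
  using assms by (auto simp: auto_def Bij_def bij_betw_def hom_def Pi_iff inv_into_into f_inv_into_f)

lemma auto_inv_mult:
  assumes "group P" "\<sigma> \<in> auto P" "x \<in> carrier P" "y \<in> carrier P"
  shows "inv_into (carrier P) \<sigma> (x \<otimes>\<^bsub>P\<^esub> y) = inv_into (carrier P) \<sigma> x \<otimes>\<^bsub>P\<^esub> inv_into (carrier P) \<sigma> y"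
proof -
  interpret P: group P by fact
  let ?i = "inv_into (carrier P) \<sigma>"
  have "\<sigma> (?i x \<otimes>\<^bsub>P\<^esub> ?i y) = x \<otimes>\<^bsub>P\<^esub> y"
    using assms autoD[OF assms(1,2)] by (auto simp: auto_def hom_def)
  then show ?thesis
    using autoD[OF assms(1,2)] assms(3,4) by (metis P.m_closed)
qed

lemma reps_compose_inv:
  assumes "group P" "\<sigma> \<in> auto P" "\<rho> \<in> reps P G"
  shows "compose (carrier P) \<rho> (inv_into (carrier P) \<sigma>) \<in> reps P G"
proof -
  interpret P: group P by fact
  show ?thesis
    using assms(3) autoD[OF assms(1,2)] auto_inv_mult[OF assms(1,2)]
    by (auto simp: reps_def hom_def compose_def)
qed

text \<open>An inner difference between the automorphisms becomes conjugation by the inverse of the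
  value at \<open>\<gamma>\<close> of the representation obtained from \<open>\<sigma>\<close>.
  Hence an outer automorphism has a well-defined effect on classes.\<close>

lemma rep_class_compose_inv_cong:
  assumes P: "group P" and G: "group G" and "\<sigma> \<in> auto P" "\<sigma>' \<in> auto P" "\<rho> \<in> reps P G"
    and \<gamma>: "\<gamma> \<in> carrier P" "\<forall>x\<in>carrier P. \<sigma> x = inv\<^bsub>P\<^esub> \<gamma> \<otimes>\<^bsub>P\<^esub> \<sigma>' x \<otimes>\<^bsub>P\<^esub> \<gamma>"
  shows "rep_class P G (compose (carrier P) \<rho> (inv_into (carrier P) \<sigma>'))
       = rep_class P G (compose (carrier P) \<rho> (inv_into (carrier P) \<sigma>))"
proof -
  interpret P: group P by fact
  interpret G: group G by fact
  define \<rho>1 where "\<rho>1 = compose (carrier P) \<rho> (inv_into (carrier P) \<sigma>)"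
  define \<rho>2 where "\<rho>2 = compose (carrier P) \<rho> (inv_into (carrier P) \<sigma>')"
  have \<rho>1: "\<rho>1 \<in> reps P G" and \<rho>2: "\<rho>2 \<in> reps P G"
    unfolding \<rho>1_def \<rho>2_def using assms by (auto intro: reps_compose_inv)
  interpret \<rho>1: group_hom P G \<rho>1
    using \<rho>1 by unfold_locales (simp add: reps_def)
  have "\<rho>2 y = inv\<^bsub>G\<^esub> (\<rho>1 \<gamma>) \<otimes>\<^bsub>G\<^esub> \<rho>1 y \<otimes>\<^bsub>G\<^esub> inv\<^bsub>G\<^esub> (inv\<^bsub>G\<^esub> (\<rho>1 \<gamma>))" if y: "y \<in> carrier P" for y
  proof -
    let ?x = "inv_into (carrier P) \<sigma>' y"
    have x: "?x \<in> carrier P" "\<sigma>' ?x = y" using autoD[OF P assms(4) y] by auto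
    have "\<rho>2 y = \<rho> ?x" "\<rho>1 (\<sigma> ?x) = \<rho> ?x"
      using autoD[OF P assms(3) x(1)] y by (auto simp: \<rho>1_def \<rho>2_def compose_def)
    then have "\<rho>2 y = \<rho>1 (inv\<^bsub>P\<^esub> \<gamma> \<otimes>\<^bsub>P\<^esub> y \<otimes>\<^bsub>P\<^esub> \<gamma>)"
      using \<gamma>(2) x by simp
    then show ?thesis
      using \<gamma>(1) y by simp
  qed
  then have "\<rho>2 = (\<lambda>y\<in>carrier P. inv\<^bsub>G\<^esub> (\<rho>1 \<gamma>) \<otimes>\<^bsub>G\<^esub> \<rho>1 y \<otimes>\<^bsub>G\<^esub> inv\<^bsub>G\<^esub> (inv\<^bsub>G\<^esub> (\<rho>1 \<gamma>)))"
    using \<rho>2 by (intro extensionalityI[of _ "carrier P"]) (auto simp: reps_def)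
  then have "rep_class P G \<rho>2 = rep_class P G \<rho>1"
    using rep_class_conj[OF P G \<rho>1, of "inv\<^bsub>G\<^esub> (\<rho>1 \<gamma>)"] \<gamma>(1) by (metis G.inv_closed \<rho>1.hom_closed)
  then show ?thesis by (simp add: \<rho>1_def \<rho>2_def)
qed

section \<open>Mapping classes as outer automorphisms of the fundamental group\<close>

context pointed_space
begin

lemma paths_in_mem: "p \<in> paths_in S x y \<Longrightarrow> t \<in> {0..1} \<Longrightarrow> p t \<in> S"
  by (auto simp: paths_in_def path_image_def)

lemma paths_in_homeo:
  assumes "f \<in> carrier (homeo_group S)" "p \<in> paths_in S x y"
  shows "f \<circ> p \<in> paths_in S (f x) (f y)"
  using homeo_groupD(3,4)[OF assms(1)] by (intro paths_in_compose[OF assms(2)]) auto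

text \<open>The effect of \<open>f\<close> on the fundamental group, transported back to \<open>v\<close> along \<open>p\<close>.\<close>

definition pushes :: "('p \<Rightarrow> 'p) \<Rightarrow> (real \<Rightarrow> 'p) \<Rightarrow> ((real \<Rightarrow> 'p) set \<Rightarrow> (real \<Rightarrow> 'p) set) \<Rightarrow> bool" where
  "pushes f p \<sigma> \<longleftrightarrow> p \<in> paths_in S v (f v) \<and>
     (\<forall>c\<in>paths_in S v v. \<sigma> (loopify S v c)
        = inv\<^bsub>\<pi>\<^sub>1\<^esub> (loopify S v p) \<otimes>\<^bsub>\<pi>\<^sub>1\<^esub> loopify S v (f \<circ> c) \<otimes>\<^bsub>\<pi>\<^sub>1\<^esub> loopify S v p)"

lemma loopify_transport:
  assumes "c \<in> paths_in S y z" "p \<in> paths_in S x y" "p' \<in> paths_in S w z"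
  shows "loopify S v (p +++ c +++ reversepath p')
    = inv\<^bsub>\<pi>\<^sub>1\<^esub> (loopify S v p') \<otimes>\<^bsub>\<pi>\<^sub>1\<^esub> loopify S v c \<otimes>\<^bsub>\<pi>\<^sub>1\<^esub> loopify S v p"
  using loopify_join[OF assms(2) paths_in_join[OF assms(1) paths_in_reverse[OF assms(3)]]]
    loopify_join[OF assms(1) paths_in_reverse[OF assms(3)]] loopify_reverse[OF assms(3)] by simp

text \<open>Under \<open>loopify\<close>, transport along \<open>p\<close> is conjugation by a
  single element, so existence, composition and uniqueness of representing automorphisms become
  computations in a group.\<close>

lemma represents_iff:
  assumes "\<phi> \<in> carrier (mcg S)"
  shows "represents S v \<phi> \<sigma> \<longleftrightarrow> \<sigma> \<in> auto \<pi>\<^sub>1 \<and> (\<exists>f\<in>\<phi>. \<exists>p. pushes f p \<sigma>)"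
proof -
  have "(\<forall>c\<in>based_loops S v. \<sigma> (loop_class S c) = loop_class S (p +++ (f \<circ> c) +++ reversepath p)) \<longleftrightarrow>
    (\<forall>c\<in>paths_in S v v. \<sigma> (loopify S v c)
        = inv\<^bsub>\<pi>\<^sub>1\<^esub> (loopify S v p) \<otimes>\<^bsub>\<pi>\<^sub>1\<^esub> loopify S v (f \<circ> c) \<otimes>\<^bsub>\<pi>\<^sub>1\<^esub> loopify S v p)"
    if "f \<in> \<phi>" "p \<in> paths_in S v (f v)" for f p
    unfolding based_loops_eq
  proof (rule ball_cong[OF refl])
    fix c assume c: "c \<in> paths_in S v v"
    note fc = paths_in_homeo[OF mcg_elements(1)[OF assms that(1,1)] c]
    have "p +++ (f \<circ> c) +++ reversepath p \<in> paths_in S v v"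
      by (rule paths_in_join[OF that(2) paths_in_join[OF fc paths_in_reverse[OF that(2)]]])
    from loopify_loop[OF this] show "\<sigma> (loop_class S c) = loop_class S (p +++ (f \<circ> c) +++ reversepath p) \<longleftrightarrow>
      \<sigma> (loopify S v c)
        = inv\<^bsub>\<pi>\<^sub>1\<^esub> (loopify S v p) \<otimes>\<^bsub>\<pi>\<^sub>1\<^esub> loopify S v (f \<circ> c) \<otimes>\<^bsub>\<pi>\<^sub>1\<^esub> loopify S v p"
      using loopify_transport[OF fc that(2,2)] loopify_loop[OF c] by simp
  qed
  then show ?thesis
    unfolding represents_def pushes_def paths_in_def mem_Collect_eq conj_assoc
    by (intro conj_cong refl bex_cong ex_cong1) simp
qed

lemma homeo_group_apply:
  assumes "f \<in> carrier (homeo_group S)" "x \<in> S"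
  shows "f x \<in> S" "(inv\<^bsub>homeo_group S\<^esub> f) (f x) = x" "f ((inv\<^bsub>homeo_group S\<^esub> f) x) = x"
    "inv\<^bsub>homeo_group S\<^esub> f \<in> carrier (homeo_group S)"
proof -
  interpret G: group "homeo_group S" by (rule group_homeo_group)
  show "f x \<in> S" using homeo_groupD(4)[OF assms(1)] assms by auto
  then show "(inv\<^bsub>homeo_group S\<^esub> f) (f x) = x" "f ((inv\<^bsub>homeo_group S\<^esub> f) x) = x"
    using homeo_groupD(1)[OF assms(1)] assms
    by (auto simp: homeo_group_inv Bij_def bij_betw_def inv_into_f_f f_inv_into_f)
  show "inv\<^bsub>homeo_group S\<^esub> f \<in> carrier (homeo_group S)" using assms by simp
qed

lemma pushes_hom_exists:
  assumes f: "f \<in> carrier (homeo_group S)" and p: "p \<in> paths_in S v (f v)"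
  obtains \<sigma> where "\<sigma> \<in> hom \<pi>\<^sub>1 \<pi>\<^sub>1" "\<sigma> \<in> extensional (carrier \<pi>\<^sub>1)" "pushes f p \<sigma>"
proof -
  let ?m = "loopify S v"
  \<comment> \<open>A class is sent to the transported image of a chosen representative loop; the
    choice is immaterial since \<open>f\<close> preserves homotopies of loops.\<close>
  define \<sigma> where "\<sigma> = (\<lambda>x\<in>carrier \<pi>\<^sub>1. inv\<^bsub>\<pi>\<^sub>1\<^esub> (?m p) \<otimes>\<^bsub>\<pi>\<^sub>1\<^esub>
    ?m (f \<circ> (SOME c. c \<in> paths_in S v v \<and> x = ?m c)) \<otimes>\<^bsub>\<pi>\<^sub>1\<^esub> ?m p)"
  have fc: "?m (f \<circ> c) \<in> carrier \<pi>\<^sub>1" if "c \<in> paths_in S v v" for c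
    using paths_in_homeo[OF f that] by (rule loopify_closed)
  have mp: "?m p \<in> carrier \<pi>\<^sub>1" using p by (rule loopify_closed)
  have \<sigma>: "\<sigma> (?m c) = inv\<^bsub>\<pi>\<^sub>1\<^esub> (?m p) \<otimes>\<^bsub>\<pi>\<^sub>1\<^esub> ?m (f \<circ> c) \<otimes>\<^bsub>\<pi>\<^sub>1\<^esub> ?m p" if c: "c \<in> paths_in S v v" for c
  proof -
    define d where "d = (SOME d. d \<in> paths_in S v v \<and> ?m c = ?m d)"
    have "d \<in> paths_in S v v \<and> ?m c = ?m d"
      unfolding d_def by (rule someI[of _ c]) (use c in simp)
    then have d: "d \<in> paths_in S v v" "homotopic_paths S c d"
      using c by (auto simp: loopify_loop loop_class_eq_iff[OF c])
    have "homotopic_paths S (f \<circ> c) (f \<circ> d)"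
      using homeo_groupD(3,4)[OF f] by (intro homotopic_paths_continuous_image[OF d(2)]) auto
    then have "?m (f \<circ> c) = ?m (f \<circ> d)" by (rule loopify_homotopic)
    then show ?thesis
      using loopify_closed[OF c] by (simp add: \<sigma>_def d_def)
  qed
  have "\<sigma> (x \<otimes>\<^bsub>\<pi>\<^sub>1\<^esub> y) = \<sigma> x \<otimes>\<^bsub>\<pi>\<^sub>1\<^esub> \<sigma> y" if xy: "x \<in> carrier \<pi>\<^sub>1" "y \<in> carrier \<pi>\<^sub>1" for x y
  proof -
    obtain c d where c: "c \<in> paths_in S v v" "x = ?m c" and d: "d \<in> paths_in S v v" "y = ?m d"
      using xy unfolding carrier_pi1_loopify by blast
    have "x \<otimes>\<^bsub>\<pi>\<^sub>1\<^esub> y = ?m (d +++ c)"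
      using loopify_join[OF d(1) c(1)] c d by simp
    moreover have "?m (f \<circ> (d +++ c)) = ?m (f \<circ> c) \<otimes>\<^bsub>\<pi>\<^sub>1\<^esub> ?m (f \<circ> d)"
      unfolding path_compose_join using loopify_join paths_in_homeo[OF f] c d by blast
    ultimately have "\<sigma> (x \<otimes>\<^bsub>\<pi>\<^sub>1\<^esub> y) = inv\<^bsub>\<pi>\<^sub>1\<^esub> (?m p) \<otimes>\<^bsub>\<pi>\<^sub>1\<^esub> (?m (f \<circ> c) \<otimes>\<^bsub>\<pi>\<^sub>1\<^esub> ?m (f \<circ> d)) \<otimes>\<^bsub>\<pi>\<^sub>1\<^esub> ?m p"
      using \<sigma> paths_in_join[OF d(1) c(1)] by simp
    also have "\<dots> = \<sigma> x \<otimes>\<^bsub>\<pi>\<^sub>1\<^esub> \<sigma> y"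
      using conj_mult[OF pi1.group_axioms, of "inv\<^bsub>\<pi>\<^sub>1\<^esub> (?m p)"] mp fc c d \<sigma> by simp
    finally show ?thesis .
  qed
  moreover have "\<sigma> x \<in> carrier \<pi>\<^sub>1" if "x \<in> carrier \<pi>\<^sub>1" for x
  proof -
    obtain c where "c \<in> paths_in S v v" "x = ?m c" using \<open>x \<in> carrier \<pi>\<^sub>1\<close> unfolding carrier_pi1_loopify by blast
    then show ?thesis using \<sigma> fc mp by simp
  qed
  ultimately have "\<sigma> \<in> hom \<pi>\<^sub>1 \<pi>\<^sub>1" by (auto simp: hom_def)
  moreover have "pushes f p \<sigma>" using p \<sigma> by (simp add: pushes_def)
  ultimately show thesis by (intro that[of \<sigma>]) (auto simp: \<sigma>_def)
qed

text \<open>The base point travels along \<open>p\<close> to its image under \<open>f\<close>, and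
  from there along the \<open>f\<close>-image of \<open>p'\<close>.\<close>

lemma pushes_compose:
  assumes f: "f \<in> carrier (homeo_group S)" and h: "h \<in> carrier (homeo_group S)"
    and \<sigma>: "pushes f p \<sigma>" and \<tau>: "pushes h p' \<tau>"
  shows "pushes (compose S f h) (p +++ (f \<circ> p')) (compose (carrier \<pi>\<^sub>1) \<sigma> \<tau>)"
proof -
  let ?m = "loopify S v"
  have p: "p \<in> paths_in S v (f v)" and p': "p' \<in> paths_in S v (h v)"
    using \<sigma> \<tau> by (auto simp: pushes_def)
  have fp': "f \<circ> p' \<in> paths_in S (f v) (f (h v))" by (rule paths_in_homeo[OF f p'])
  have pp: "p +++ (f \<circ> p') \<in> paths_in S v (compose S f h v)"
    using paths_in_join[OF p fp'] v_in by (simp add: compose_def)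
  have "\<sigma> (\<tau> (?m c)) = inv\<^bsub>\<pi>\<^sub>1\<^esub> (?m (p +++ (f \<circ> p'))) \<otimes>\<^bsub>\<pi>\<^sub>1\<^esub> ?m (compose S f h \<circ> c) \<otimes>\<^bsub>\<pi>\<^sub>1\<^esub> ?m (p +++ (f \<circ> p'))"
    if c: "c \<in> paths_in S v v" for c
  proof -
    note hc = paths_in_homeo[OF h c]
    note fhc = paths_in_homeo[OF f hc]
    have "\<tau> (?m c) = ?m (p' +++ (h \<circ> c) +++ reversepath p')"
      using \<tau> c loopify_transport[OF hc p' p'] by (simp add: pushes_def)
    moreover have L: "p' +++ (h \<circ> c) +++ reversepath p' \<in> paths_in S v v"
      by (rule paths_in_join[OF p' paths_in_join[OF hc paths_in_reverse[OF p']]])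
    ultimately have "\<sigma> (\<tau> (?m c)) = inv\<^bsub>\<pi>\<^sub>1\<^esub> (?m p) \<otimes>\<^bsub>\<pi>\<^sub>1\<^esub> ?m (f \<circ> (p' +++ (h \<circ> c) +++ reversepath p')) \<otimes>\<^bsub>\<pi>\<^sub>1\<^esub> ?m p"
      using \<sigma> by (simp add: pushes_def)
    also have "?m (f \<circ> (p' +++ (h \<circ> c) +++ reversepath p'))
        = inv\<^bsub>\<pi>\<^sub>1\<^esub> (?m (f \<circ> p')) \<otimes>\<^bsub>\<pi>\<^sub>1\<^esub> ?m (f \<circ> (h \<circ> c)) \<otimes>\<^bsub>\<pi>\<^sub>1\<^esub> ?m (f \<circ> p')"
      using loopify_transport[OF fhc fp' fp'] by (simp add: path_compose_join path_compose_reversepath)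
    also have "?m (f \<circ> (h \<circ> c)) = ?m (compose S f h \<circ> c)"
    proof (rule loopify_cong[OF fhc])
      show "(f \<circ> (h \<circ> c)) t = (compose S f h \<circ> c) t" if "t \<in> {0..1}" for t
        using paths_in_mem[OF c that] by (simp add: compose_def)
    qed
    finally have *: "\<sigma> (\<tau> (?m c)) = inv\<^bsub>\<pi>\<^sub>1\<^esub> (?m p) \<otimes>\<^bsub>\<pi>\<^sub>1\<^esub> (inv\<^bsub>\<pi>\<^sub>1\<^esub> (?m (f \<circ> p')) \<otimes>\<^bsub>\<pi>\<^sub>1\<^esub> ?m (compose S f h \<circ> c) \<otimes>\<^bsub>\<pi>\<^sub>1\<^esub> ?m (f \<circ> p')) \<otimes>\<^bsub>\<pi>\<^sub>1\<^esub> ?m p" .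
    have "compose S f h \<in> carrier (homeo_group S)"
      using f h monoid.m_closed[OF group.is_monoid[OF group_homeo_group]] by (metis homeo_group_mult)
    then have "?m (compose S f h \<circ> c) \<in> carrier \<pi>\<^sub>1"
      by (intro loopify_closed[OF paths_in_homeo[OF _ c]])
    then show ?thesis
      using loopify_closed[OF p] loopify_closed[OF fp'] unfolding * loopify_join[OF p fp']
      by (simp add: pi1.m_assoc pi1.inv_mult_group)
  qed
  moreover have "?m c \<in> carrier \<pi>\<^sub>1" if "c \<in> paths_in S v v" for c
    using that by (rule loopify_closed)
  ultimately show ?thesis
    using pp by (simp add: pushes_def compose_def)
qed

text \<open>During the homotopy from \<open>f\<close> to \<open>h\<close> the image of the base
  point traces a path, and a loop carried along the homotopy sweeps out a square. This square
  conjugates one effect on loops into the other.\<close>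

lemma pushes_unique_up_to_conj:
  assumes f: "f \<in> carrier (homeo_group S)" and h: "h \<in> carrier (homeo_group S)" and "homotopic_self S f h"
    and \<sigma>: "pushes f p \<sigma>" and \<tau>: "pushes h p' \<tau>"
  obtains \<gamma> where "\<gamma> \<in> carrier \<pi>\<^sub>1" "\<forall>x\<in>carrier \<pi>\<^sub>1. \<sigma> x = inv\<^bsub>\<pi>\<^sub>1\<^esub> \<gamma> \<otimes>\<^bsub>\<pi>\<^sub>1\<^esub> \<tau> x \<otimes>\<^bsub>\<pi>\<^sub>1\<^esub> \<gamma>"
proof -
  let ?m = "loopify S v"
  obtain K where K: "continuous_map (prod_topology (top_of_set {0..1::real}) (top_of_set S)) (top_of_set S) K"
      "\<And>x. K (0, x) = f x" "\<And>x. K (1, x) = h x"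
    using assms(3) unfolding homotopic_with_def by blast
  have Kc: "continuous_on ({0..1} \<times> S) K" "K ` ({0..1} \<times> S) \<subseteq> S"
    using K(1) by (auto simp: image_subset_iff_funcset)
  define d where "d = (\<lambda>t. K (t, v))"
  have d: "d \<in> paths_in S (f v) (h v)"
  proof -
    have "path d" unfolding path_def d_def
      by (rule continuous_on_compose2[OF Kc(1)]) (use v_in in \<open>auto intro!: continuous_intros\<close>)
    then show ?thesis
      using Kc(2) v_in by (auto simp: paths_in_def d_def path_image_def pathstart_def pathfinish_def K)
  qed
  have p: "p \<in> paths_in S v (f v)" and p': "p' \<in> paths_in S v (h v)"
    using \<sigma> \<tau> by (auto simp: pushes_def)
  \<comment> \<open>Read from right to left: out along \<open>p\<close> to \<open>f v\<close>, along
    the trace \<open>d\<close> to \<open>h v\<close>, and back along \<open>p'\<close>.\<close>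
  define \<gamma> where "\<gamma> = inv\<^bsub>\<pi>\<^sub>1\<^esub> (?m p') \<otimes>\<^bsub>\<pi>\<^sub>1\<^esub> ?m d \<otimes>\<^bsub>\<pi>\<^sub>1\<^esub> ?m p"
  note m = loopify_closed[OF p] loopify_closed[OF p'] loopify_closed[OF d]
  have "\<gamma> \<in> carrier \<pi>\<^sub>1" using m by (simp add: \<gamma>_def)
  moreover have "\<sigma> x = inv\<^bsub>\<pi>\<^sub>1\<^esub> \<gamma> \<otimes>\<^bsub>\<pi>\<^sub>1\<^esub> \<tau> x \<otimes>\<^bsub>\<pi>\<^sub>1\<^esub> \<gamma>" if x: "x \<in> carrier \<pi>\<^sub>1" for x
  proof -
    obtain c where c: "c \<in> paths_in S v v" "x = ?m c"
      using x unfolding carrier_pi1_loopify by blast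
    define fc hc where "fc = ?m (f \<circ> c)" and "hc = ?m (h \<circ> c)"
    have fhc: "fc \<in> carrier \<pi>\<^sub>1" "hc \<in> carrier \<pi>\<^sub>1"
      unfolding fc_def hc_def using paths_in_homeo[OF f c(1)] paths_in_homeo[OF h c(1)] by (auto intro: loopify_closed)
    have cS: "c t \<in> S" if "t \<in> {0..1}" for t
      using c(1) that by (auto simp: paths_in_def path_image_def)
    \<comment> \<open>Two opposite sides of this square are the images of \<open>c\<close> under
      \<open>f\<close> and \<open>h\<close>; the other two are both the trace \<open>d\<close>,
      because \<open>c\<close> is a loop.\<close>
    have "continuous_on ({0..1} \<times> {0..1}) (\<lambda>z. K (fst z, c (snd z)))"
    proof (rule continuous_on_compose2[OF Kc(1)])
      have "continuous_on {0..1} c" using c(1) by (simp add: paths_in_def path_def)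
      then have "continuous_on ({0..1::real} \<times> {0..1}) (\<lambda>z. c (snd z))"
        by (rule continuous_on_compose2) (auto intro!: continuous_intros)
      then show "continuous_on ({0..1} \<times> {0..1}) (\<lambda>z::real\<times>real. (fst z, c (snd z)))"
        by (auto intro!: continuous_intros)
    qed (use cS in auto)
    from loopify_square[OF this]
    have "hc \<otimes>\<^bsub>\<pi>\<^sub>1\<^esub> ?m d = ?m d \<otimes>\<^bsub>\<pi>\<^sub>1\<^esub> fc"
      using Kc(2) cS c(1) by (auto simp: image_subset_iff K d_def fc_def hc_def paths_in_def pathstart_def pathfinish_def o_def)
    then have "fc = inv\<^bsub>\<pi>\<^sub>1\<^esub> (?m d) \<otimes>\<^bsub>\<pi>\<^sub>1\<^esub> (hc \<otimes>\<^bsub>\<pi>\<^sub>1\<^esub> ?m d)"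
      using m fhc pi1.inv_solve_left by simp
    moreover have "\<sigma> x = inv\<^bsub>\<pi>\<^sub>1\<^esub> (?m p) \<otimes>\<^bsub>\<pi>\<^sub>1\<^esub> fc \<otimes>\<^bsub>\<pi>\<^sub>1\<^esub> ?m p" "\<tau> x = inv\<^bsub>\<pi>\<^sub>1\<^esub> (?m p') \<otimes>\<^bsub>\<pi>\<^sub>1\<^esub> hc \<otimes>\<^bsub>\<pi>\<^sub>1\<^esub> ?m p'"
      using \<sigma> \<tau> c by (auto simp: pushes_def fc_def hc_def)
    moreover have "?m p' \<otimes>\<^bsub>\<pi>\<^sub>1\<^esub> (inv\<^bsub>\<pi>\<^sub>1\<^esub> (?m p') \<otimes>\<^bsub>\<pi>\<^sub>1\<^esub> z) = z" if "z \<in> carrier \<pi>\<^sub>1" for z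
      using that m by (simp flip: pi1.m_assoc)
    ultimately show ?thesis
      using m fhc by (simp add: \<gamma>_def pi1.m_assoc pi1.inv_mult_group)
  qed
  ultimately show thesis using that by blast
qed

text \<open>A map that fixes all points of \<open>S\<close> closes the path \<open>p\<close> to a
  loop, and only conjugation by this loop remains.\<close>

lemma pushes_id:
  assumes "pushes f p \<sigma>" "f \<in> carrier (homeo_group S)" "\<forall>x\<in>S. f x = x" "x \<in> carrier \<pi>\<^sub>1"
  shows "\<sigma> x = inv\<^bsub>\<pi>\<^sub>1\<^esub> (loopify S v p) \<otimes>\<^bsub>\<pi>\<^sub>1\<^esub> x \<otimes>\<^bsub>\<pi>\<^sub>1\<^esub> loopify S v p" "loopify S v p \<in> carrier \<pi>\<^sub>1"
proof -
  obtain c where c: "c \<in> paths_in S v v" "x = loopify S v c"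
    using assms(4) unfolding carrier_pi1_loopify by blast
  have "loopify S v c = loopify S v (f \<circ> c)"
    using assms(3) paths_in_mem[OF c(1)] by (intro loopify_cong[OF c(1)]) simp
  then show "\<sigma> x = inv\<^bsub>\<pi>\<^sub>1\<^esub> (loopify S v p) \<otimes>\<^bsub>\<pi>\<^sub>1\<^esub> x \<otimes>\<^bsub>\<pi>\<^sub>1\<^esub> loopify S v p"
    using assms(1) c(1) unfolding pushes_def c(2) by metis
  show "loopify S v p \<in> carrier \<pi>\<^sub>1" using assms(1) by (auto simp: pushes_def)
qed

text \<open>The inverse homeomorphism induces a homomorphism whose composites with
  \<open>\<sigma>\<close> in both orders are conjugations. One order gives surjectivity of
  \<open>\<sigma>\<close>, the other injectivity.\<close>

lemma pushes_auto_exists: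
  assumes f: "f \<in> carrier (homeo_group S)" and p: "p \<in> paths_in S v (f v)"
  obtains \<sigma> where "\<sigma> \<in> auto \<pi>\<^sub>1" "pushes f p \<sigma>"
proof -
  interpret G: group "homeo_group S" by (rule group_homeo_group)
  define h where "h = inv\<^bsub>homeo_group S\<^esub> f"
  have h: "h \<in> carrier (homeo_group S)" using f by (simp add: h_def)
  \<comment> \<open>The reverse of \<open>p\<close> runs from \<open>f v\<close> to
    \<open>v\<close>; the inverse of \<open>f\<close> carries it to a path starting at
    \<open>v\<close>, as \<open>pushes\<close> demands.\<close>
  define p' where "p' = h \<circ> reversepath p"
  have p': "p' \<in> paths_in S v (h v)"
    using paths_in_homeo[OF h paths_in_reverse[OF p]] homeo_group_apply(2)[OF f v_in] by (simp add: p'_def h_def)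
  obtain \<sigma> where \<sigma>: "\<sigma> \<in> hom \<pi>\<^sub>1 \<pi>\<^sub>1" "\<sigma> \<in> extensional (carrier \<pi>\<^sub>1)" "pushes f p \<sigma>"
    by (rule pushes_hom_exists[OF f p])
  obtain \<tau> where \<tau>: "\<tau> \<in> hom \<pi>\<^sub>1 \<pi>\<^sub>1" "\<tau> \<in> extensional (carrier \<pi>\<^sub>1)" "pushes h p' \<tau>"
    by (rule pushes_hom_exists[OF h p'])
  have fh: "compose S f h \<in> carrier (homeo_group S)" "compose S h f \<in> carrier (homeo_group S)"
    using f h G.m_closed by (metis homeo_group_mult)+
  have id: "\<forall>x\<in>S. compose S f h x = x" "\<forall>x\<in>S. compose S h f x = x"
    using homeo_group_apply[OF f] by (auto simp: compose_def h_def)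
  note s1 = pushes_id[OF pushes_compose[OF f h \<sigma>(3) \<tau>(3)] fh(1) id(1)]
    and s2 = pushes_id[OF pushes_compose[OF h f \<tau>(3) \<sigma>(3)] fh(2) id(2)]
  have conj: "x = inv\<^bsub>\<pi>\<^sub>1\<^esub> a \<otimes>\<^bsub>\<pi>\<^sub>1\<^esub> (a \<otimes>\<^bsub>\<pi>\<^sub>1\<^esub> x \<otimes>\<^bsub>\<pi>\<^sub>1\<^esub> inv\<^bsub>\<pi>\<^sub>1\<^esub> a) \<otimes>\<^bsub>\<pi>\<^sub>1\<^esub> a" if "a \<in> carrier \<pi>\<^sub>1" "x \<in> carrier \<pi>\<^sub>1" for a x
    using that conj_conj[OF pi1.group_axioms, of a "inv\<^bsub>\<pi>\<^sub>1\<^esub> a" x] by simp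
  have surj: "\<sigma> ` carrier \<pi>\<^sub>1 = carrier \<pi>\<^sub>1"
  proof
    show "\<sigma> ` carrier \<pi>\<^sub>1 \<subseteq> carrier \<pi>\<^sub>1" using \<sigma>(1) by (auto simp: hom_def)
    show "carrier \<pi>\<^sub>1 \<subseteq> \<sigma> ` carrier \<pi>\<^sub>1"
    proof
      fix x assume x: "x \<in> carrier \<pi>\<^sub>1"
      let ?a = "loopify S v (p +++ (f \<circ> p'))"
      have a: "?a \<in> carrier \<pi>\<^sub>1" using s1(2)[OF x] .
      let ?y = "?a \<otimes>\<^bsub>\<pi>\<^sub>1\<^esub> x \<otimes>\<^bsub>\<pi>\<^sub>1\<^esub> inv\<^bsub>\<pi>\<^sub>1\<^esub> ?a"
      have y: "?y \<in> carrier \<pi>\<^sub>1" using a x by simp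
      from s1(1)[OF this] have "\<sigma> (\<tau> ?y) = x"
        using conj[OF a x] y by (simp add: compose_def)
      moreover have "\<tau> ?y \<in> carrier \<pi>\<^sub>1" using \<tau>(1) y by (auto simp: hom_def)
      ultimately show "x \<in> \<sigma> ` carrier \<pi>\<^sub>1" by (metis image_eqI)
    qed
  qed
  have "inj_on \<sigma> (carrier \<pi>\<^sub>1)"
  proof (rule inj_onI)
    fix x y assume xy: "x \<in> carrier \<pi>\<^sub>1" "y \<in> carrier \<pi>\<^sub>1" "\<sigma> x = \<sigma> y"
    let ?a = "loopify S v (p' +++ (h \<circ> p))"
    have a: "?a \<in> carrier \<pi>\<^sub>1" using s2(2)[OF xy(1)] .
    have "inv\<^bsub>\<pi>\<^sub>1\<^esub> ?a \<otimes>\<^bsub>\<pi>\<^sub>1\<^esub> x \<otimes>\<^bsub>\<pi>\<^sub>1\<^esub> ?a = inv\<^bsub>\<pi>\<^sub>1\<^esub> ?a \<otimes>\<^bsub>\<pi>\<^sub>1\<^esub> y \<otimes>\<^bsub>\<pi>\<^sub>1\<^esub> ?a"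
      using s2(1)[OF xy(1)] s2(1)[OF xy(2)] xy by (simp add: compose_def)
    then show "x = y" using a xy by simp
  qed
  then have "\<sigma> \<in> auto \<pi>\<^sub>1"
    using \<sigma> surj by (simp add: auto_def Bij_def bij_betw_def)
  then show thesis using \<sigma>(3) that by blast
qed

lemma represents_exists:
  assumes "\<phi> \<in> carrier (mcg S)"
  obtains \<sigma> where "represents S v \<phi> \<sigma>"
proof -
  obtain f where f: "f \<in> carrier (homeo_group S)" "f \<in> \<phi>" by (rule mcg_class[OF assms])
  have "f v \<in> S" using homeo_group_apply(1)[OF f(1) v_in] .
  from connecting_path[OF this] obtain p where "p \<in> paths_in S v (f v)" ..
  then obtain \<sigma> where "\<sigma> \<in> auto \<pi>\<^sub>1" "pushes f p \<sigma>" by (rule pushes_auto_exists[OF f(1)])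
  then show thesis using that represents_iff[OF assms] f(2) by blast
qed

lemma represents_unique_up_to_conj:
  assumes \<phi>: "\<phi> \<in> carrier (mcg S)" and "represents S v \<phi> \<sigma>" "represents S v \<phi> \<tau>"
  obtains \<gamma> where "\<gamma> \<in> carrier \<pi>\<^sub>1" "\<forall>x\<in>carrier \<pi>\<^sub>1. \<sigma> x = inv\<^bsub>\<pi>\<^sub>1\<^esub> \<gamma> \<otimes>\<^bsub>\<pi>\<^sub>1\<^esub> \<tau> x \<otimes>\<^bsub>\<pi>\<^sub>1\<^esub> \<gamma>"
proof -
  obtain f p where f: "f \<in> \<phi>" "pushes f p \<sigma>"
    using assms(2) unfolding represents_iff[OF \<phi>] by blast
  obtain h p' where h: "h \<in> \<phi>" "pushes h p' \<tau>"
    using assms(3) unfolding represents_iff[OF \<phi>] by blast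
  show thesis
    by (rule pushes_unique_up_to_conj[OF mcg_elements(1)[OF \<phi> f(1,1)] mcg_elements(1)[OF \<phi> h(1,1)]
          mcg_elements(2)[OF \<phi> f(1) h(1)] f(2) h(2)]) (rule that)
qed

lemma represents_compose:
  assumes "\<phi> \<in> carrier (mcg S)" "\<psi> \<in> carrier (mcg S)" "represents S v \<phi> \<sigma>" "represents S v \<psi> \<tau>"
  shows "represents S v (\<phi> \<otimes>\<^bsub>mcg S\<^esub> \<psi>) (compose (carrier \<pi>\<^sub>1) \<sigma> \<tau>)"
proof -
  interpret M: group "mcg S" by (rule group_mcg)
  obtain f p where f: "f \<in> \<phi>" "pushes f p \<sigma>" "\<sigma> \<in> auto \<pi>\<^sub>1"
    using assms(3) unfolding represents_iff[OF assms(1)] by blast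
  obtain h p' where h: "h \<in> \<psi>" "pushes h p' \<tau>" "\<tau> \<in> auto \<pi>\<^sub>1"
    using assms(4) unfolding represents_iff[OF assms(2)] by blast
  have "compose (carrier \<pi>\<^sub>1) \<sigma> \<tau> \<in> auto \<pi>\<^sub>1"
    using f(3) h(3) compose_Bij[of \<sigma> "carrier \<pi>\<^sub>1" \<tau>]
    by (auto simp: auto_def hom_def Pi_iff) (auto simp: compose_def)
  moreover have "pushes (compose S f h) (p +++ (f \<circ> p')) (compose (carrier \<pi>\<^sub>1) \<sigma> \<tau>)"
    using f h mcg_elements(1)[OF assms(1)] mcg_elements(1)[OF assms(2)] by (intro pushes_compose) auto
  ultimately show ?thesis
    unfolding represents_iff[OF M.m_closed[OF assms(1,2)]] using mcg_mult[OF assms(1,2) f(1) h(1)] by blast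
qed

text \<open>All members of the union in \<open>rep_action\<close> coincide: changing the
  representative of the class conjugates the result, and changing the automorphism alters it by an
  inner one.\<close>

lemma rep_action_eq:
  assumes G: "group G" and \<phi>: "\<phi> \<in> carrier (mcg S)" and \<sigma>: "represents S v \<phi> \<sigma>" and \<rho>: "\<rho> \<in> reps \<pi>\<^sub>1 G"
  shows "rep_action S v G \<phi> (rep_class \<pi>\<^sub>1 G \<rho>) = rep_class \<pi>\<^sub>1 G (compose (carrier \<pi>\<^sub>1) \<rho> (inv_into (carrier \<pi>\<^sub>1) \<sigma>))"
proof -
  let ?R = "rep_class \<pi>\<^sub>1 G" and ?c = "\<lambda>\<rho> \<sigma>. compose (carrier \<pi>\<^sub>1) \<rho> (inv_into (carrier \<pi>\<^sub>1) \<sigma>)"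
  note P = pi1.group_axioms
  have eq: "?R (?c \<rho>' \<sigma>') = ?R (?c \<rho> \<sigma>)" if that': "\<rho>' \<in> ?R \<rho>" "represents S v \<phi> \<sigma>'" for \<rho>' \<sigma>'
  proof -
    have auts: "\<sigma> \<in> auto \<pi>\<^sub>1" "\<sigma>' \<in> auto \<pi>\<^sub>1" using that \<sigma> represents_iff[OF \<phi>] by auto
    have \<rho>': "\<rho>' \<in> reps \<pi>\<^sub>1 G" using rep_class_subset[OF P G \<rho>] that by auto
    obtain \<gamma> where "\<gamma> \<in> carrier \<pi>\<^sub>1" "\<forall>x\<in>carrier \<pi>\<^sub>1. \<sigma> x = inv\<^bsub>\<pi>\<^sub>1\<^esub> \<gamma> \<otimes>\<^bsub>\<pi>\<^sub>1\<^esub> \<sigma>' x \<otimes>\<^bsub>\<pi>\<^sub>1\<^esub> \<gamma>"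
      by (rule represents_unique_up_to_conj[OF \<phi> \<sigma> that'(2)])
    from rep_class_compose_inv_cong[OF P G auts \<rho>' this]
    have "?R (?c \<rho>' \<sigma>') = ?R (?c \<rho>' \<sigma>)" .
    also obtain h where h: "h \<in> carrier G" "\<rho>' = (\<lambda>x\<in>carrier \<pi>\<^sub>1. h \<otimes>\<^bsub>G\<^esub> \<rho> x \<otimes>\<^bsub>G\<^esub> inv\<^bsub>G\<^esub> h)"
      using that'(1) by (auto simp: rep_class_def)
    then have "?c \<rho>' \<sigma> = (\<lambda>x\<in>carrier \<pi>\<^sub>1. h \<otimes>\<^bsub>G\<^esub> ?c \<rho> \<sigma> x \<otimes>\<^bsub>G\<^esub> inv\<^bsub>G\<^esub> h)"
      using autoD[OF P auts(1)] by (auto simp: compose_def)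
    then have "?R (?c \<rho>' \<sigma>) = ?R (?c \<rho> \<sigma>)"
      using rep_class_conj[OF P G reps_compose_inv[OF P auts(1) \<rho>] h(1)] by simp
    finally show ?thesis .
  qed
  have "\<rho> \<in> ?R \<rho>" by (rule rep_class_self[OF P G \<rho>])
  have "?R \<rho> \<in> rep_variety \<pi>\<^sub>1 G" using \<rho> by (simp add: rep_variety_def)
  then have "rep_action S v G \<phi> (?R \<rho>) = (\<Union>\<rho>'\<in>?R \<rho>. \<Union>\<sigma>'\<in>{\<sigma>'. represents S v \<phi> \<sigma>'}. ?R (?c \<rho>' \<sigma>'))"
    by (simp only: rep_action_def restrict_apply if_True)
  also have "\<dots> = (\<Union>\<rho>'\<in>?R \<rho>. \<Union>\<sigma>'\<in>{\<sigma>'. represents S v \<phi> \<sigma>'}. ?R (?c \<rho> \<sigma>))"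
    using eq by (intro SUP_cong refl) blast
  also have "\<dots> = ?R (?c \<rho> \<sigma>)"
    using \<sigma> \<open>\<rho> \<in> ?R \<rho>\<close> by blast
  finally show ?thesis .
qed

lemma group_action_rep_variety:
  assumes G: "group G"
  shows "group_action (mcg S) (rep_variety \<pi>\<^sub>1 G) (rep_action S v G)"
proof (rule group_actionI)
  interpret M: group "mcg S" by (rule group_mcg)
  note P = pi1.group_axioms
  show "group (mcg S)" by (rule group_mcg)
  show "rep_action S v G \<phi> \<in> extensional (rep_variety \<pi>\<^sub>1 G)" for \<phi>
    by (simp add: rep_action_def)
  fix \<phi> C assume \<phi>: "\<phi> \<in> carrier (mcg S)" and C: "C \<in> rep_variety \<pi>\<^sub>1 G"
  obtain \<rho> where \<rho>: "\<rho> \<in> reps \<pi>\<^sub>1 G" "C = rep_class \<pi>\<^sub>1 G \<rho>"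
    using C by (auto simp: rep_variety_def)
  obtain \<sigma> where \<sigma>: "represents S v \<phi> \<sigma>" by (rule represents_exists[OF \<phi>])
  then have aut: "\<sigma> \<in> auto \<pi>\<^sub>1" using represents_iff[OF \<phi>] by simp
  show "rep_action S v G \<phi> C \<in> rep_variety \<pi>\<^sub>1 G"
    unfolding \<rho>(2) rep_action_eq[OF G \<phi> \<sigma> \<rho>(1)] rep_variety_def
    using reps_compose_inv[OF P aut \<rho>(1)] by simp
next
  interpret M: group "mcg S" by (rule group_mcg)
  note P = pi1.group_axioms
  fix C assume C: "C \<in> rep_variety \<pi>\<^sub>1 G"
  obtain \<rho> where \<rho>: "\<rho> \<in> reps \<pi>\<^sub>1 G" "C = rep_class \<pi>\<^sub>1 G \<rho>"
    using C by (auto simp: rep_variety_def)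
  have "pushes (\<lambda>x\<in>S. x) (\<lambda>_. v) (\<lambda>x\<in>carrier \<pi>\<^sub>1. x)"
  proof -
    have "loopify S v ((\<lambda>x\<in>S. x) \<circ> c) = loopify S v c" if "c \<in> paths_in S v v" for c
      by (rule loopify_cong[OF that, symmetric]) (use paths_in_mem[OF that] in simp)
    then show ?thesis
      using v_in by (auto simp: pushes_def paths_in_const intro: loopify_closed)
  qed
  then have rep: "represents S v \<one>\<^bsub>mcg S\<^esub> (\<lambda>x\<in>carrier \<pi>\<^sub>1. x)"
    unfolding represents_iff[OF M.one_closed] using mcg_one pi1.id_in_auto by blast
  have "compose (carrier \<pi>\<^sub>1) \<rho> (inv_into (carrier \<pi>\<^sub>1) (\<lambda>x\<in>carrier \<pi>\<^sub>1. x)) = \<rho>"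
  proof (rule extensionalityI[of _ "carrier \<pi>\<^sub>1"])
    fix x assume x: "x \<in> carrier \<pi>\<^sub>1"
    then show "compose (carrier \<pi>\<^sub>1) \<rho> (inv_into (carrier \<pi>\<^sub>1) (\<lambda>x\<in>carrier \<pi>\<^sub>1. x)) x = \<rho> x"
      using autoD(4)[OF P pi1.id_in_auto x] by (simp add: compose_def)
  qed (use \<rho> in \<open>auto simp: reps_def\<close>)
  then show "rep_action S v G \<one>\<^bsub>mcg S\<^esub> C = C"
    unfolding \<rho>(2) rep_action_eq[OF G M.one_closed rep \<rho>(1)] by simp
  fix \<phi> \<psi> assume \<phi>: "\<phi> \<in> carrier (mcg S)" and \<psi>: "\<psi> \<in> carrier (mcg S)"
  obtain \<sigma> where \<sigma>: "represents S v \<phi> \<sigma>" by (rule represents_exists[OF \<phi>])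
  obtain \<tau> where \<tau>: "represents S v \<psi> \<tau>" by (rule represents_exists[OF \<psi>])
  have aut: "\<sigma> \<in> auto \<pi>\<^sub>1" "\<tau> \<in> auto \<pi>\<^sub>1" using represents_iff \<phi> \<psi> \<sigma> \<tau> by auto
  note \<sigma>\<tau> = represents_compose[OF \<phi> \<psi> \<sigma> \<tau>]
  have aut': "compose (carrier \<pi>\<^sub>1) \<sigma> \<tau> \<in> auto \<pi>\<^sub>1" using represents_iff M.m_closed[OF \<phi> \<psi>] \<sigma>\<tau> by auto
  let ?c = "\<lambda>\<rho> \<sigma>. compose (carrier \<pi>\<^sub>1) \<rho> (inv_into (carrier \<pi>\<^sub>1) \<sigma>)"
  \<comment> \<open>Inverting a composite reverses its factors, which turns precomposition into a
    left action.\<close>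
  have "?c \<rho> (compose (carrier \<pi>\<^sub>1) \<sigma> \<tau>) = ?c (?c \<rho> \<tau>) \<sigma>"
  proof (rule extensionalityI[of _ "carrier \<pi>\<^sub>1"])
    fix x assume x: "x \<in> carrier \<pi>\<^sub>1"
    let ?y = "inv_into (carrier \<pi>\<^sub>1) \<tau> (inv_into (carrier \<pi>\<^sub>1) \<sigma> x)"
    have y: "?y \<in> carrier \<pi>\<^sub>1" "compose (carrier \<pi>\<^sub>1) \<sigma> \<tau> ?y = x"
      using autoD[OF P aut(1) x] autoD[OF P aut(2)] by (auto simp: compose_def)
    have "inv_into (carrier \<pi>\<^sub>1) (compose (carrier \<pi>\<^sub>1) \<sigma> \<tau>) x = ?y"
      using autoD(4)[OF P aut' y(1)] y(2) by simp
    then show "?c \<rho> (compose (carrier \<pi>\<^sub>1) \<sigma> \<tau>) x = ?c (?c \<rho> \<tau>) \<sigma> x"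
      using x autoD[OF P aut(1) x] by (simp add: compose_def)
  qed (auto simp: compose_def)
  then show "rep_action S v G (\<phi> \<otimes>\<^bsub>mcg S\<^esub> \<psi>) C = rep_action S v G \<phi> (rep_action S v G \<psi> C)"
    unfolding \<rho>(2) rep_action_eq[OF G M.m_closed[OF \<phi> \<psi>] \<sigma>\<tau> \<rho>(1)] rep_action_eq[OF G \<psi> \<tau> \<rho>(1)]
      rep_action_eq[OF G \<phi> \<sigma> reps_compose_inv[OF P aut(2) \<rho>(1)]] by simp
qed

end

section \<open>Holonomy of local systems\<close>

text \<open>A local system is given by sections \<open>F i\<close> over the sets of an open cover, relative to a set-theoretic
  trivialisation; they need not be continuous, only their quotients on overlaps are locally constant.\<close>

locale local_system = group G for G :: "('h, 'c) monoid_scheme" (structure) +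
  fixes S :: "'p::topological_space set" and I :: "'i set" and W :: "'i \<Rightarrow> 'p set" and F :: "'i \<Rightarrow> 'p \<Rightarrow> 'h"
  assumes F_closed [simp]: "i \<in> I \<Longrightarrow> x \<in> W i \<Longrightarrow> F i x \<in> carrier G"
    and W_open: "i \<in> I \<Longrightarrow> openin (top_of_set S) (W i)"
    and cover: "x \<in> S \<Longrightarrow> \<exists>i\<in>I. x \<in> W i"
    and compat: "i \<in> I \<Longrightarrow> j \<in> I \<Longrightarrow> x \<in> W i \<Longrightarrow> x \<in> W j \<Longrightarrow>
      \<exists>V. openin (top_of_set S) V \<and> x \<in> V \<and>
        (\<forall>y\<in>V \<inter> W i \<inter> W j. F i y \<otimes> inv (F j y) = F i x \<otimes> inv (F j x))"
begin

text \<open>Parallel lifts along a map from an arbitrary space: \<open>f\<close> is locally a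
  constant left multiple of a section. Lifts over intervals define holonomy, lifts over squares give
  its homotopy invariance.\<close>

definition flat :: "'a::topological_space set \<Rightarrow> ('a \<Rightarrow> 'p) \<Rightarrow> ('a \<Rightarrow> 'h) \<Rightarrow> bool" where
  "flat X c f \<longleftrightarrow> f \<in> X \<rightarrow> carrier G \<and> continuous_on X c \<and> c \<in> X \<rightarrow> S \<and>
     (\<forall>x\<in>X. \<exists>i\<in>I. \<exists>h\<in>carrier G. \<exists>V. open V \<and> x \<in> V \<and> (\<forall>y\<in>V \<inter> X. c y \<in> W i \<and> f y = h \<otimes> F i (c y)))"

lemma preimage_open:
  assumes "continuous_on X c" "c \<in> X \<rightarrow> S" "openin (top_of_set S) U" "x \<in> X" "c x \<in> U"
  obtains V where "open V" "x \<in> V" "\<forall>y\<in>V \<inter> X. c y \<in> U"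
proof -
  have "openin (top_of_set X) (X \<inter> c -` U)"
    using assms by (intro continuous_openin_preimage)
  then obtain V where "open V" "X \<inter> c -` U = X \<inter> V"
    by (auto simp: openin_open)
  then show thesis
    using assms that[of V] by blast
qed

text \<open>The local form of a lift can be expressed in any section over the given point, because
  on overlaps the sections differ by a locally constant left factor.\<close>

lemma flat_at:
  assumes "flat X c f" "x \<in> X" "j \<in> I" "c x \<in> W j"
  obtains h V where "h \<in> carrier G" "open V" "x \<in> V" "\<forall>y\<in>V \<inter> X. c y \<in> W j \<and> f y = h \<otimes> F j (c y)"
proof -
  have c: "continuous_on X c" "c \<in> X \<rightarrow> S" using assms by (auto simp: flat_def)
  obtain i h V where i: "i \<in> I" "h \<in> carrier G" "open V" "x \<in> V"
    and V: "\<forall>y\<in>V \<inter> X. c y \<in> W i \<and> f y = h \<otimes> F i (c y)"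
    using assms(1,2) unfolding flat_def by blast
  have ci: "c x \<in> W i" using V i assms(2) by blast
  obtain U where U: "openin (top_of_set S) U" "c x \<in> U"
    "\<And>y. y \<in> U \<inter> W i \<inter> W j \<Longrightarrow> F i y \<otimes> inv (F j y) = F i (c x) \<otimes> inv (F j (c x))"
    using compat[OF i(1) assms(3) ci assms(4)] by blast
  have "openin (top_of_set S) (U \<inter> W j)" using U W_open[OF assms(3)] by blast
  then obtain V' where V': "open V'" "x \<in> V'" "\<forall>y\<in>V' \<inter> X. c y \<in> U \<inter> W j"
    by (rule preimage_open[OF c _ assms(2)]) (use U(2) assms(4) in auto)
  define k where "k = F i (c x) \<otimes> inv (F j (c x))"
  have k: "k \<in> carrier G" using i ci assms by (simp add: k_def)
  show thesis
  proof (rule that[of "h \<otimes> k" "V \<inter> V'"], goal_cases)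
    case 4
    show ?case
    proof
    fix y assume y: "y \<in> V \<inter> V' \<inter> X"
    then have y': "c y \<in> W i" "f y = h \<otimes> F i (c y)" "c y \<in> U" "c y \<in> W j"
      using V V'(3) by auto
    then have "F i (c y) \<otimes> inv (F j (c y)) = k"
      using U(3)[of "c y"] by (simp add: k_def)
    then have "F i (c y) = k \<otimes> F j (c y)"
      using y' i assms(3) k by (metis F_closed inv_closed inv_solve_right)
    then show "c y \<in> W j \<and> f y = h \<otimes> k \<otimes> F j (c y)"
      using y' i(2) k assms(3) by (simp add: m_assoc)
    qed
  qed (use i k V' in auto)
qed

lemma flatI:
  assumes "continuous_on X c" "c \<in> X \<rightarrow> S" "f \<in> X \<rightarrow> carrier G"
    and "\<And>x. x \<in> X \<Longrightarrow> \<exists>i\<in>I. \<exists>h\<in>carrier G. \<exists>V. open V \<and> x \<in> V \<and> (\<forall>y\<in>V \<inter> X. c y \<in> W i \<and> f y = h \<otimes> F i (c y))"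
  shows "flat X c f"
  using assms by (simp add: flat_def)

lemma flatD:
  assumes "flat X c f"
  shows "continuous_on X c" "c \<in> X \<rightarrow> S" "x \<in> X \<Longrightarrow> f x \<in> carrier G" "x \<in> X \<Longrightarrow> c x \<in> S"
  using assms by (auto simp: flat_def)

lemma flat_compose:
  assumes f: "flat Y c f" and \<phi>: "continuous_on X \<phi>" "\<phi> \<in> X \<rightarrow> Y"
  shows "flat X (c \<circ> \<phi>) (f \<circ> \<phi>)"
proof (rule flatI)
  show "continuous_on X (c \<circ> \<phi>)"
    using flatD(1)[OF f] \<phi> by (intro continuous_on_compose) (auto intro: continuous_on_subset)
  show "c \<circ> \<phi> \<in> X \<rightarrow> S" "f \<circ> \<phi> \<in> X \<rightarrow> carrier G"
    using flatD[OF f] \<phi>(2) by (auto simp: Pi_iff)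
  fix x assume x: "x \<in> X"
  then obtain i h V where *: "i \<in> I" "h \<in> carrier G" "open V" "\<phi> x \<in> V"
    "\<forall>y\<in>V \<inter> Y. c y \<in> W i \<and> f y = h \<otimes> F i (c y)"
    using f \<phi>(2) unfolding flat_def by (metis PiE)
  have "openin (top_of_set X) (X \<inter> \<phi> -` V)"
    using \<phi>(1) *(3) by (simp add: continuous_openin_preimage_gen)
  then obtain V' where "open V'" "X \<inter> \<phi> -` V = X \<inter> V'"
    by (auto simp: openin_open)
  then have "open V' \<and> x \<in> V' \<and> (\<forall>y\<in>V' \<inter> X. (c \<circ> \<phi>) y \<in> W i \<and> (f \<circ> \<phi>) y = h \<otimes> F i ((c \<circ> \<phi>) y))"
    using * x \<phi>(2) by auto
  then show "\<exists>i\<in>I. \<exists>h\<in>carrier G. \<exists>V. open V \<and> x \<in> V \<and> (\<forall>y\<in>V \<inter> X. (c \<circ> \<phi>) y \<in> W i \<and> (f \<circ> \<phi>) y = h \<otimes> F i ((c \<circ> \<phi>) y))"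
    using *(1,2) by blast
qed

lemma flat_subset: "flat Y c f \<Longrightarrow> X \<subseteq> Y \<Longrightarrow> flat X c f"
  using flat_compose[of Y c f X "\<lambda>x. x"] by (auto simp: o_def)

lemma flat_cong:
  assumes "flat X c f" "\<And>x. x \<in> X \<Longrightarrow> c x = c' x" "\<And>x. x \<in> X \<Longrightarrow> f x = f' x"
  shows "flat X c' f'"
proof -
  have "continuous_on X c'" using flatD(1)[OF assms(1)] assms(2) by (simp cong: continuous_on_cong)
  then show ?thesis
    using assms unfolding flat_def by (auto 4 4 simp: Pi_iff)
qed

lemma flat_mult:
  assumes f: "flat X c f" and k: "k \<in> carrier G"
  shows "flat X c (\<lambda>x. k \<otimes> f x)"
proof (rule flatI)
  fix x assume x: "x \<in> X"
  then obtain i where i: "i \<in> I" "c x \<in> W i" using cover flatD[OF f] by blast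
  obtain h V where *: "h \<in> carrier G" "open V" "x \<in> V" "\<forall>y\<in>V \<inter> X. c y \<in> W i \<and> f y = h \<otimes> F i (c y)"
    by (rule flat_at[OF f x i])
  then have "\<forall>y\<in>V \<inter> X. c y \<in> W i \<and> k \<otimes> f y = (k \<otimes> h) \<otimes> F i (c y)"
    using k i by (auto simp: m_assoc)
  then show "\<exists>i\<in>I. \<exists>h\<in>carrier G. \<exists>V. open V \<and> x \<in> V \<and> (\<forall>y\<in>V \<inter> X. c y \<in> W i \<and> k \<otimes> f y = h \<otimes> F i (c y))"
    using * i k by blast
qed (use flatD[OF f] k in auto)

text \<open>The quotient of two lifts is locally constant, hence constant on a connected
  set.\<close>

lemma flat_unique:
  assumes f: "flat X c f" and f': "flat X c f'" and "connected X"
  obtains h where "h \<in> carrier G" "\<forall>x\<in>X. f' x = h \<otimes> f x"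
proof (cases "X = {}")
  case False
  then obtain a where a: "a \<in> X" by blast
  let ?r = "\<lambda>x. f' x \<otimes> inv (f x)"
  have "?r x = ?r a" if "x \<in> X" for x
  proof (rule connected_local_const[OF assms(3) that a], intro ballI)
    fix b assume b: "b \<in> X"
    then obtain i where i: "i \<in> I" "c b \<in> W i" using cover flatD[OF f] by blast
    obtain h V where *: "h \<in> carrier G" "open V" "b \<in> V" "\<forall>y\<in>V \<inter> X. c y \<in> W i \<and> f y = h \<otimes> F i (c y)"
      by (rule flat_at[OF f b i])
    obtain h' V' where **: "h' \<in> carrier G" "open V'" "b \<in> V'" "\<forall>y\<in>V' \<inter> X. c y \<in> W i \<and> f' y = h' \<otimes> F i (c y)"
      by (rule flat_at[OF f' b i])
    have "?r y = h' \<otimes> inv h" if "y \<in> V \<inter> V' \<inter> X" for y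
    proof -
      have "F i (c y) \<otimes> (inv (F i (c y)) \<otimes> inv h) = inv h"
        using *(1,4) i that by (simp add: m_assoc[symmetric])
      then show ?thesis
        using *(1,4) **(1,4) that i by (simp add: inv_mult_group m_assoc)
    qed
    then have "\<forall>y\<in>V \<inter> V' \<inter> X. ?r b = ?r y" using * ** b by auto
    then show "\<forall>\<^sub>F y in at b within X. ?r b = ?r y"
      using *(2,3) **(2,3) unfolding eventually_at_topological by (intro exI[of _ "V \<inter> V'"]) auto
  qed
  moreover have "f' x = ?r x \<otimes> f x" if "x \<in> X" for x
    using flatD(3)[OF f that] flatD(3)[OF f' that] by (simp add: m_assoc)
  ultimately have "\<forall>x\<in>X. f' x = ?r a \<otimes> f x" by metis
  moreover have "?r a \<in> carrier G" using flatD(3)[OF f a] flatD(3)[OF f' a] by simp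
  ultimately show thesis by (intro that)
qed (use that in auto)

text \<open>On the connected overlap the two lifts differ by one left factor, which is absorbed into
  the second lift.\<close>

lemma flat_glue:
  assumes f1: "flat X1 c f1" and f2: "flat X2 c f2" and cl: "closed X1" "closed X2" and con: "connected (X1 \<inter> X2)"
  obtains f where "flat (X1 \<union> X2) c f"
proof -
  obtain h where h: "h \<in> carrier G" "\<forall>x\<in>X1 \<inter> X2. f1 x = h \<otimes> f2 x"
    by (rule flat_unique[OF flat_subset[OF f2 Int_lower2] flat_subset[OF f1 Int_lower1] con])
  define f where "f x = (if x \<in> X1 then f1 x else h \<otimes> f2 x)" for x
  have g1: "flat X1 c f" by (rule flat_cong[OF f1]) (auto simp: f_def)
  have g2: "flat X2 c f" by (rule flat_cong[OF flat_mult[OF f2 h(1)]]) (auto simp: f_def h)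
  have "flat (X1 \<union> X2) c f"
  proof (rule flatI)
    show "continuous_on (X1 \<union> X2) c"
      using flatD[OF f1] flatD[OF f2] cl by (intro continuous_on_closed_Un)
    fix x assume x: "x \<in> X1 \<union> X2"
    then have "c x \<in> S" using flatD[OF f1] flatD[OF f2] by auto
    then obtain i where i: "i \<in> I" "c x \<in> W i" using cover by blast
    \<comment> \<open>If the point lies outside the closed set \<open>X\<close>, the complement of
      \<open>X\<close> is a neighbourhood on which the condition is vacuous.\<close>
    have loc: "\<exists>h V. h \<in> carrier G \<and> open V \<and> x \<in> V \<and> (\<forall>y\<in>V \<inter> X. c y \<in> W i \<and> f y = h \<otimes> F i (c y))"
      if "flat X c f" "closed X" for X
    proof (cases "x \<in> X")
      case True
      show ?thesis by (rule flat_at[OF that(1) True i]) blast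
    next
      case False
      then show ?thesis using that(2) by (intro exI[of _ \<one>] exI[of _ "- X"]) auto
    qed
    obtain h1 V1 where 1: "h1 \<in> carrier G" "open V1" "x \<in> V1" "\<forall>y\<in>V1 \<inter> X1. c y \<in> W i \<and> f y = h1 \<otimes> F i (c y)"
      using loc[OF g1 cl(1)] by blast
    obtain h2 V2 where 2: "h2 \<in> carrier G" "open V2" "x \<in> V2" "\<forall>y\<in>V2 \<inter> X2. c y \<in> W i \<and> f y = h2 \<otimes> F i (c y)"
      using loc[OF g2 cl(2)] by blast
    have "\<exists>h\<in>carrier G. \<exists>V. open V \<and> x \<in> V \<and> (\<forall>y\<in>V \<inter> (X1 \<union> X2). c y \<in> W i \<and> f y = h \<otimes> F i (c y))"
    proof -
      consider "x \<in> X1" "x \<in> X2" | "x \<notin> X1" "x \<in> X2" | "x \<in> X1" "x \<notin> X2" using x by auto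
      then show ?thesis
      proof cases
        case 1
        with \<open>\<forall>y\<in>V1 \<inter> X1. _ y\<close> \<open>\<forall>y\<in>V2 \<inter> X2. _ y\<close> \<open>x \<in> V1\<close> \<open>x \<in> V2\<close>
        have "h1 \<otimes> F i (c x) = h2 \<otimes> F i (c x)" by force
        then have "h1 = h2" using \<open>h1 \<in> carrier G\<close> \<open>h2 \<in> carrier G\<close> i by simp
        then show ?thesis
          using \<open>\<forall>y\<in>V1 \<inter> X1. _ y\<close> \<open>\<forall>y\<in>V2 \<inter> X2. _ y\<close> \<open>h1 \<in> carrier G\<close> \<open>x \<in> V1\<close> \<open>x \<in> V2\<close> \<open>open V1\<close> \<open>open V2\<close>
          by (intro bexI[of _ h1] exI[of _ "V1 \<inter> V2"]) auto
      next
        case 2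
        then show ?thesis using \<open>\<forall>y\<in>V2 \<inter> X2. _ y\<close> \<open>h2 \<in> carrier G\<close> \<open>x \<in> V2\<close> \<open>open V2\<close> cl(1)
          by (intro bexI[of _ h2] exI[of _ "V2 \<inter> - X1"]) auto
      next
        case 3
        then show ?thesis using \<open>\<forall>y\<in>V1 \<inter> X1. _ y\<close> \<open>h1 \<in> carrier G\<close> \<open>x \<in> V1\<close> \<open>open V1\<close> cl(2)
          by (intro bexI[of _ h1] exI[of _ "V1 \<inter> - X2"]) auto
      qed
    qed
    then show "\<exists>i\<in>I. \<exists>h\<in>carrier G. \<exists>V. open V \<and> x \<in> V \<and> (\<forall>y\<in>V \<inter> (X1 \<union> X2). c y \<in> W i \<and> f y = h \<otimes> F i (c y))"
      using i by blast
  qed (use flatD[OF g1] flatD[OF g2] in auto)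
  then show thesis by (rule that)
qed

lemma flat_local:
  assumes "continuous_on X c" "c \<in> X \<rightarrow> S" "i \<in> I" "\<And>x. x \<in> X \<Longrightarrow> c x \<in> W i"
  shows "flat X c (\<lambda>x. F i (c x))"
proof (rule flatI)
  fix x assume "x \<in> X"
  show "\<exists>j\<in>I. \<exists>h\<in>carrier G. \<exists>V. open V \<and> x \<in> V \<and> (\<forall>y\<in>V \<inter> X. c y \<in> W j \<and> F i (c y) = h \<otimes> F j (c y))"
    using assms by (intro bexI[of _ i] bexI[of _ \<one>] exI[of _ UNIV]) auto
qed (use assms in auto)

text \<open>Bisection takes the place of a subdivision into small squares. It is applied twice: in
  the first coordinate to strips of full height, and inside its local step in the second coordinate
  to rectangles. Neighbouring rectangles meet in a segment, which is connected, so their lifts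
  glue.\<close>

lemma flat_exists_square:
  fixes c :: "real \<times> real \<Rightarrow> 'p"
  assumes c: "continuous_on ({0..1} \<times> {0..1}) c" "c \<in> {0..1} \<times> {0..1} \<rightarrow> S"
  obtains f where "flat ({0..1} \<times> {0..1}) c f"
proof -
  let ?F = "\<lambda>a b t t'. \<exists>f. flat ({a..b} \<times> {t..t'}) c f"
  have glue_s: "?F a d t t'" if "?F a b t t'" "?F b d t t'" "a \<le> b" "b \<le> d" for a b d t t'
  proof -
    have "({a..b} \<times> {t..t'}) \<inter> ({b..d} \<times> {t..t'}) = {b} \<times> {t..t'}" using that by auto
    then have "connected (({a..b} \<times> {t..t'}) \<inter> ({b..d} \<times> {t..t'}))" by (auto intro!: connected_Times)
    moreover have "({a..b} \<times> {t..t'}) \<union> ({b..d} \<times> {t..t'}) = {a..d} \<times> {t..t'}" using that by auto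
    ultimately show ?thesis
      using that(1,2) flat_glue[of "{a..b} \<times> {t..t'}" c _ "{b..d} \<times> {t..t'}"] by (metis closed_Times closed_atLeastAtMost)
  qed
  have glue_t: "?F a b t t''" if "?F a b t t'" "?F a b t' t''" "t \<le> t'" "t' \<le> t''" for a b t t' t''
  proof -
    have "({a..b} \<times> {t..t'}) \<inter> ({a..b} \<times> {t'..t''}) = {a..b} \<times> {t'}" using that by auto
    then have "connected (({a..b} \<times> {t..t'}) \<inter> ({a..b} \<times> {t'..t''}))" by (auto intro!: connected_Times)
    moreover have "({a..b} \<times> {t..t'}) \<union> ({a..b} \<times> {t'..t''}) = {a..b} \<times> {t..t''}" using that by auto
    ultimately show ?thesis
      using that(1,2) flat_glue[of "{a..b} \<times> {t..t'}" c _ "{a..b} \<times> {t'..t''}"] by (metis closed_Times closed_atLeastAtMost)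
  qed
  define P where "P a b \<longleftrightarrow> (0 \<le> a \<and> b \<le> 1 \<longrightarrow> ?F a b 0 1)" for a b
  have "(0::real) \<le> 1" by simp
  then have "P 0 1"
  proof (induction rule: Bolzano)
    case (trans a b d)
    show ?case
      unfolding P_def
    proof
      assume "0 \<le> a \<and> d \<le> 1"
      then have "?F a b 0 1" "?F b d 0 1" using trans by (simp_all add: P_def)
      then show "?F a d 0 1" by (rule glue_s) (fact trans(3,4))+
    qed
  next
    case (local s)
    \<comment> \<open>The width \<open>d\<close> serves all intervals around \<open>s\<close> at
      once, so two rectangles stacked on each other can use the smaller of their widths.\<close>
    define Q where "Q t t' \<longleftrightarrow> (0 \<le> t \<and> t' \<le> 1 \<longrightarrow>
      (\<exists>d>0. \<forall>a b. a \<le> s \<and> s \<le> b \<and> b - a < d \<and> 0 \<le> a \<and> b \<le> 1 \<longrightarrow> ?F a b t t'))" for t t'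
    have "(0::real) \<le> 1" by simp
    then have "Q 0 1"
    proof (induction rule: Bolzano)
      case (trans t t' t'')
      show ?case
        unfolding Q_def
      proof
        assume t: "0 \<le> t \<and> t'' \<le> 1"
        have t': "0 \<le> t \<and> t' \<le> 1" "0 \<le> t' \<and> t'' \<le> 1" using t trans(3,4) by auto
        obtain d where d: "d > 0" "\<forall>a b. a \<le> s \<and> s \<le> b \<and> b - a < d \<and> 0 \<le> a \<and> b \<le> 1 \<longrightarrow> ?F a b t t'"
          using trans(1)[unfolded Q_def, THEN mp, OF t'(1)] by (elim exE conjE)
        obtain d' where d': "d' > 0" "\<forall>a b. a \<le> s \<and> s \<le> b \<and> b - a < d' \<and> 0 \<le> a \<and> b \<le> 1 \<longrightarrow> ?F a b t' t''"
          using trans(2)[unfolded Q_def, THEN mp, OF t'(2)] by (elim exE conjE)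
        show "\<exists>d>0. \<forall>a b. a \<le> s \<and> s \<le> b \<and> b - a < d \<and> 0 \<le> a \<and> b \<le> 1 \<longrightarrow> ?F a b t t''"
        proof (intro exI[of _ "min d d'"] conjI allI impI)
          fix a b assume ab: "a \<le> s \<and> s \<le> b \<and> b - a < min d d' \<and> 0 \<le> a \<and> b \<le> 1"
          show "?F a b t t''"
          proof (rule glue_t[OF _ _ trans(3,4)])
            show "?F a b t t'" using d(2) ab by simp
            show "?F a b t' t''" using d'(2) ab by simp
          qed
        qed (use d d' in simp)
      qed
    next
      case (local t)
      have st: "(s, t) \<in> {0..1} \<times> {0..1}" using local \<open>0 \<le> s\<close> \<open>s \<le> 1\<close> by auto
      then obtain i where i: "i \<in> I" "c (s, t) \<in> W i" using cover c(2) by blast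
      obtain V where V: "open V" "(s, t) \<in> V" "\<forall>y\<in>V \<inter> ({0..1} \<times> {0..1}). c y \<in> W i"
        by (rule preimage_open[OF c W_open[OF i(1)] st i(2)])
      obtain e where e: "e > 0" "ball (s, t) e \<subseteq> V" using V(1,2) open_contains_ball by blast
      \<comment> \<open>With sides shorter than half of \<open>e\<close> the rectangle fits into the
        ball, as the distance is at most the sum of the coordinate differences.\<close>
      have loc: "?F a b t0 t1" if "a \<le> s" "s \<le> b" "b - a < e / 2" "0 \<le> a" "b \<le> 1"
         "t0 \<le> t" "t \<le> t1" "t1 - t0 < e / 2" "0 \<le> t0" "t1 \<le> 1" for a b t0 t1
      proof -
        have sub: "{a..b} \<times> {t0..t1} \<subseteq> {0..1} \<times> {0..1}" using that by auto
        have "y \<in> V" if y: "y \<in> {a..b} \<times> {t0..t1}" for y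
        proof -
          have "dist (s, t) y \<le> \<bar>s - fst y\<bar> + \<bar>t - snd y\<bar>"
            using sqrt_sum_squares_le_sum_abs[of "s - fst y" "t - snd y"]
            by (cases y) (simp add: dist_prod_def dist_real_def)
          also have "\<dots> < e" using y \<open>a \<le> s\<close> \<open>s \<le> b\<close> \<open>b - a < e / 2\<close> \<open>t0 \<le> t\<close> \<open>t \<le> t1\<close> \<open>t1 - t0 < e / 2\<close> by auto
          finally show ?thesis using e by auto
        qed
        then have "flat ({a..b} \<times> {t0..t1}) c (\<lambda>x. F i (c x))"
          using sub c V(3) i(1) by (intro flat_local) (auto intro: continuous_on_subset)
        then show ?thesis by blast
      qed
      show ?case
        unfolding Q_def
      proof (intro exI[of _ "e / 2"] conjI allI impI)
        fix t0 t1 a b assume "t0 \<le> t \<and> t \<le> t1 \<and> t1 - t0 < e / 2" "0 \<le> t0 \<and> t1 \<le> 1"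
          "a \<le> s \<and> s \<le> b \<and> b - a < e / 2 \<and> 0 \<le> a \<and> b \<le> 1"
        then show "?F a b t0 t1" by (intro loc) auto
      qed (use e(1) in auto)
    qed
    then obtain d where d: "d > 0" "\<forall>a b. a \<le> s \<and> s \<le> b \<and> b - a < d \<and> 0 \<le> a \<and> b \<le> 1 \<longrightarrow> ?F a b 0 1"
      unfolding Q_def by auto
    show ?case
    proof (intro exI[of _ d] conjI allI impI)
      fix a b assume "a \<le> s \<and> s \<le> b \<and> b - a < d"
      then show "P a b" using d(2) by (simp add: P_def)
    qed (rule d(1))
  qed
  then show thesis using that by (auto simp: P_def)
qed

lemma flat_exists_path:
  assumes "p \<in> paths_in S x y"
  obtains f where "flat {0..1} p f"
proof -
  have p: "continuous_on {0..1} p" "p \<in> {0..1} \<rightarrow> S"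
    using assms by (auto simp: paths_in_def path_def path_image_def)
  have "continuous_on ({0..1} \<times> {0..1}) (\<lambda>z::real \<times> real. p (snd z))"
    by (rule continuous_on_compose2[OF p(1)]) (auto intro!: continuous_intros)
  then obtain f where "flat ({0..1} \<times> {0..1}) (\<lambda>z::real \<times> real. p (snd z)) f"
    by (rule flat_exists_square) (use p in auto)
  from flat_compose[OF this, of "{0..1}" "\<lambda>t. (0, t)"] show thesis
    using that by (force simp: o_def intro: continuous_intros)
qed

section \<open>Holonomy along paths\<close>

definition hol :: "(real \<Rightarrow> 'p) \<Rightarrow> 'h" where
  "hol p = (let f = SOME f. flat {0..1} p f in inv (f 1) \<otimes> f 0)"

text \<open>Two lifts differ by a left factor, which cancels in the quotient of the end values.
  Putting the inverse of the final value first makes the holonomy of a join multiply from right to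
  left.\<close>

lemma hol_eq:
  assumes "flat {0..1} p f"
  shows "hol p = inv (f 1) \<otimes> f 0"
proof -
  define f' where "f' = (SOME f. flat {0..1} p f)"
  have f': "flat {0..1} p f'" unfolding f'_def by (rule someI[of "flat {0..1} p", OF assms])
  obtain h where h: "h \<in> carrier G" "\<forall>x\<in>{0..1}. f' x = h \<otimes> f x"
    by (rule flat_unique[OF assms f']) auto
  have f: "f 0 \<in> carrier G" "f 1 \<in> carrier G" using flatD(3)[OF assms] by auto
  have "hol p = inv (h \<otimes> f 1) \<otimes> (h \<otimes> f 0)"
    unfolding hol_def Let_def f'_def[symmetric] using h(2) by simp
  also have "\<dots> = inv (f 1) \<otimes> (inv h \<otimes> (h \<otimes> f 0))"
    using h(1) f by (simp add: inv_mult_group m_assoc)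
  also have "inv h \<otimes> (h \<otimes> f 0) = f 0"
    using h(1) f by (simp add: m_assoc[symmetric])
  finally show ?thesis .
qed

lemma hol_closed:
  assumes "p \<in> paths_in S x y"
  shows "hol p \<in> carrier G"
proof -
  obtain f where f: "flat {0..1} p f" by (rule flat_exists_path[OF assms])
  show ?thesis unfolding hol_eq[OF f] using flatD(3)[OF f] by simp
qed

text \<open>Over a constant map the constant value of a section is itself a lift, and every other
  lift is a multiple of it.\<close>

lemma flat_const:
  assumes f: "flat X c f" and "connected X" "\<And>x. x \<in> X \<Longrightarrow> c x = y" "a \<in> X" "b \<in> X"
  shows "f a = f b"
proof -
  have "y \<in> S" using assms flatD(4)[OF f] by blast
  then obtain i where i: "i \<in> I" "y \<in> W i" using cover by blast
  have "flat X c (\<lambda>_. F i y)"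
    by (rule flat_cong[OF flat_local[OF flatD(1,2)[OF f] i(1)]]) (use assms i in auto)
  then obtain h where "\<forall>x\<in>X. f x = h \<otimes> F i y"
    using flat_unique[OF _ f \<open>connected X\<close>] by blast
  then show ?thesis using assms by simp
qed

text \<open>A lift over the whole homotopy is constant on the two sides where the homotopy rests at
  the end points, so the lifts over the other two sides have the same end values.\<close>

lemma hol_homotopic:
  assumes "homotopic_paths S p p'"
  shows "hol p = hol p'"
proof -
  obtain h :: "real \<times> real \<Rightarrow> 'p" where h: "continuous_on ({0..1} \<times> {0..1}) h" "h \<in> ({0..1} \<times> {0..1}) \<rightarrow> S"
    "\<forall>x\<in>{0..1}. h (0, x) = p x" "\<forall>x\<in>{0..1}. h (1, x) = p' x"
    "\<forall>t\<in>{0..1}. h (t, 0) = p 0 \<and> h (t, 1) = p 1"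
    using assms unfolding homotopic_paths pathstart_def pathfinish_def o_def by (elim exE conjE)
  obtain f where f: "flat ({0..1} \<times> {0..1}) h f"
    by (rule flat_exists_square[OF h(1,2)])
  have side: "flat {0..1} r (f \<circ> \<phi>)" if "continuous_on {0..1} \<phi>" "\<phi> \<in> {0..1} \<rightarrow> {0..1} \<times> {0..1}" "\<And>t. t \<in> {0..1} \<Longrightarrow> h (\<phi> t) = r t" for r and \<phi> :: "real \<Rightarrow> real \<times> real"
    by (rule flat_cong[OF flat_compose[OF f that(1,2)]]) (use that in auto)
  have Pair: "continuous_on {0..1} (Pair a :: real \<Rightarrow> real \<times> real)" for a
    by (intro continuous_intros)
  have "hol p = inv (f (0, 1)) \<otimes> f (0, 0)"
    using hol_eq[OF side[of "\<lambda>t. (0, t)" p]] h Pair by (auto simp: o_def)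
  moreover have "hol p' = inv (f (1, 1)) \<otimes> f (1, 0)"
    using hol_eq[OF side[of "\<lambda>t. (1, t)" p']] h Pair by (auto simp: o_def)
  moreover have "flat {0..1} (\<lambda>_. p 0) (f \<circ> (\<lambda>t. (t, 0)))"
    by (rule side) (use h in \<open>auto intro!: continuous_intros\<close>)
  from flat_const[OF this, of _ 0 1] have "f (0, 0) = f (1, 0)" by simp
  moreover have "flat {0..1} (\<lambda>_. p 1) (f \<circ> (\<lambda>t. (t, 1)))"
    by (rule side) (use h in \<open>auto intro!: continuous_intros\<close>)
  from flat_const[OF this, of _ 0 1] have "f (0, 1) = f (1, 1)" by simp
  ultimately show ?thesis by simp
qed

text \<open>One lift over the joined path, restricted to its two halves, computes all three
  holonomies; the value in the middle cancels.\<close>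

lemma hol_join:
  assumes p: "p \<in> paths_in S x y" and p': "p' \<in> paths_in S y z"
  shows "hol (p +++ p') = hol p' \<otimes> hol p"
proof -
  obtain f where f: "flat {0..1} (p +++ p') f" by (rule flat_exists_path[OF paths_in_join[OF p p']])
  have "flat {0..1} p (f \<circ> (\<lambda>t. t / 2))"
    by (rule flat_cong[OF flat_compose[OF f, of "{0..1}" "\<lambda>t. t / 2"]])
       (auto simp: joinpaths_def intro!: continuous_intros)
  moreover have "flat {0..1} p' (f \<circ> (\<lambda>t. (t + 1) / 2))"
    by (rule flat_cong[OF flat_compose[OF f, of "{0..1}" "\<lambda>t. (t + 1) / 2"]])
       (use p p' in \<open>auto simp: joinpaths_def paths_in_def pathstart_def pathfinish_def add_divide_distrib intro!: continuous_intros\<close>)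
  ultimately have "hol p' \<otimes> hol p = (inv (f 1) \<otimes> f (1/2)) \<otimes> (inv (f (1/2)) \<otimes> f 0)"
    by (simp add: hol_eq)
  moreover have "f (1/2) \<otimes> (inv (f (1/2)) \<otimes> f 0) = f 0"
    using flatD(3)[OF f, of "1/2"] flatD(3)[OF f, of 0] by (simp add: m_assoc[symmetric])
  ultimately show ?thesis
    using flatD(3)[OF f, of "1/2"] flatD(3)[OF f, of 0] flatD(3)[OF f, of 1] by (simp add: hol_eq[OF f] m_assoc)
qed

lemma hol_rep:
  obtains \<rho> where "\<rho> \<in> reps (pi1 S v) G" "\<forall>p\<in>paths_in S v v. \<rho> (loop_class S p) = hol p"
proof -
  define \<rho> where "\<rho> = (\<lambda>P\<in>carrier (pi1 S v). hol (SOME p. p \<in> P))"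
  have \<rho>: "\<rho> (loop_class S p) = hol p" if p: "p \<in> paths_in S v v" for p
  proof -
    have "p \<in> loop_class S p" using p by (simp add: loop_class_def paths_in_def)
    then have "(SOME r. r \<in> loop_class S p) \<in> loop_class S p" unfolding some_in_eq by blast
    then have "hol (SOME r. r \<in> loop_class S p) = hol p"
      by (simp add: loop_class_def hol_homotopic)
    then show ?thesis using p by (simp add: \<rho>_def carrier_pi1)
  qed
  have "\<rho> \<in> hom (pi1 S v) G"
  proof (rule homI)
    show "\<rho> P \<in> carrier G" if "P \<in> carrier (pi1 S v)" for P
      using that \<rho> by (auto simp: carrier_pi1 intro: hol_closed)
    show "\<rho> (P \<otimes>\<^bsub>pi1 S v\<^esub> P') = \<rho> P \<otimes> \<rho> P'" if "P \<in> carrier (pi1 S v)" "P' \<in> carrier (pi1 S v)" for P P'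
      using that by (auto simp: carrier_pi1 pi1_mult \<rho> paths_in_join hol_join)
  qed
  then show thesis
    using that[of \<rho>] \<rho> by (simp add: reps_def \<rho>_def)
qed

end

section \<open>Polar coordinates on the polygon\<close>

text \<open>Clockwise polar coordinates in which the sides of the \<open>4g\<close>-gon have length 1.\<close>

definition pol :: "nat \<Rightarrow> real \<Rightarrow> real \<Rightarrow> complex" where
  "pol g r u = of_real r * cis (- (2 * pi * u / (4 * real g)))"

definition angle_coord :: "nat \<Rightarrow> complex \<Rightarrow> real" where
  "angle_coord g z = - (4 * real g / (2 * pi)) * Arg z"

lemma side_pol: "side g k t = pol g 1 (real k + t)"
  by (simp add: side_def pol_def)

lemma norm_pol [simp]: "norm (pol g r u) = \<bar>r\<bar>"
  by (simp add: pol_def norm_mult)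

lemma pol_0: "pol g r 0 = of_real r"
  by (simp add: pol_def)

lemma pol_angle_coord:
  assumes "g \<ge> 1"
  shows "pol g (norm z) (angle_coord g z) = z"
proof -
  have "- (2 * pi * angle_coord g z / (4 * real g)) = Arg z"
    using assms by (simp add: angle_coord_def)
  then show ?thesis using rcis_cmod_Arg[of z] by (simp add: pol_def rcis_def)
qed

lemma pol_mult: "pol g r u * pol g r' u' = pol g (r * r') (u + u')"
  by (simp add: pol_def cis_mult algebra_simps add_divide_distrib)

lemma pol_shift:
  assumes "g \<ge> 1"
  shows "pol g r (u + 4 * real g * of_int m) = pol g r u"
proof -
  have "pol g 1 (4 * real g * of_int m) = 1"
    using assms cis_multiple_2pi[of "of_int (- m)"] by (simp add: pol_def mult.assoc)
  then show ?thesis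
    using pol_mult[of g r u 1 "4 * real g * of_int m"] by simp
qed

lemma pol_eqD:
  assumes "g \<ge> 1" "r > 0" "pol g r u = pol g r u'"
  obtains m :: int where "u' = u + 4 * real g * of_int m"
proof -
  have "cis (- (2 * pi * u' / (4 * real g))) = cis (- (2 * pi * u / (4 * real g)))"
    using assms by (simp add: pol_def)
  then have "exp (\<i> * of_real (- (2 * pi * u' / (4 * real g)))) = exp (\<i> * of_real (- (2 * pi * u / (4 * real g))))"
    by (simp add: cis_conv_exp)
  then obtain n :: int where "\<i> * of_real (- (2 * pi * u' / (4 * real g)))
      = \<i> * of_real (- (2 * pi * u / (4 * real g))) + (of_int (2 * n) * pi) * \<i>"
    unfolding exp_eq by blast
  then have "Im (\<i> * of_real (- (2 * pi * u' / (4 * real g))))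
      = Im (\<i> * of_real (- (2 * pi * u / (4 * real g))) + (of_int (2 * n) * pi) * \<i>)" by (rule arg_cong)
  then have "2 * pi * (u' - u) = 2 * pi * (- 4 * real g * n)"
    using assms by (simp add: field_simps)
  then have "u' - u = - 4 * real g * n" by (subst (asm) mult_cancel_left) auto
  then have "u' = u + 4 * real g * of_int (- n)" by simp
  then show thesis by (rule that)
qed

lemma periodic_int:
  fixes F :: "real \<Rightarrow> 'x"
  assumes "\<And>u. F (u + p) = F u"
  shows "F (u + p * of_int m) = F u"
proof (induction m rule: int_induct[of _ 0])
  case (step1 i)
  then show ?case using assms[of "u + p * of_int i"] by (simp add: algebra_simps)
next
  case (step2 i)
  then show ?case using assms[of "u + p * of_int (i - 1)"] by (simp add: algebra_simps)
qed simp

text \<open>\<open>angle_coord\<close> selects one of infinitely many angles, and a function with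
  period \<open>4g\<close> does not notice the choice. Functions on the polygon defined by the angle
  can thus be evaluated at any convenient angle.\<close>

lemma periodic_angle_coord:
  assumes "g \<ge> 1" "\<And>u. F (u + 4 * real g) = F u" "r > 0"
  shows "F (angle_coord g (pol g r u)) = F u"
proof -
  have "pol g r u = pol g r (angle_coord g (pol g r u))"
    using pol_angle_coord[OF assms(1), of "pol g r u"] assms(3) by simp
  then obtain m :: int where "angle_coord g (pol g r u) = u + 4 * real g * of_int m"
    using pol_eqD[OF assms(1,3)] by metis
  then show ?thesis using periodic_int[of F, OF assms(2)] by simp
qed

text \<open>Division by \<open>z0\<close> moves the cut of the argument away: within distance
  \<open>norm z0\<close> of \<open>z0\<close> the quotient \<open>z / z0\<close> has positive real
  part.\<close>

lemma local_polar_coordinate: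
  assumes "g \<ge> 1" "z0 \<noteq> 0"
  obtains U where "continuous_on (ball z0 (norm z0)) U" "U z0 = angle_coord g z0"
    "\<forall>z\<in>ball z0 (norm z0). z \<noteq> 0 \<and> z = pol g (norm z) (U z)"
proof
  define U where "U z = angle_coord g z0 + angle_coord g (z / z0)" for z
  have "z / z0 \<notin> \<real>\<^sub>\<le>\<^sub>0" if "z \<in> ball z0 (norm z0)" for z
  proof
    assume "z / z0 \<in> \<real>\<^sub>\<le>\<^sub>0"
    then have "Re (z / z0) \<le> 0" by (simp add: complex_nonpos_Reals_iff)
    moreover have "Re (1 - z / z0) \<le> norm (1 - z / z0)" by (rule complex_Re_le_cmod)
    moreover have "norm (1 - z / z0) = norm (z0 - z) / norm z0"
      using assms by (simp add: diff_divide_distrib flip: norm_divide)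
    moreover have "norm (z0 - z) / norm z0 < 1"
      using that assms by (simp add: dist_norm)
    ultimately show False by simp
  qed
  then show "continuous_on (ball z0 (norm z0)) U"
    using assms unfolding U_def angle_coord_def by (auto intro!: continuous_intros)
  show "U z0 = angle_coord g z0" using assms by (simp add: U_def angle_coord_def)
  show "\<forall>z\<in>ball z0 (norm z0). z \<noteq> 0 \<and> z = pol g (norm z) (U z)"
  proof
    fix z assume z: "z \<in> ball z0 (norm z0)"
    have "z = z0 * (z / z0)" using assms by simp
    also have "\<dots> = pol g (norm z0) (angle_coord g z0) * pol g (norm (z / z0)) (angle_coord g (z / z0))"
      using assms by (simp only: pol_angle_coord)
    also have "\<dots> = pol g (norm z) (U z)"
      using assms by (simp add: pol_mult U_def norm_divide)
    finally show "z \<noteq> 0 \<and> z = pol g (norm z) (U z)" using z by auto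
  qed
qed

text \<open>Side \<open>k + 2\<close> run backwards has coordinate \<open>(k + 2) + (1 - t)\<close>.
  So both kinds of pairs are instances of one reflection, from \<open>k + t\<close> to
  \<open>k + 3 - t\<close>.\<close>

lemma pairing_cases:
  assumes "(z, z') \<in> side_pairing g"
  obtains k :: nat and t :: real where "k < 4 * g" "k mod 4 < 2" "t \<in> {0..1}"
    "z = pol g 1 (real k + t)" "z' = pol g 1 (real k + 3 - t)"
proof -
  obtain i j t where *: "i < g" "j < 2" "t \<in> {0..1}" "z = side g (4 * i + j) t" "z' = side g (4 * i + j + 2) (1 - t)"
    using assms unfolding side_pairing_def by blast
  show thesis
  proof (rule that[of "4 * i + j" t])
    show "4 * i + j < 4 * g" "(4 * i + j) mod 4 < 2" using *(1,2) by auto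
    show "z = pol g 1 (real (4 * i + j) + t)" by (simp add: *(4) side_pol)
    show "z' = pol g 1 (real (4 * i + j) + 3 - t)" by (simp add: *(5) side_pol algebra_simps)
  qed (rule *(3))
qed

lemma pairing_pol:
  assumes "k < 4 * g" "k mod 4 < 2" "t \<in> {0..1}"
  shows "(pol g 1 (real k + t), pol g 1 (real k + 3 - t)) \<in> side_pairing g"
proof -
  have "k div 4 < g" using assms by auto
  moreover have "pol g 1 (real k + t) = side g k t" "pol g 1 (real k + 3 - t) = side g (k + 2) (1 - t)"
    by (auto simp: side_pol algebra_simps)
  ultimately show ?thesis
    unfolding side_pairing_def using assms(2,3)
    by (intro CollectI exI[of _ "k div 4"] exI[of _ "k mod 4"] exI[of _ t]) simp
qed

section \<open>Closed surfaces as quotients of the polygon\<close>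

text \<open>A continuous map from a compact space to a Hausdorff space is closed. On a saturated
  subset it is therefore a quotient map, even if the subset is neither open nor closed.\<close>

lemma continuous_on_quotient:
  fixes p :: "'a::topological_space \<Rightarrow> 'b::t2_space"
  assumes K: "compact K" "continuous_on K p" and B: "B \<subseteq> K" "\<And>y. y \<in> K \<Longrightarrow> p y \<in> p ` B \<Longrightarrow> y \<in> B"
    and f: "continuous_on B (\<lambda>y. f (p y))"
  shows "continuous_on (p ` B) f"
  unfolding continuous_on_closed_invariant
proof (intro allI impI)
  fix D :: "'c set" assume "closed D"
  then obtain C where C: "closed C" "C \<inter> B = (\<lambda>y. f (p y)) -` D \<inter> B"
    using f unfolding continuous_on_closed_invariant by blast
  have "compact (p ` (C \<inter> K))"
    using K C(1) by (intro compact_continuous_image) (auto intro: continuous_on_subset simp: Int_commute compact_Int_closed)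
  then have "closed (p ` (C \<inter> K))" by (rule compact_imp_closed)
  moreover have "p ` (C \<inter> K) \<inter> p ` B = f -` D \<inter> p ` B"
  proof (intro equalityI subsetI)
    fix x assume "x \<in> p ` (C \<inter> K) \<inter> p ` B"
    then obtain y where y: "y \<in> C" "y \<in> K" "x = p y" "p y \<in> p ` B" by blast
    moreover from B(2)[OF y(2,4)] have "y \<in> B" .
    ultimately show "x \<in> f -` D \<inter> p ` B" using C(2) by blast
  next
    fix x assume "x \<in> f -` D \<inter> p ` B"
    then obtain y where "x = p y" "y \<in> B" "f (p y) \<in> D" by auto
    then show "x \<in> p ` (C \<inter> K) \<inter> p ` B" using C(2) B(1) by blast
  qed
  ultimately show "\<exists>A. closed A \<and> A \<inter> p ` B = f -` D \<inter> p ` B" by blast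
qed

text \<open>The part of \<open>K\<close> outside an open saturated set is compact, so its image is
  closed, and by saturation it is disjoint from the image of the set.\<close>

lemma quotient_open:
  fixes p :: "'a::topological_space \<Rightarrow> 'b::t2_space"
  assumes K: "compact K" "continuous_on K p" and B: "openin (top_of_set K) B" "\<And>y. y \<in> K \<Longrightarrow> p y \<in> p ` B \<Longrightarrow> y \<in> B"
  shows "openin (top_of_set (p ` K)) (p ` B)"
proof -
  obtain V where V: "open V" "B = K \<inter> V" using B(1) by (auto simp: openin_open)
  have "compact (p ` (K - V))"
    using K V(1) by (intro compact_continuous_image compact_diff) (auto intro: continuous_on_subset)
  then have "closed (p ` (K - V))" by (rule compact_imp_closed)
  moreover have "p ` B = p ` K \<inter> - p ` (K - V)"
  proof (intro equalityI subsetI)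
    fix x assume x: "x \<in> p ` B"
    have "x \<notin> p ` (K - V)"
    proof
      assume "x \<in> p ` (K - V)"
      then obtain y where y: "y \<in> K" "y \<notin> V" "x = p y" by blast
      with x have "p y \<in> p ` B" by simp
      from B(2)[OF y(1) this] show False using V(2) y(2) by simp
    qed
    then show "x \<in> p ` K \<inter> - p ` (K - V)" using x V(2) by auto
  next
    fix x assume "x \<in> p ` K \<inter> - p ` (K - V)"
    then show "x \<in> p ` B" using V(2) by auto
  qed
  ultimately show ?thesis by (auto simp: openin_open)
qed

text \<open>The prefixes of the boundary word: the product, from right to left, of the sides passed
  clockwise between corner 0 and corner \<open>j\<close>.\<close>

primrec corner_word :: "('h, 'c) monoid_scheme \<Rightarrow> (edge \<Rightarrow> 'h) \<Rightarrow> nat \<Rightarrow> 'h" where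
  "corner_word G a 0 = \<one>\<^bsub>G\<^esub>"
| "corner_word G a (Suc j) =
    (if j mod 4 = 0 then inv\<^bsub>G\<^esub> (a (Alpha (j div 4))) else
     if j mod 4 = 1 then a (Beta (j div 4)) else
     if j mod 4 = 2 then a (Alpha (j div 4)) else inv\<^bsub>G\<^esub> (a (Beta (j div 4)))) \<otimes>\<^bsub>G\<^esub> corner_word G a j"

context group
begin

lemma edge_label_closed:
  assumes "\<forall>e\<in>edges g. a e \<in> carrier G" "i < g"
  shows "a (Alpha i) \<in> carrier G" "a (Beta i) \<in> carrier G"
  using assms by (auto simp: edges_def)

lemma corner_word_closed:
  assumes "\<forall>e\<in>edges g. a e \<in> carrier G" "j \<le> 4 * g"
  shows "corner_word G a j \<in> carrier G"
  using assms(2)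
proof (induction j)
  case (Suc j)
  then have "j div 4 < g" by auto
  then show ?case using Suc edge_label_closed[OF assms(1)] by auto
qed simp

lemma face_word_closed:
  assumes "\<forall>e\<in>edges g. a e \<in> carrier G" "k \<le> g"
  shows "face_word G k a \<in> carrier G"
  using assms(2)
proof (induction k)
  case (Suc k)
  then show ?case using edge_label_closed[OF assms(1)] by (auto simp: grp_commutator_def)
qed simp

text \<open>Each block of four sides contributes, from right to left, one commutator of an inverse
  \<open>Beta\<close> label with an \<open>Alpha\<close> label.\<close>

lemma corner_word_face_word:
  assumes "\<forall>e\<in>edges g. a e \<in> carrier G" "k \<le> g"
  shows "corner_word G a (4 * k) = face_word G k a"
  using assms(2)
proof (induction k)
  case (Suc k)
  have "Suc (4 * k) mod 4 = 1" "Suc (Suc (4 * k)) mod 4 = 2" "Suc (Suc (Suc (4 * k))) mod 4 = 3"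
    "Suc (4 * k) div 4 = k" "Suc (Suc (4 * k)) div 4 = k" "Suc (Suc (Suc (4 * k))) div 4 = k" by presburger+
  moreover have "4 * Suc k = Suc (Suc (Suc (Suc (4 * k))))" by simp
  ultimately show ?case
    using Suc edge_label_closed[OF assms(1), of k] face_word_closed[OF assms(1), of k]
    by (simp add: grp_commutator_def m_assoc del: mult_Suc_right)
qed simp

end

section \<open>Fibres of the quotient map and paths in the polygon\<close>

locale surface =
  fixes g :: nat and S :: "'p::t2_space set" and q :: "complex \<Rightarrow> 'p"
  assumes closed_surface: "closed_surface g S q"
begin

lemma g_pos: "g \<ge> 1" and q_cont: "continuous_on (cball 0 1) q" and q_image: "q ` cball 0 1 = S"
  and q_fibre: "x \<in> cball 0 1 \<Longrightarrow> y \<in> cball 0 1 \<Longrightarrow> q x = q y \<longleftrightarrow> (x, y) \<in> (side_pairing g \<union> (side_pairing g)\<inverse>)\<^sup>*"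
  using closed_surface by (auto simp: closed_surface_def)

lemma q_in: "z \<in> cball 0 1 \<Longrightarrow> q z \<in> S"
  using q_image by blast

lemma q_pairing:
  assumes "k < 4 * g" "k mod 4 < 2" "t \<in> {0..1}"
  shows "q (pol g 1 (real k + t)) = q (pol g 1 (real k + 3 - t))"
  using q_fibre[of "pol g 1 (real k + t)" "pol g 1 (real k + 3 - t)"] pairing_pol[OF assms] by auto

text \<open>Fibres are the classes of the equivalence relation generated by the side pairing, so it
  suffices to check generating pairs. Membership in \<open>B\<close> is carried along in the
  induction because \<open>F\<close> is compared only there.\<close>

lemma fibre_invariant:
  assumes "\<And>z z'. (z, z') \<in> side_pairing g \<Longrightarrow> (z \<in> B \<longleftrightarrow> z' \<in> B) \<and> (z \<in> B \<longrightarrow> F z = F z')"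
    and "z \<in> cball 0 1" "z' \<in> cball 0 1" "q z = q z'"
  shows "(z \<in> B \<longleftrightarrow> z' \<in> B) \<and> (z \<in> B \<longrightarrow> F z = F z')"
proof -
  have "(z, z') \<in> (side_pairing g \<union> (side_pairing g)\<inverse>)\<^sup>*"
    using q_fibre assms by blast
  then show ?thesis
  proof (induction rule: rtrancl_induct)
    case (step y w)
    then show ?case using assms(1)[of y w] assms(1)[of w y] by auto
  qed simp
qed

text \<open>The end points of paired sides identify corner \<open>4i\<close> with
  \<open>4i + 3\<close>, \<open>4i + 1\<close> with \<open>4i + 2\<close> and \<open>4i + 4\<close>,
  and \<open>4i + 2\<close> with \<open>4i + 3\<close>. Thus the five corners of a block coincide,
  and consecutive blocks share a corner.\<close>

lemma q_corner_int: "q (pol g 1 (of_int m)) = q 1"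
proof -
  have step: "q (pol g 1 (real (4 * i + j))) = q (pol g 1 (real (4 * i + 4)))" if "i < g" "j \<le> 4" for i j
  proof -
    have "q (pol g 1 (real (4 * i))) = q (pol g 1 (real (4 * i) + 3))"
      "q (pol g 1 (real (4 * i) + 1)) = q (pol g 1 (real (4 * i) + 2))"
      using q_pairing[of "4 * i" 0] q_pairing[of "4 * i" 1] that by (simp_all add: algebra_simps)
    moreover have "(4 * i + 1) mod 4 = 1" by presburger
    then have "q (pol g 1 (real (4 * i) + 1)) = q (pol g 1 (real (4 * i) + 4))"
      "q (pol g 1 (real (4 * i) + 2)) = q (pol g 1 (real (4 * i) + 3))"
      using q_pairing[of "4 * i + 1" 0] q_pairing[of "4 * i + 1" 1] that by (simp_all add: algebra_simps)
    moreover have "j = 0 \<or> j = 1 \<or> j = 2 \<or> j = 3 \<or> j = 4" using that by auto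
    ultimately show ?thesis by (auto simp: algebra_simps)
  qed
  have zero: "q (pol g 1 (real (4 * i))) = q 1" if "i \<le> g" for i
    using that
  proof (induction i)
    case 0
    then show ?case by (simp add: pol_0)
  next
    case (Suc i)
    then show ?case using step[of i 0] by (simp add: algebra_simps)
  qed
  define n where "n = nat (m mod (4 * int g))"
  have n: "n < 4 * g" using g_pos by (simp add: n_def nat_less_iff)
  have "q (pol g 1 (real n)) = q 1"
    using step[of "n div 4" "n mod 4"] zero[of "Suc (n div 4)"] n by (simp add: algebra_simps)
  moreover have "real_of_int m = real n + 4 * real g * of_int (m div (4 * int g))"
  proof -
    have "m = int n + 4 * int g * (m div (4 * int g))"
      using g_pos by (simp add: n_def)
    then have "real_of_int m = real_of_int (int n + 4 * int g * (m div (4 * int g)))" by simp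
    then show ?thesis by simp
  qed
  ultimately show ?thesis using pol_shift[OF g_pos] by metis
qed

lemma q_corner: "q (pol g 1 (real j)) = q 1"
  using q_corner_int[of "int j"] by simp

sublocale pointed_space S "q 1"
proof
  show "q 1 \<in> S" by (simp add: q_in)
  show "path_connected S"
    unfolding q_image[symmetric]
    by (intro path_connected_continuous_image q_cont convex_imp_path_connected) simp
qed

abbreviation m :: "(real \<Rightarrow> 'p) \<Rightarrow> (real \<Rightarrow> 'p) set" where "m \<equiv> loopify S (q 1)"

lemma paths_in_q:
  assumes "path \<gamma>" "path_image \<gamma> \<subseteq> cball 0 1"
  shows "q \<circ> \<gamma> \<in> paths_in S (q (pathstart \<gamma>)) (q (pathfinish \<gamma>))"
  using assms q_cont q_image by (intro paths_in_convex[of "cball 0 1"]) auto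

lemma linepath_in: "z \<in> cball 0 1 \<Longrightarrow> path_image (linepath 1 z) \<subseteq> cball (0::complex) 1"
  unfolding path_image_linepath by (rule closed_segment_subset) (simp_all add: convex_cball)

text \<open>By convexity this class represents any path in the polygon from corner 1 to
  \<open>z\<close>. It depends on \<open>z\<close> and not only on \<open>q z\<close>.\<close>

definition spoke :: "complex \<Rightarrow> (real \<Rightarrow> 'p) set" where
  "spoke z = m (q \<circ> linepath 1 z)"

lemma spoke_closed [simp]: "z \<in> cball 0 1 \<Longrightarrow> spoke z \<in> carrier \<pi>\<^sub>1"
  unfolding spoke_def by (rule loopify_closed[OF paths_in_q[OF path_linepath linepath_in]])

lemma spoke_move:
  assumes "path \<gamma>" "path_image \<gamma> \<subseteq> cball 0 1"
  shows "spoke (pathfinish \<gamma>) = m (q \<circ> \<gamma>) \<otimes>\<^bsub>\<pi>\<^sub>1\<^esub> spoke (pathstart \<gamma>)"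
proof -
  have in1: "pathstart \<gamma> \<in> cball 0 1" "pathfinish \<gamma> \<in> cball 0 1" using assms by auto
  note seg = linepath_in
  have "spoke (pathfinish \<gamma>) = m (q \<circ> (linepath 1 (pathstart \<gamma>) +++ \<gamma>))"
    unfolding spoke_def using assms in1 seg q_cont q_image
    by (intro loopify_convex[of "cball 0 1"]) (auto simp: path_image_join)
  also have "\<dots> = m (q \<circ> \<gamma>) \<otimes>\<^bsub>\<pi>\<^sub>1\<^esub> spoke (pathstart \<gamma>)"
    unfolding path_compose_join spoke_def
    by (rule loopify_join[OF _ paths_in_q[OF assms]])
      (use paths_in_q[OF path_linepath seg[OF in1(1)]] in simp)
  finally show ?thesis .
qed

lemma path_arc:
  assumes "continuous_on {0..1} f"
  shows "path (\<lambda>t. pol g 1 (f t))" "path_image (\<lambda>t. pol g 1 (f t)) \<subseteq> cball 0 1"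
  using assms g_pos unfolding path_def pol_def path_image_def
  by (auto intro!: continuous_intros simp: norm_mult)

lemma spoke_arc: "spoke (pol g 1 u') = m (\<lambda>t. q (pol g 1 (u + t * (u' - u)))) \<otimes>\<^bsub>\<pi>\<^sub>1\<^esub> spoke (pol g 1 u)"
proof -
  have "continuous_on {0..1} (\<lambda>t. u + t * (u' - u))" by (intro continuous_intros)
  from spoke_move[OF path_arc[OF this]] show ?thesis
    by (simp add: pathstart_def pathfinish_def o_def)
qed

lemma std_graph_in:
  assumes "e \<in> edges g"
  shows "std_graph g q e \<in> paths_in S (q 1) (q 1)"
proof -
  have "(\<lambda>t. q (side g k t)) \<in> paths_in S (q 1) (q 1)" for k
  proof -
    have "continuous_on {0..1} (\<lambda>t. real k + t)" by (intro continuous_intros)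
    from paths_in_q[OF path_arc[OF this]] show ?thesis
      using q_corner[of k] q_corner[of "Suc k"]
      by (simp add: o_def pathstart_def pathfinish_def side_pol add.commute)
  qed
  then show ?thesis using assms by (auto simp: edges_def)
qed

abbreviation edge_class :: "edge \<Rightarrow> (real \<Rightarrow> 'p) set" where
  "edge_class e \<equiv> loop_class S (std_graph g q e)"

lemma edge_class_closed: "\<forall>e\<in>edges g. edge_class e \<in> carrier \<pi>\<^sub>1"
  using std_graph_in by (auto simp: carrier_pi1)

text \<open>The straight segment to a corner is homotopic in the polygon to the boundary arc, whose
  sides project to edges or reversed edges.\<close>

lemma spoke_corner: "j \<le> 4 * g \<Longrightarrow> spoke (pol g 1 (real j)) = corner_word \<pi>\<^sub>1 edge_class j"
proof (induction j)
  case 0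
  have "spoke 1 = m (\<lambda>t. q 1)" by (simp add: spoke_def o_def)
  then show ?case using q_in[of 1] by (simp add: pol_0)
next
  case (Suc j)
  define i where "i = j div 4"
  have i: "i < g" using Suc by (auto simp: i_def)
  have e: "Alpha i \<in> edges g" "Beta i \<in> edges g" using i by (auto simp: edges_def)
  have rev: "m (reversepath (std_graph g q x)) = inv\<^bsub>\<pi>\<^sub>1\<^esub> (edge_class x)" if "x \<in> edges g" for x
    using loopify_reverse[OF std_graph_in[OF that]] loopify_loop[OF std_graph_in[OF that]] by simp
  have side: "m (\<lambda>t. q (pol g 1 (real j + t))) = m p" if "p \<in> paths_in S (q 1) (q 1)" "\<And>t. t \<in> {0..1} \<Longrightarrow> q (pol g 1 (real j + t)) = p t" for p
    using loopify_cong[OF that(1), of "\<lambda>t. q (pol g 1 (real j + t))"] that(2) by simp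
  have step: "m (\<lambda>t. q (pol g 1 (real j + t))) =
    (if j mod 4 = 0 then inv\<^bsub>\<pi>\<^sub>1\<^esub> (edge_class (Alpha (j div 4))) else
     if j mod 4 = 1 then edge_class (Beta (j div 4)) else
     if j mod 4 = 2 then edge_class (Alpha (j div 4)) else inv\<^bsub>\<pi>\<^sub>1\<^esub> (edge_class (Beta (j div 4))))"
  proof -
    consider "j = 4 * i" | "j = 4 * i + 1" | "j = 4 * i + 2" | "j = 4 * i + 3"
      unfolding i_def by linarith
    then show ?thesis
    proof cases
      case 1
      \<comment> \<open>Side \<open>4i\<close> is glued to side \<open>4i + 2\<close> run backwards,
        and the latter carries the edge \<open>Alpha i\<close>.\<close>
      have "m (\<lambda>t. q (pol g 1 (real j + t))) = m (reversepath (std_graph g q (Alpha i)))"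
      proof (rule side[OF paths_in_reverse[OF std_graph_in[OF e(1)]]])
        fix t :: real assume "t \<in> {0..1}"
        then show "q (pol g 1 (real j + t)) = reversepath (std_graph g q (Alpha i)) t"
          using q_pairing[of j t] 1 i by (simp add: reversepath_def side_pol algebra_simps)
      qed
      then show ?thesis using 1 rev[OF e(1)] by simp
    next
      case 2
      have "m (\<lambda>t. q (pol g 1 (real j + t))) = m (std_graph g q (Beta i))"
        by (rule side[OF std_graph_in[OF e(2)]]) (use 2 in \<open>simp add: side_pol\<close>)
      moreover have "(4 * i + 1) mod 4 = 1" "(4 * i + 1) div 4 = i" by presburger+
      ultimately show ?thesis using 2 loopify_loop[OF std_graph_in[OF e(2)]] by simp
    next
      case 3
      have "m (\<lambda>t. q (pol g 1 (real j + t))) = m (std_graph g q (Alpha i))"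
        by (rule side[OF std_graph_in[OF e(1)]]) (use 3 in \<open>simp add: side_pol\<close>)
      moreover have "(4 * i + 2) mod 4 = 2" "(4 * i + 2) div 4 = i" by presburger+
      ultimately show ?thesis using 3 loopify_loop[OF std_graph_in[OF e(1)]] by simp
    next
      case 4
      have m4: "(4 * i + 1) mod 4 = 1" "(4 * i + 3) mod 4 = 3" "(4 * i + 3) div 4 = i" by presburger+
      \<comment> \<open>Side \<open>4i + 3\<close> at \<open>t\<close> is glued to side
        \<open>4i + 1\<close> at \<open>1 - t\<close>, since
        \<open>(4i + 1) + 3 - (1 - t) = 4i + 3 + t\<close>.\<close>
      have "m (\<lambda>t. q (pol g 1 (real j + t))) = m (reversepath (std_graph g q (Beta i)))"
      proof (rule side[OF paths_in_reverse[OF std_graph_in[OF e(2)]]])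
        fix t :: real assume "t \<in> {0..1}"
        then show "q (pol g 1 (real j + t)) = reversepath (std_graph g q (Beta i)) t"
          using q_pairing[of "4 * i + 1" "1 - t"] 4 i m4 by (simp add: reversepath_def side_pol algebra_simps)
      qed
      then show ?thesis using 4 m4 rev[OF e(2)] by simp
    qed
  qed
  have "spoke (pol g 1 (real (Suc j))) = m (\<lambda>t. q (pol g 1 (real j + t))) \<otimes>\<^bsub>\<pi>\<^sub>1\<^esub> spoke (pol g 1 (real j))"
    using spoke_arc[of "real (Suc j)" "real j"] by simp
  then show ?case using step Suc by simp
qed

text \<open>Corner \<open>4g\<close> is corner 0, and the spoke to corner 0 is constant.\<close>

lemma face_word_edge_class: "face_word \<pi>\<^sub>1 g edge_class = \<one>\<^bsub>\<pi>\<^sub>1\<^esub>"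
proof -
  have "pol g 1 (real (4 * g)) = 1"
    using pol_shift[OF g_pos, of 1 0 1] by (simp add: pol_0)
  moreover have "spoke 1 = \<one>\<^bsub>\<pi>\<^sub>1\<^esub>" using q_in[of 1] by (simp add: spoke_def o_def)
  ultimately have "corner_word \<pi>\<^sub>1 edge_class (4 * g) = \<one>\<^bsub>\<pi>\<^sub>1\<^esub>"
    using spoke_corner[of "4 * g"] by simp
  then show ?thesis using pi1.corner_word_face_word[OF edge_class_closed] by simp
qed

end

section \<open>Generators of the fundamental group\<close>

lemma continuous_on_local:
  assumes "\<And>x. x \<in> X \<Longrightarrow> \<exists>V. open V \<and> x \<in> V \<and> continuous_on (X \<inter> V) f"
  shows "continuous_on X f"
  unfolding continuous_on_def
proof
  fix x assume x: "x \<in> X"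
  then obtain V where V: "open V" "x \<in> V" "continuous_on (X \<inter> V) f" using assms by blast
  have "at x within X = at x within (X \<inter> V)"
    using V(1,2) by (intro at_within_nhd[of x V]) auto
  then show "(f \<longlongrightarrow> f x) (at x within X)"
    using V(2,3) x by (simp add: continuous_on_def)
qed

lemma floor_near:
  fixes u :: real
  assumes "u - d \<notin> \<int>"
  shows "of_int \<lfloor>u - d\<rfloor> + d < u" "u < of_int \<lfloor>u - d\<rfloor> + 1 + d"
    and "of_int \<lfloor>u - d\<rfloor> + d < w \<Longrightarrow> w < of_int \<lfloor>u - d\<rfloor> + 1 + d \<Longrightarrow> w - d \<notin> \<int> \<and> \<lfloor>w - d\<rfloor> = \<lfloor>u - d\<rfloor>"
proof -
  have "of_int \<lfloor>u - d\<rfloor> \<noteq> u - d" using assms by (metis Ints_of_int)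
  then show "of_int \<lfloor>u - d\<rfloor> + d < u" "u < of_int \<lfloor>u - d\<rfloor> + 1 + d"
    using of_int_floor_le[of "u - d"] floor_correct[of "u - d"] by linarith+
  assume w: "of_int \<lfloor>u - d\<rfloor> + d < w" "w < of_int \<lfloor>u - d\<rfloor> + 1 + d"
  then have "\<lfloor>w - d\<rfloor> = \<lfloor>u - d\<rfloor>" by (intro floor_unique) auto
  moreover have "w - d \<notin> \<int>"
  proof
    assume "w - d \<in> \<int>"
    then have "of_int \<lfloor>w - d\<rfloor> = w - d" by (auto elim: Ints_cases)
    with w calculation show False by simp
  qed
  ultimately show "w - d \<notin> \<int> \<and> \<lfloor>w - d\<rfloor> = \<lfloor>u - d\<rfloor>" by blast
qed

text \<open>The midpoint of the interval between consecutive points of \<open>\<int> + d\<close>. For \<open>d = 0\<close> the midpoints are those of the sides, for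
  \<open>d = 1/2\<close> they are the corners.\<close>

definition center :: "real \<Rightarrow> real \<Rightarrow> real" where
  "center d u = of_int \<lfloor>u - d\<rfloor> + d + 1/2"

lemma floor_add_nat_shift: "\<lfloor>u + real n - d\<rfloor> = \<lfloor>u - d\<rfloor> + int n"
  using floor_add_int[of "u - d" "int n"] by (simp add: algebra_simps)

lemma center_shift: "center d (u + 4 * real g) = center d u + 4 * real g"
  using floor_add_nat_shift[of u "4 * g" d] by (simp add: center_def)

lemma Ints_shift: "u + real n - d \<in> \<int> \<longleftrightarrow> u - d \<in> \<int>"
proof -
  have "u + real n - d = (u - d) + real n" by simp
  then show ?thesis by (metis Ints_add Ints_diff Ints_of_nat add_diff_cancel_right')
qed

text \<open>As \<open>2d\<close> is an integer, the gluing reflection permutes the intervals between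
  consecutive points of \<int> + d, and so it commutes with passing to midpoints. The value of
  \<open>c\<close> is 1/2 for \<open>d = 0\<close> and the nearer of 0 and 1 for
  \<open>d = 1/2\<close>.\<close>

lemma center_sides:
  fixes k :: nat
  assumes "d = 0 \<or> d = 1/2" "t \<in> {0..1}" "real k + t - d \<notin> \<int>"
  obtains c where "c \<in> {0..1}" "center d (real k + t) = real k + c" "center d (real k + 3 - t) = real k + 3 - c"
    "real k + 3 - t - d \<notin> \<int>"
proof -
  have n: "t - d \<notin> \<int>" using Ints_shift[of t k d] assms(3) by (simp add: add.commute)
  have c: "center d (real k + x) = real k + center d x" for x
    using floor_add_nat_shift[of x k d] by (simp add: center_def add.commute)
  have "t \<noteq> 0 \<and> t \<noteq> 1" if "d = 0" using n that by auto
  moreover have "t \<noteq> 1/2" if "d = 1/2" using n that by (metis Ints_0 diff_self)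
  ultimately consider "d = 0" "0 < t" "t < 1" | "d = 1/2" "0 \<le> t" "t < 1/2" | "d = 1/2" "1/2 < t" "t \<le> 1"
    using assms(1,2) by force
  then have "\<exists>c\<in>{0..1}. center d t = c \<and> center d (3 - t) = 3 - c"
  proof cases
    case 1
    then have "\<lfloor>t\<rfloor> = 0" "\<lfloor>3 - t\<rfloor> = 2" by linarith+
    with 1 show ?thesis by (intro bexI[of _ "1/2"]) (simp_all add: center_def)
  next
    case 2
    then have "\<lfloor>t - 1/2\<rfloor> = -1" "\<lfloor>3 - t - 1/2\<rfloor> = 2" by linarith+
    then show ?thesis unfolding 2(1) center_def by (intro bexI[of _ "0"]) (simp_all add: center_def)
  next
    case 3
    then have "\<lfloor>t - 1/2\<rfloor> = 0" "\<lfloor>3 - t - 1/2\<rfloor> = 1" by linarith+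
    then show ?thesis unfolding 3(1) center_def by (intro bexI[of _ "1"]) (simp_all add: center_def)
  qed
  moreover have "real k + 3 - t - d \<notin> \<int>"
  proof
    assume "real k + 3 - t - d \<in> \<int>"
    moreover have "2 * d = 0 \<or> 2 * d = 1" using assms(1) by auto
    then have "2 * d \<in> \<int>" by (metis Ints_0 Ints_1)
    then have "real k + 3 - 2 * d \<in> \<int>" by auto
    ultimately have "real k + 3 - 2 * d - (real k + 3 - t - d) \<in> \<int>" using Ints_diff by blast
    then show False using n by simp
  qed
  ultimately show thesis
    using that c[of t] c[of "3 - t"] by (auto simp: add_diff_eq)
qed

section \<open>Sectors of the polygon and their contractions\<close>

context surface
begin

text \<open>Removing the rays with angle in \<int> + d makes the centre of the sector containing a
  point locally constant, so that contracting towards it is continuous. At the origin the angle has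
  no meaning.\<close>

definition sector :: "real \<Rightarrow> complex set" where
  "sector d = {z \<in> cball 0 1. z \<noteq> 0 \<and> angle_coord g z - d \<notin> \<int>}"

lemma sector_pol:
  assumes "r \<in> {0<..1}"
  shows "pol g r u \<in> sector d \<longleftrightarrow> u - d \<notin> \<int>"
proof -
  have "(angle_coord g (pol g r u) - d \<in> \<int>) = (u - d \<in> \<int>)"
    using periodic_angle_coord[OF g_pos, of "\<lambda>u. u - d \<in> \<int>" r u] Ints_shift[of _ "4 * g" d] assms by simp
  moreover have "pol g r u \<noteq> 0" using norm_pol[of g r u] assms by fastforce
  ultimately show ?thesis using assms by (simp add: sector_def)
qed

lemma sector_polE:
  assumes "z \<in> sector d"
  obtains r u where "r \<in> {0<..1}" "z = pol g r u" "u - d \<notin> \<int>" "r = norm z" "u = angle_coord g z"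
proof (rule that[of "norm z" "angle_coord g z"])
  show "z = pol g (norm z) (angle_coord g z)" by (simp add: pol_angle_coord[OF g_pos])
  show "norm z \<in> {0<..1}" using assms unfolding sector_def by simp
  show "angle_coord g z - d \<notin> \<int>" using assms unfolding sector_def by blast
qed (rule refl)+

text \<open>A continuous branch of the angle, on a neighbourhood so small that the branch stays
  between two neighbouring removed rays.\<close>

lemma sector_local:
  assumes "z0 \<in> sector d"
  obtains V U where "open V" "z0 \<in> V" "continuous_on V U"
    "\<forall>z\<in>V. z = pol g (norm z) (U z) \<and> z \<noteq> 0 \<and> U z - d \<notin> \<int> \<and> \<lfloor>U z - d\<rfloor> = \<lfloor>angle_coord g z0 - d\<rfloor>"
proof -
  have z0: "z0 \<noteq> 0" "angle_coord g z0 - d \<notin> \<int>" using assms by (auto simp: sector_def)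
  obtain U where U: "continuous_on (ball z0 (norm z0)) U" "U z0 = angle_coord g z0"
    "\<forall>z\<in>ball z0 (norm z0). z \<noteq> 0 \<and> z = pol g (norm z) (U z)"
    by (rule local_polar_coordinate[OF g_pos z0(1)])
  let ?n = "of_int \<lfloor>angle_coord g z0 - d\<rfloor> :: real"
  define V where "V = ball z0 (norm z0) \<inter> U -` {?n + d<..<?n + 1 + d}"
  show thesis
  proof (rule that[of V U])
    show "open V" unfolding V_def
      using U(1) by (intro continuous_open_preimage) auto
    show "z0 \<in> V" using z0 U(2) floor_near(1,2)[OF z0(2)] by (simp add: V_def)
    show "continuous_on V U" using U(1) by (rule continuous_on_subset) (auto simp: V_def)
    show "\<forall>z\<in>V. z = pol g (norm z) (U z) \<and> z \<noteq> 0 \<and> U z - d \<notin> \<int> \<and> \<lfloor>U z - d\<rfloor> = \<lfloor>angle_coord g z0 - d\<rfloor>"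
    proof
      fix z assume "z \<in> V"
      then have "z \<in> ball z0 (norm z0)" "?n + d < U z" "U z < ?n + 1 + d" unfolding V_def by auto
      then show "z = pol g (norm z) (U z) \<and> z \<noteq> 0 \<and> U z - d \<notin> \<int> \<and> \<lfloor>U z - d\<rfloor> = \<lfloor>angle_coord g z0 - d\<rfloor>"
        using U(3) floor_near(3)[OF z0(2), of "U z"] by blast
    qed
  qed
qed

lemma sector_open: "openin (top_of_set (cball 0 1)) (sector d)"
proof (subst openin_subopen, intro ballI)
  fix z0 assume z0: "z0 \<in> sector d"
  obtain V U where V: "open V" "z0 \<in> V" "continuous_on V U"
    "\<forall>z\<in>V. z = pol g (norm z) (U z) \<and> z \<noteq> 0 \<and> U z - d \<notin> \<int> \<and> \<lfloor>U z - d\<rfloor> = \<lfloor>angle_coord g z0 - d\<rfloor>"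
    by (rule sector_local[OF z0])
  have "cball 0 1 \<inter> V \<subseteq> sector d"
  proof
    fix z assume z: "z \<in> cball 0 1 \<inter> V"
    then have "pol g (norm z) (U z) \<in> sector d"
      using V(4) by (subst sector_pol) auto
    then show "z \<in> sector d" using V(4) z by auto
  qed
  then show "\<exists>T. openin (top_of_set (cball 0 1)) T \<and> z0 \<in> T \<and> T \<subseteq> sector d"
    using V(1,2) z0 by (intro exI[of _ "cball 0 1 \<inter> V"]) (auto simp: openin_open sector_def)
qed

lemma sector_pairing:
  assumes "d = 0 \<or> d = 1/2" "(z, z') \<in> side_pairing g"
  shows "z \<in> sector d \<longleftrightarrow> z' \<in> sector d"
proof -
  obtain k t where kt: "k < 4 * g" "k mod 4 < 2" "t \<in> {0..1}" "z = pol g 1 (real k + t)" "z' = pol g 1 (real k + 3 - t)"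
    by (rule pairing_cases[OF assms(2)])
  have "2 * d = 0 \<or> 2 * d = 1" using assms(1) by auto
  then have d: "2 * d \<in> \<int>" by (metis Ints_0 Ints_1)
  have "real k + 3 - t - d \<in> \<int> \<longleftrightarrow> real k + t - d \<in> \<int>"
  proof -
    have "(real k + 3 - t - d) + (real k + t - d) = 2 * real k + 3 - 2 * d" by simp
    moreover have "2 * real k + 3 - 2 * d \<in> \<int>" using d by auto
    ultimately show ?thesis by (metis Ints_diff add_diff_cancel_left' add_diff_cancel_right')
  qed
  then show ?thesis using kt sector_pol[of 1] by simp
qed

text \<open>The angle moves linearly to the centre, which commutes with the gluing reflections. The
  radius moves outwards to 1, so that only finitely many points remain at the end.\<close>

definition contract :: "real \<Rightarrow> real \<times> complex \<Rightarrow> complex" where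
  "contract d = (\<lambda>(s, z). pol g ((1 - s) * norm z + s) ((1 - s) * angle_coord g z + s * center d (angle_coord g z)))"

lemma contract_pol:
  assumes "r \<in> {0<..1}"
  shows "contract d (s, pol g r u) = pol g ((1 - s) * r + s) ((1 - s) * u + s * center d u)"
proof -
  let ?F = "\<lambda>u. pol g ((1 - s) * r + s) ((1 - s) * u + s * center d u)"
  have "?F (u + 4 * real g) = ?F u" for u
  proof -
    have "(1 - s) * (u + 4 * real g) + s * center d (u + 4 * real g) = ((1 - s) * u + s * center d u) + 4 * real g * of_int 1"
      unfolding center_shift by (simp add: algebra_simps)
    then show ?thesis using pol_shift[OF g_pos] by metis
  qed
  from periodic_angle_coord[OF g_pos, of ?F, OF this] show ?thesis
    using assms by (simp add: contract_def)
qed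

lemma contract_in:
  assumes "s \<in> {0..1}" "z \<in> cball 0 1"
  shows "contract d (s, z) \<in> cball 0 1"
proof -
  have "(1 - s) * norm z + s \<le> (1 - s) * 1 + s"
    using assms by (intro add_right_mono mult_left_mono) auto
  moreover have "0 \<le> (1 - s) * norm z + s" using assms by auto
  ultimately show ?thesis by (simp add: contract_def)
qed

lemma contract_0: "contract d (0, z) = z"
  by (simp add: contract_def pol_angle_coord[OF g_pos])

text \<open>Locally \<open>angle_coord\<close> can be replaced by a continuous branch, for which the
  centre is a fixed number; by periodicity this leaves the contraction unchanged.\<close>

lemma contract_continuous: "continuous_on ({0..1} \<times> sector d) (contract d)"
proof (rule continuous_on_local)
  fix x assume "x \<in> {0..1::real} \<times> sector d"
  then obtain s0 z0 where x: "x = (s0, z0)" "z0 \<in> sector d" by auto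
  obtain V U where V: "open V" "z0 \<in> V" "continuous_on V U"
    "\<forall>z\<in>V. z = pol g (norm z) (U z) \<and> z \<noteq> 0 \<and> U z - d \<notin> \<int> \<and> \<lfloor>U z - d\<rfloor> = \<lfloor>angle_coord g z0 - d\<rfloor>"
    by (rule sector_local[OF x(2)])
  let ?X = "({0..1::real} \<times> sector d) \<inter> (UNIV \<times> V)"
  let ?c = "center d (angle_coord g z0)"
  have "continuous_on ?X (\<lambda>y. U (snd y))"
    by (rule continuous_on_compose2[OF V(3)]) (auto intro!: continuous_intros)
  then have cont: "continuous_on ?X (\<lambda>y. pol g ((1 - fst y) * norm (snd y) + fst y) ((1 - fst y) * U (snd y) + fst y * ?c))"
    unfolding pol_def using g_pos by (auto intro!: continuous_intros)
  have eq: "contract d y = pol g ((1 - fst y) * norm (snd y) + fst y) ((1 - fst y) * U (snd y) + fst y * ?c)"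
    if y: "y \<in> ?X" for y
  proof -
    have z: "snd y = pol g (norm (snd y)) (U (snd y))" "snd y \<noteq> 0" "\<lfloor>U (snd y) - d\<rfloor> = \<lfloor>angle_coord g z0 - d\<rfloor>"
      using V(4) y by auto
    then have c: "center d (U (snd y)) = ?c" by (simp add: center_def)
    have "norm (snd y) \<in> {0<..1}" using y z(2) by (auto simp: sector_def)
    from contract_pol[OF this, of d "fst y" "U (snd y)"] show ?thesis
      unfolding z(1)[symmetric] c by simp
  qed
  have "continuous_on ?X (contract d)"
    by (rule continuous_on_eq[OF cont eq[symmetric]])
  then show "\<exists>W. open W \<and> x \<in> W \<and> continuous_on (({0..1::real} \<times> sector d) \<inter> W) (contract d)"
    using V(1,2) x by (intro exI[of _ "UNIV \<times> V"]) (auto intro: open_Times)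
qed

text \<open>Glued boundary points stay on their sides and have mirror-image centres, so at each time
  they are again mirror images.\<close>

lemma contract_pairing:
  assumes d: "d = 0 \<or> d = 1/2" and "(z, z') \<in> side_pairing g" "z \<in> sector d" "s \<in> {0..1}"
  shows "q (contract d (s, z)) = q (contract d (s, z'))"
proof -
  obtain k t where kt: "k < 4 * g" "k mod 4 < 2" "t \<in> {0..1}" "z = pol g 1 (real k + t)" "z' = pol g 1 (real k + 3 - t)"
    by (rule pairing_cases[OF assms(2)])
  have "real k + t - d \<notin> \<int>" using assms(3) kt(4) sector_pol[of 1] by simp
  then obtain c where c: "c \<in> {0..1}" "center d (real k + t) = real k + c" "center d (real k + 3 - t) = real k + 3 - c"
    by (rule center_sides[OF d kt(3)])
  define t' where "t' = (1 - s) * t + s * c"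
  have "(1 - s) * t + s * c \<le> (1 - s) * 1 + s * 1"
    using assms(4) kt(3) c(1) by (intro add_mono mult_left_mono) auto
  then have "t' \<in> {0..1}" using assms(4) kt(3) c(1) by (auto simp: t'_def)
  moreover have "contract d (s, z) = pol g 1 (real k + t')"
  proof -
    have "(1 - s) * (real k + t) + s * (real k + c) = real k + t'" by (simp add: t'_def algebra_simps)
    then show ?thesis using contract_pol[of 1 d s "real k + t"] by (simp add: kt(4) c(2))
  qed
  moreover have "contract d (s, z') = pol g 1 (real k + 3 - t')"
  proof -
    have "(1 - s) * (real k + 3 - t) + s * (real k + 3 - c) = real k + 3 - t'" by (simp add: t'_def algebra_simps)
    then show ?thesis using contract_pol[of 1 d s "real k + 3 - t"] by (simp add: kt(5) c(3))
  qed
  ultimately show ?thesis using q_pairing[OF kt(1,2)] by simp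
qed

lemma contract_1_finite:
  "z \<in> sector d \<Longrightarrow> q (contract d (1, z)) \<in> (\<lambda>j. q (pol g 1 (real j + d + 1/2))) ` {..<4 * g}"
proof (elim sector_polE)
  fix r u assume ru: "r \<in> {0<..1}" "z = pol g r u"
  define n where "n = \<lfloor>u - d\<rfloor>"
  define j where "j = nat (n mod (4 * int g))"
  have j: "j < 4 * g" using g_pos by (simp add: j_def nat_less_iff)
  have "n = int j + 4 * int g * (n div (4 * int g))" using g_pos by (simp add: j_def)
  then have "real_of_int n = real_of_int (int j + 4 * int g * (n div (4 * int g)))" by simp
  then have "center d u = (real j + d + 1/2) + 4 * real g * of_int (n div (4 * int g))"
    by (simp add: center_def n_def[symmetric])
  then have "pol g 1 (center d u) = pol g 1 (real j + d + 1/2)"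
    using pol_shift[OF g_pos] by metis
  then show ?thesis using j contract_pol[OF ru(1), of d 1 u] ru(2) by auto
qed

text \<open>The contraction \<open>h\<close> need only be compatible with the side pairing after projection to the surface.\<close>

definition contractible_region :: "complex set \<Rightarrow> (real \<times> complex \<Rightarrow> complex) \<Rightarrow> 'p set \<Rightarrow> bool" where
  "contractible_region B h Y \<longleftrightarrow> openin (top_of_set (cball 0 1)) B \<and> finite Y \<and>
     continuous_on ({0..1} \<times> B) h \<and> h ` ({0..1} \<times> B) \<subseteq> cball 0 1 \<and> (\<forall>z\<in>B. h (0, z) = z \<and> q (h (1, z)) \<in> Y) \<and>
     (\<forall>z z'. (z, z') \<in> side_pairing g \<longrightarrow>
        (z \<in> B \<longleftrightarrow> z' \<in> B) \<and> (z \<in> B \<longrightarrow> (\<forall>s\<in>{0..1}. q (h (s, z)) = q (h (s, z')))))"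

lemma contractible_region_sector:
  assumes "d = 0 \<or> d = 1/2"
  shows "contractible_region (sector d) (contract d) ((\<lambda>j. q (pol g 1 (real j + d + 1/2))) ` {..<4 * g})"
  unfolding contractible_region_def
  using sector_open contract_continuous contract_1_finite sector_pairing[OF assms] contract_pairing[OF assms]
    contract_in[of _ _ d] contract_0
  by (auto simp: sector_def)

lemma contractible_region_ball: "contractible_region (ball 0 1) (\<lambda>(s, z). (1 - s) *\<^sub>R z) {q 0}"
proof -
  have "norm z = 1 \<and> norm z' = 1" if "(z, z') \<in> side_pairing g" for z z' :: complex
    using pairing_cases[OF that] by (metis abs_one norm_pol)
  moreover have "continuous_on ({0..1} \<times> ball 0 1) (\<lambda>(s::real, z::complex). (1 - s) *\<^sub>R z)"
    by (auto simp: case_prod_unfold intro!: continuous_intros)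
  moreover have "openin (top_of_set (cball 0 1)) (ball (0::complex) 1)"
    by (metis ball_subset_cball open_ball open_subset)
  moreover have "norm ((1 - s) *\<^sub>R z) \<le> 1" if "s \<in> {0..1}" "norm z < 1" for s :: real and z :: complex
  proof -
    have "\<bar>1 - s\<bar> * norm z \<le> 1 * 1" using that by (intro mult_mono) auto
    then show ?thesis by simp
  qed
  ultimately show ?thesis
    unfolding contractible_region_def by (auto simp del: norm_scaleR)
qed

section \<open>Subdivision of loops and generation by the edge classes\<close>

lemma region_saturated:
  assumes "\<forall>z z'. (z, z') \<in> side_pairing g \<longrightarrow> (z \<in> B \<longleftrightarrow> z' \<in> B)" "B \<subseteq> cball 0 1"
    and "z \<in> cball 0 1" "q z \<in> q ` B"
  shows "z \<in> B"
proof -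
  obtain z' where z': "z' \<in> B" "q z = q z'" using assms(4) by auto
  \<comment> \<open>With a function to the unit type only the statement about membership is left of
    \<open>fibre_invariant\<close>.\<close>
  have "(z \<in> B \<longleftrightarrow> z' \<in> B) \<and> (z \<in> B \<longrightarrow> () = ())"
    by (rule fibre_invariant[of B "\<lambda>_. ()"]) (use assms z' in auto)
  then show ?thesis using z' by simp
qed

lemma region_open:
  assumes "\<forall>z z'. (z, z') \<in> side_pairing g \<longrightarrow> (z \<in> B \<longleftrightarrow> z' \<in> B)" "openin (top_of_set (cball 0 1)) B"
  shows "openin (top_of_set S) (q ` B)"
proof -
  have B: "B \<subseteq> cball 0 1" using assms(2) openin_imp_subset by auto
  show ?thesis
    using quotient_open[OF compact_cball q_cont assms(2) region_saturated[OF assms(1) B]] q_image by simp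
qed

lemma regions_cover:
  assumes "x \<in> S"
  shows "x \<in> q ` ball 0 1 \<or> x \<in> q ` sector 0 \<or> x \<in> q ` sector (1/2)"
proof -
  obtain z where z: "z \<in> cball 0 1" "x = q z" using assms q_image by auto
  show ?thesis
  proof (cases "norm z < 1")
    case False
    then have "norm z = 1" using z by simp
    have "z \<in> sector 0 \<or> z \<in> sector (1/2)"
    proof (rule ccontr)
      assume "\<not> ?thesis"
      then have "angle_coord g z \<in> \<int>" "angle_coord g z - 1/2 \<in> \<int>"
        using \<open>norm z = 1\<close> z by (auto simp: sector_def)
      then have "angle_coord g z - (angle_coord g z - 1/2) \<in> \<int>" by (rule Ints_diff)
      then have "(1/2 :: real) \<in> \<int>" by simp
      then show False by simp
    qed
    then show ?thesis using z by auto
  qed (use z in auto)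
qed

text \<open>The contraction drags \<open>c\<close> to a path inside a finite set, which must be
  constant. What remains of \<open>c\<close> is the difference between the spokes to two preimages
  of one point, an element controlled by the side pairing alone.\<close>

lemma contract_path:
  assumes R: "contractible_region B h Y"
    and c: "c \<in> paths_in S (q z) (q w)" "path_image c \<subseteq> q ` B" and zw: "z \<in> B" "w \<in> B"
  obtains z1 w1 where "z1 \<in> cball 0 1" "w1 \<in> cball 0 1" "q z1 = q w1"
    "inv\<^bsub>\<pi>\<^sub>1\<^esub> (spoke w) \<otimes>\<^bsub>\<pi>\<^sub>1\<^esub> m c \<otimes>\<^bsub>\<pi>\<^sub>1\<^esub> spoke z = inv\<^bsub>\<pi>\<^sub>1\<^esub> (spoke w1) \<otimes>\<^bsub>\<pi>\<^sub>1\<^esub> spoke z1"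
proof -
  have B: "openin (top_of_set (cball 0 1)) B" "B \<subseteq> cball 0 1"
    and h: "continuous_on ({0..1} \<times> B) h" "h ` ({0..1} \<times> B) \<subseteq> cball 0 1"
    and h01: "\<And>z. z \<in> B \<Longrightarrow> h (0, z) = z" "\<And>z. z \<in> B \<Longrightarrow> q (h (1, z)) \<in> Y" and Y: "finite Y"
    and sat: "\<forall>z z'. (z, z') \<in> side_pairing g \<longrightarrow> (z \<in> B \<longleftrightarrow> z' \<in> B)"
    and inv: "\<And>z z' s. (z, z') \<in> side_pairing g \<Longrightarrow> z \<in> B \<Longrightarrow> s \<in> {0..1} \<Longrightarrow> q (h (s, z)) = q (h (s, z'))"
    using R openin_imp_subset unfolding contractible_region_def by blast+
  \<comment> \<open>The contraction transported to the surface. The chosen preimage does not matter,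
    because the region is saturated and the projected contraction agrees on paired points.\<close>
  define H where "H = (\<lambda>(s, x). q (h (s, SOME z. z \<in> B \<and> q z = x)))"
  have H: "H (s, q z) = q (h (s, z))" if "z \<in> B" "s \<in> {0..1}" for s z
  proof -
    define z' where "z' = (SOME z'. z' \<in> B \<and> q z' = q z)"
    have z': "z' \<in> B \<and> q z' = q z" unfolding z'_def by (rule someI[of _ z]) (use that in simp)
    have "(z' \<in> B \<longleftrightarrow> z \<in> B) \<and> (z' \<in> B \<longrightarrow> q (h (s, z')) = q (h (s, z)))"
      by (rule fibre_invariant[of B "\<lambda>z. q (h (s, z))"]) (use sat inv that z' B in auto)
    then show ?thesis using z' by (simp add: H_def z'_def)
  qed
  let ?p = "\<lambda>y :: real \<times> complex. (fst y, q (snd y))"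
  have "continuous_on (?p ` ({0..1} \<times> B)) H"
  \<comment> \<open>The quotient argument is applied with the time parameter included, to the
    compact product of the interval and the polygon.\<close>
  proof (rule continuous_on_quotient[of "{0..1::real} \<times> cball (0::complex) 1"])
    show "continuous_on ({0..1} \<times> cball 0 1) ?p"
    proof -
      have "continuous_on ({0..1::real} \<times> cball 0 1) (\<lambda>y. q (snd y))"
        by (rule continuous_on_compose2[OF q_cont]) (auto intro!: continuous_intros)
      then show ?thesis by (auto intro!: continuous_intros)
    qed
    show "y \<in> {0..1} \<times> B" if "y \<in> {0..1} \<times> cball 0 1" "?p y \<in> ?p ` ({0..1} \<times> B)" for y
      using that region_saturated[OF sat B(2), of "snd y"] by (cases y) auto
    have "continuous_on ({0..1} \<times> B) (\<lambda>y. q (h y))"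
      by (rule continuous_on_compose2[OF q_cont h(1,2)])
    then show "continuous_on ({0..1} \<times> B) (\<lambda>y. H (?p y))"
      by (rule continuous_on_eq) (use H in auto)
  qed (use B in \<open>auto intro: compact_Times\<close>)
  moreover have "?p ` ({0..1} \<times> B) = {0..1} \<times> q ` B" by force
  ultimately have Hc: "continuous_on ({0..1} \<times> q ` B) H" by simp
  have HS: "H y \<in> S" if "y \<in> {0..1} \<times> q ` B" for y
    using that H h(2) q_in by fastforce
  have ct: "c t \<in> q ` B" if "t \<in> {0..1}" for t using c(2) that by (auto simp: path_image_def)
  have cc: "continuous_on {0..1} c" using c(1) by (simp add: paths_in_def path_def)
  have c01: "c 0 = q z" "c 1 = q w" using c(1) by (auto simp: paths_in_def pathstart_def pathfinish_def)
  define K where "K = (\<lambda>y :: real \<times> real. H (fst y, c (snd y)))"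
  have Kc: "continuous_on ({0..1} \<times> {0..1}) K"
    unfolding K_def
  proof (rule continuous_on_compose2[OF Hc])
    have "continuous_on ({0..1::real} \<times> {0..1}) (\<lambda>y. c (snd y))"
      by (rule continuous_on_compose2[OF cc]) (auto intro!: continuous_intros)
    then show "continuous_on ({0..1} \<times> {0..1}) (\<lambda>y::real \<times> real. (fst y, c (snd y)))"
      by (auto intro!: continuous_intros)
  qed (use ct in auto)
  have KS: "K ` ({0..1} \<times> {0..1}) \<subseteq> S" using HS ct by (auto simp: K_def)
  have ends: "\<exists>\<gamma>. path \<gamma> \<and> path_image \<gamma> \<subseteq> cball 0 1 \<and> pathstart \<gamma> = z \<and> pathfinish \<gamma> = h (1, z) \<and> (\<forall>s\<in>{0..1}. H (s, q z) = (q \<circ> \<gamma>) s)"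
    if "z \<in> B" for z
  proof (intro exI conjI)
    show "path (\<lambda>s. h (s, z))" unfolding path_def
      by (rule continuous_on_compose2[OF h(1)]) (use that in \<open>auto intro!: continuous_intros\<close>)
    show "path_image (\<lambda>s. h (s, z)) \<subseteq> cball 0 1" using h(2) that by (auto simp: path_image_def image_subset_iff)
  qed (use h01 that H in \<open>auto simp: pathstart_def pathfinish_def\<close>)
  have side: "spoke (h (1, z)) = m (\<lambda>s. H (s, q z)) \<otimes>\<^bsub>\<pi>\<^sub>1\<^esub> spoke z \<and> m (\<lambda>s. H (s, q z)) \<in> carrier \<pi>\<^sub>1" if z: "z \<in> B" for z
  proof -
    obtain \<gamma> where \<gamma>: "path \<gamma>" "path_image \<gamma> \<subseteq> cball 0 1" "pathstart \<gamma> = z" "pathfinish \<gamma> = h (1, z)" "\<forall>s\<in>{0..1}. H (s, q z) = (q \<circ> \<gamma>) s"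
      using ends[OF z] by blast
    have "m (q \<circ> \<gamma>) = m (\<lambda>s. H (s, q z))"
      by (rule loopify_cong[OF paths_in_q[OF \<gamma>(1,2)]]) (use \<gamma>(5) in simp)
    then show ?thesis
      using spoke_move[OF \<gamma>(1,2)] \<gamma>(3,4) loopify_closed[OF paths_in_q[OF \<gamma>(1,2)]] by simp
  qed
  \<comment> \<open>At time 1 the values lie in the finite set \<open>Y\<close>; a nonempty finite
    connected set in a Hausdorff space is a single point.\<close>
  obtain y where y: "\<forall>t\<in>{0..1}. K (1, t) = y"
  proof -
    have "continuous_on {0..1} (\<lambda>t. K (1, t))"
      by (rule continuous_on_compose2[OF Kc]) (auto intro!: continuous_intros)
    then have "connected ((\<lambda>t. K (1, t)) ` {0..1})" by (intro connected_continuous_image) auto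
    moreover have sub: "(\<lambda>t. K (1, t)) ` {0..1} \<subseteq> Y"
      using ct H h01(2) by (fastforce simp: K_def)
    then have "finite ((\<lambda>t. K (1, t)) ` {0..1})" using Y finite_subset by blast
    ultimately have "\<exists>y. \<forall>t\<in>{0..1}. K (1, t) = y"
    proof -
      assume con: "connected ((\<lambda>t. K (1, t)) ` {0..1})" and fin: "finite ((\<lambda>t. K (1, t)) ` {0..1})"
      let ?I = "(\<lambda>t. K (1, t)) ` {0..1}" and ?y = "K (1, 0)"
      have "?I \<subseteq> {?y}"
      proof (rule ccontr)
        assume "\<not> ?I \<subseteq> {?y}"
        moreover have "closed (?I - {?y})" using fin by (intro finite_imp_closed) auto
        ultimately have *: "closed {?y} \<and> closed (?I - {?y}) \<and> ?I \<subseteq> {?y} \<union> (?I - {?y}) \<and>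
          {?y} \<inter> (?I - {?y}) \<inter> ?I = {} \<and> {?y} \<inter> ?I \<noteq> {} \<and> (?I - {?y}) \<inter> ?I \<noteq> {}" by auto
        show False
          by (rule notE[OF con[unfolded connected_closed]], intro exI) (fact *)
      qed
      then show ?thesis by blast
    qed
    then show thesis using that by blast
  qed
  have "y \<in> S" using y KS by force
  have "m (\<lambda>t. K (1, t)) = \<one>\<^bsub>\<pi>\<^sub>1\<^esub>"
    using loopify_cong[OF paths_in_const[OF \<open>y \<in> S\<close>], of "\<lambda>t. K (1, t)"] y loopify_const[OF \<open>y \<in> S\<close>] by simp
  moreover have "m (\<lambda>t. K (0, t)) = m c"
  proof (rule loopify_cong[OF c(1), symmetric])
    fix t :: real assume t: "t \<in> {0..1}"
    then obtain z' where "z' \<in> B" "c t = q z'" using ct by blast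
    then show "c t = K (0, t)" using H h01(1) by (simp add: K_def)
  qed
  moreover have "m (\<lambda>t. K (t, 0)) = m (\<lambda>s. H (s, q z))" "m (\<lambda>t. K (t, 1)) = m (\<lambda>s. H (s, q w))"
    using c01 by (simp_all add: K_def)
  ultimately have sq: "m (\<lambda>s. H (s, q z)) = m (\<lambda>s. H (s, q w)) \<otimes>\<^bsub>\<pi>\<^sub>1\<^esub> m c"
    using loopify_square[OF Kc KS] side[OF zw(1)] by simp
  show thesis
  proof (rule that[of "h (1, z)" "h (1, w)"])
    show "h (1, z) \<in> cball 0 1" "h (1, w) \<in> cball 0 1"
      by (rule subsetD[OF h(2)], rule imageI, use zw in simp)+
    have "q (h (1, z)) = K (1, 0)" "q (h (1, w)) = K (1, 1)"
      using c01 H zw by (auto simp: K_def)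
    then show "q (h (1, z)) = q (h (1, w))" using y by simp
    have mw: "m (\<lambda>s. H (s, q w)) \<in> carrier \<pi>\<^sub>1" "m c \<in> carrier \<pi>\<^sub>1" "spoke z \<in> carrier \<pi>\<^sub>1" "spoke w \<in> carrier \<pi>\<^sub>1"
      using side[OF zw(2)] c(1) zw B(2) by auto
    have "inv\<^bsub>\<pi>\<^sub>1\<^esub> (spoke (h (1, w))) \<otimes>\<^bsub>\<pi>\<^sub>1\<^esub> spoke (h (1, z))
        = inv\<^bsub>\<pi>\<^sub>1\<^esub> (spoke w) \<otimes>\<^bsub>\<pi>\<^sub>1\<^esub> (inv\<^bsub>\<pi>\<^sub>1\<^esub> (m (\<lambda>s. H (s, q w))) \<otimes>\<^bsub>\<pi>\<^sub>1\<^esub> (m (\<lambda>s. H (s, q w)) \<otimes>\<^bsub>\<pi>\<^sub>1\<^esub> (m c \<otimes>\<^bsub>\<pi>\<^sub>1\<^esub> spoke z)))"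
      using side[OF zw(1)] side[OF zw(2)] mw by (simp add: sq pi1.inv_mult_group pi1.m_assoc)
    also have "\<dots> = inv\<^bsub>\<pi>\<^sub>1\<^esub> (spoke w) \<otimes>\<^bsub>\<pi>\<^sub>1\<^esub> m c \<otimes>\<^bsub>\<pi>\<^sub>1\<^esub> spoke z"
      using mw by (simp add: pi1.m_assoc flip: pi1.m_assoc[of "inv\<^bsub>\<pi>\<^sub>1\<^esub> (m (\<lambda>s. H (s, q w)))"])
    finally show "inv\<^bsub>\<pi>\<^sub>1\<^esub> (spoke w) \<otimes>\<^bsub>\<pi>\<^sub>1\<^esub> m c \<otimes>\<^bsub>\<pi>\<^sub>1\<^esub> spoke z = inv\<^bsub>\<pi>\<^sub>1\<^esub> (spoke (h (1, w))) \<otimes>\<^bsub>\<pi>\<^sub>1\<^esub> spoke (h (1, z))" by simp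
  qed
qed

text \<open>The two points are reached from corners \<open>k\<close> and \<open>k + 3\<close> by
  boundary arcs with the same projection. The class of this projection cancels and only the corners
  are left.\<close>

lemma spoke_pairing:
  assumes "k < 4 * g" "k mod 4 < 2" "t \<in> {0..1}"
  shows "inv\<^bsub>\<pi>\<^sub>1\<^esub> (spoke (pol g 1 (real k + 3 - t))) \<otimes>\<^bsub>\<pi>\<^sub>1\<^esub> spoke (pol g 1 (real k + t))
    = inv\<^bsub>\<pi>\<^sub>1\<^esub> (spoke (pol g 1 (real (k + 3)))) \<otimes>\<^bsub>\<pi>\<^sub>1\<^esub> spoke (pol g 1 (real k))"
proof -
  have "continuous_on {0..1} (\<lambda>\<tau>. real k + \<tau> * t)" by (intro continuous_intros)
  note P = paths_in_q[OF path_arc[OF this]]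
  define p where "p = m (\<lambda>\<tau>. q (pol g 1 (real k + \<tau> * t)))"
  have p: "p \<in> carrier \<pi>\<^sub>1" using loopify_closed[OF P] by (simp add: p_def o_def)
  have "p = m (\<lambda>\<tau>. q (pol g 1 (real (k + 3) + \<tau> * (- t))))"
    unfolding p_def
  proof (rule loopify_cong[OF P, unfolded o_def])
    fix \<tau> :: real assume "\<tau> \<in> {0..1}"
    then have "\<tau> * t \<in> {0..1}" using assms(3) mult_mono[of \<tau> 1 t 1] by auto
    from q_pairing[OF assms(1,2) this] show "q (pol g 1 (real k + \<tau> * t)) = q (pol g 1 (real (k + 3) + \<tau> * (- t)))"
      by simp
  qed
  then have "spoke (pol g 1 (real k + t)) = p \<otimes>\<^bsub>\<pi>\<^sub>1\<^esub> spoke (pol g 1 (real k))"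
    "spoke (pol g 1 (real k + 3 - t)) = p \<otimes>\<^bsub>\<pi>\<^sub>1\<^esub> spoke (pol g 1 (real (k + 3)))"
    using spoke_arc[of "real k + t" "real k"] spoke_arc[of "real k + 3 - t" "real (k + 3)"] by (simp_all add: p_def)
  moreover have "inv\<^bsub>\<pi>\<^sub>1\<^esub> p \<otimes>\<^bsub>\<pi>\<^sub>1\<^esub> (p \<otimes>\<^bsub>\<pi>\<^sub>1\<^esub> x) = x" if "x \<in> carrier \<pi>\<^sub>1" for x
    using that p by (simp flip: pi1.m_assoc)
  ultimately show ?thesis
    using p by (simp add: pi1.inv_mult_group pi1.m_assoc)
qed

lemma corner_word_subgroup:
  assumes K: "subgroup K \<pi>\<^sub>1" and E: "\<forall>e\<in>edges g. edge_class e \<in> K" and "j \<le> 4 * g"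
  shows "corner_word \<pi>\<^sub>1 edge_class j \<in> K"
  using assms(3)
proof (induction j)
  case 0
  then show ?case using subgroup.one_closed[OF K] by simp
next
  case (Suc j)
  then have "j div 4 < g" by auto
  then have "Alpha (j div 4) \<in> edges g" "Beta (j div 4) \<in> edges g" by (auto simp: edges_def)
  then show ?case
    using Suc E subgroup.m_inv_closed[OF K] subgroup.m_closed[OF K] by (simp del: std_graph.simps)
qed

text \<open>A chain of side pairings joins the two preimages. Each link contributes a quotient of
  corner words, and the intermediate spokes cancel.\<close>

lemma spoke_fibre:
  assumes K: "subgroup K \<pi>\<^sub>1" and E: "\<forall>e\<in>edges g. edge_class e \<in> K"
    and "z \<in> cball 0 1" "z' \<in> cball 0 1" "q z = q z'"
  shows "inv\<^bsub>\<pi>\<^sub>1\<^esub> (spoke z') \<otimes>\<^bsub>\<pi>\<^sub>1\<^esub> spoke z \<in> K"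
proof -
  let ?d = "\<lambda>y z. inv\<^bsub>\<pi>\<^sub>1\<^esub> (spoke z) \<otimes>\<^bsub>\<pi>\<^sub>1\<^esub> spoke y"
  have sym: "?d z y \<in> K" if "?d y z \<in> K" "y \<in> cball 0 1" "z \<in> cball 0 1" for y z
    using subgroup.m_inv_closed[OF K that(1)] spoke_closed[OF that(2)] spoke_closed[OF that(3)]
    by (simp add: pi1.inv_mult_group)
  have pair: "?d y w \<in> K \<and> y \<in> cball 0 1 \<and> w \<in> cball 0 1" if yw: "(y, w) \<in> side_pairing g" for y w
  proof -
    obtain k t where kt: "k < 4 * g" "k mod 4 < 2" "t \<in> {0..1}" "y = pol g 1 (real k + t)" "w = pol g 1 (real k + 3 - t)"
      by (rule pairing_cases[OF yw])
    have "k + 3 \<le> 4 * g" using kt(1,2) by presburger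
    then have "spoke (pol g 1 (real k)) \<in> K" "spoke (pol g 1 (real (k + 3))) \<in> K"
      using corner_word_subgroup[OF K E, of k] corner_word_subgroup[OF K E, of "k + 3"]
        spoke_corner[of k] spoke_corner[of "k + 3"] by (simp_all only: le_refl)
    then have "?d y w \<in> K"
      unfolding kt(4,5) spoke_pairing[OF kt(1-3)] using subgroup.m_inv_closed[OF K] subgroup.m_closed[OF K] by blast
    then show ?thesis by (simp add: kt(4,5))
  qed
  have "(z, z') \<in> (side_pairing g \<union> (side_pairing g)\<inverse>)\<^sup>*"
    using q_fibre assms by blast
  then have "?d z z' \<in> K \<and> z' \<in> cball 0 1"
  proof (induction rule: rtrancl_induct)
    case base
    then show ?case using assms(3) subgroup.one_closed[OF K] by (simp add: pi1.l_inv)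
  next
    case (step y w)
    have yw: "?d y w \<in> K \<and> w \<in> cball 0 1"
      using step(2) pair[of y w] pair[of w y] sym[of y w] by blast
    have "?d y w \<otimes>\<^bsub>\<pi>\<^sub>1\<^esub> ?d z y \<in> K"
      using step yw subgroup.m_closed[OF K] by blast
    moreover have "spoke y \<otimes>\<^bsub>\<pi>\<^sub>1\<^esub> (inv\<^bsub>\<pi>\<^sub>1\<^esub> (spoke y) \<otimes>\<^bsub>\<pi>\<^sub>1\<^esub> spoke z) = spoke z"
      using step assms(3) by (simp flip: pi1.m_assoc)
    then have "?d y w \<otimes>\<^bsub>\<pi>\<^sub>1\<^esub> ?d z y = ?d z w"
      using step yw assms(3) by (simp add: pi1.m_assoc)
    ultimately show ?case using yw by simp
  qed
  then show ?thesis by simp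
qed

text \<open>Bisection of the parameter interval of a loop: short pieces lie in one contractible
  region and are reduced to \<open>spoke_fibre\<close>. Corner 1, whose spoke is trivial, is used at
  both ends of the whole loop.\<close>

lemma edge_classes_generate:
  assumes K: "subgroup K \<pi>\<^sub>1" and E: "\<forall>e\<in>edges g. edge_class e \<in> K"
  shows "K = carrier \<pi>\<^sub>1"
proof
  show "K \<subseteq> carrier \<pi>\<^sub>1" by (rule subgroup.subset[OF K])
  show "carrier \<pi>\<^sub>1 \<subseteq> K"
  proof
    fix x assume "x \<in> carrier \<pi>\<^sub>1"
    then obtain c where c: "c \<in> paths_in S (q 1) (q 1)" "x = m c"
      unfolding carrier_pi1_loopify by blast
    have cc: "continuous_on {0..1} c" "c \<in> {0..1} \<rightarrow> S"
      using c(1) by (auto simp: paths_in_def path_def path_image_def)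
    \<comment> \<open>Quantifying over all preimages of the end points allows two adjacent pieces to
      use the same preimage of their common point.\<close>
    define P where "P a b \<longleftrightarrow> (0 \<le> a \<and> b \<le> 1 \<and> a \<le> b \<longrightarrow> (\<forall>z\<in>cball 0 1. \<forall>w\<in>cball 0 1. q z = c a \<longrightarrow> q w = c b \<longrightarrow>
      inv\<^bsub>\<pi>\<^sub>1\<^esub> (spoke w) \<otimes>\<^bsub>\<pi>\<^sub>1\<^esub> m (c \<circ> linepath a b) \<otimes>\<^bsub>\<pi>\<^sub>1\<^esub> spoke z \<in> K))" for a b
    have sub: "path_image (linepath a b) \<subseteq> {0..1}" if "0 \<le> a" "a \<le> b" "b \<le> 1" for a b :: real
      using that by (auto simp: closed_segment_eq_real_ivl)
    have seg: "c \<circ> linepath a b \<in> paths_in S (c a) (c b)" if "0 \<le> a" "a \<le> b" "b \<le> 1" for a b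
      using paths_in_convex[OF cc(1) _ path_linepath sub[OF that]] cc(2) by (simp add: image_subset_iff_funcset)
    have "P 0 1"
    proof (rule Bolzano)
      fix a b d assume ab: "P a b" "P b d" "a \<le> b" "b \<le> d"
      show "P a d"
        unfolding P_def
      proof (intro impI ballI)
        fix z w assume *: "0 \<le> a \<and> d \<le> 1 \<and> a \<le> d" and zw: "z \<in> cball 0 1" "w \<in> cball 0 1" "q z = c a" "q w = c d"
        have "c b \<in> S" using cc(2) * ab by auto
        then obtain y where y: "y \<in> cball 0 1" "q y = c b" using q_image by fastforce
        note s1 = seg[of a b] and s2 = seg[of b d]
        have bounds: "0 \<le> a" "a \<le> b" "b \<le> d" "d \<le> 1" "0 \<le> b" "b \<le> 1" "a \<le> d" using * ab by auto
        have "m (c \<circ> linepath a d) = m (c \<circ> (linepath a b +++ linepath b d))"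
          using sub[of a b] sub[of b d] sub[of a d] bounds cc
          by (intro loopify_convex[of "{0..1}"]) (auto simp: path_image_join image_subset_iff_funcset)
        also have "\<dots> = m (c \<circ> linepath b d) \<otimes>\<^bsub>\<pi>\<^sub>1\<^esub> m (c \<circ> linepath a b)"
          unfolding path_compose_join using bounds by (intro loopify_join[OF s1 s2])
        finally have "m (c \<circ> linepath a d) = m (c \<circ> linepath b d) \<otimes>\<^bsub>\<pi>\<^sub>1\<^esub> m (c \<circ> linepath a b)" .
        moreover have "m (c \<circ> linepath a b) \<in> carrier \<pi>\<^sub>1" "m (c \<circ> linepath b d) \<in> carrier \<pi>\<^sub>1"
          using loopify_closed s1 s2 bounds by blast+
        \<comment> \<open>The spoke to the common point is inserted together with its inverse, which
          splits the class into those of the two pieces.\<close>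
        moreover have "spoke y \<otimes>\<^bsub>\<pi>\<^sub>1\<^esub> (inv\<^bsub>\<pi>\<^sub>1\<^esub> (spoke y) \<otimes>\<^bsub>\<pi>\<^sub>1\<^esub> u) = u" if "u \<in> carrier \<pi>\<^sub>1" for u
          using that y by (simp flip: pi1.m_assoc)
        ultimately have eq: "inv\<^bsub>\<pi>\<^sub>1\<^esub> (spoke w) \<otimes>\<^bsub>\<pi>\<^sub>1\<^esub> m (c \<circ> linepath a d) \<otimes>\<^bsub>\<pi>\<^sub>1\<^esub> spoke z
          = (inv\<^bsub>\<pi>\<^sub>1\<^esub> (spoke w) \<otimes>\<^bsub>\<pi>\<^sub>1\<^esub> m (c \<circ> linepath b d) \<otimes>\<^bsub>\<pi>\<^sub>1\<^esub> spoke y) \<otimes>\<^bsub>\<pi>\<^sub>1\<^esub>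
            (inv\<^bsub>\<pi>\<^sub>1\<^esub> (spoke y) \<otimes>\<^bsub>\<pi>\<^sub>1\<^esub> m (c \<circ> linepath a b) \<otimes>\<^bsub>\<pi>\<^sub>1\<^esub> spoke z)"
          using spoke_closed[OF zw(1)] spoke_closed[OF zw(2)] spoke_closed[OF y(1)] by (simp add: pi1.m_assoc)
        show "inv\<^bsub>\<pi>\<^sub>1\<^esub> (spoke w) \<otimes>\<^bsub>\<pi>\<^sub>1\<^esub> m (c \<circ> linepath a d) \<otimes>\<^bsub>\<pi>\<^sub>1\<^esub> spoke z \<in> K"
          unfolding eq
        proof (rule subgroup.m_closed[OF K])
          show "inv\<^bsub>\<pi>\<^sub>1\<^esub> (spoke w) \<otimes>\<^bsub>\<pi>\<^sub>1\<^esub> m (c \<circ> linepath b d) \<otimes>\<^bsub>\<pi>\<^sub>1\<^esub> spoke y \<in> K"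
            using ab(2) y zw bounds unfolding P_def by simp
          show "inv\<^bsub>\<pi>\<^sub>1\<^esub> (spoke y) \<otimes>\<^bsub>\<pi>\<^sub>1\<^esub> m (c \<circ> linepath a b) \<otimes>\<^bsub>\<pi>\<^sub>1\<^esub> spoke z \<in> K"
            using ab(1) y zw bounds unfolding P_def by simp
        qed
      qed
    next
      fix t :: real assume t: "0 \<le> t" "t \<le> 1"
      have "\<exists>B h Y. contractible_region B h Y \<and> c t \<in> q ` B"
        using regions_cover[of "c t"] cc(2) t contractible_region_ball contractible_region_sector[of 0]
          contractible_region_sector[of "1/2"] by (auto simp: Pi_iff)
      then obtain B h Y where B: "contractible_region B h Y" "c t \<in> q ` B" by blast
      have sat: "\<forall>z z'. (z, z') \<in> side_pairing g \<longrightarrow> (z \<in> B \<longleftrightarrow> z' \<in> B)" and opn: "openin (top_of_set (cball 0 1)) B"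
        using B(1) unfolding contractible_region_def by blast+
      have Bsub: "B \<subseteq> cball 0 1" using opn openin_imp_subset by auto
      have "openin (top_of_set {0..1}) ({0..1} \<inter> c -` (q ` B))"
        using cc region_open[OF sat opn] by (intro continuous_openin_preimage)
      moreover have "t \<in> {0..1} \<inter> c -` (q ` B)" using B(2) t by simp
      ultimately have "\<exists>e>0. \<forall>s\<in>{0..1}. dist s t < e \<longrightarrow> s \<in> {0..1} \<inter> c -` (q ` B)"
        unfolding openin_euclidean_subtopology_iff by (elim conjE) (rule bspec)
      then obtain e where e: "e > 0" "\<forall>s\<in>{0..1}. dist s t < e \<longrightarrow> c s \<in> q ` B" by blast
      show "\<exists>d>0. \<forall>a b. a \<le> t \<and> t \<le> b \<and> b - a < d \<longrightarrow> P a b"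
      proof (intro exI[of _ e] conjI allI impI)
        fix a b assume ab: "a \<le> t \<and> t \<le> b \<and> b - a < e"
        show "P a b"
          unfolding P_def
        proof (intro impI ballI)
          fix z w assume *: "0 \<le> a \<and> b \<le> 1 \<and> a \<le> b" and zw: "z \<in> cball 0 1" "w \<in> cball 0 1" "q z = c a" "q w = c b"
          have in_B: "c s \<in> q ` B" if "s \<in> {a..b}" for s
            using e(2) that ab * by (auto simp: dist_real_def)
          have "z \<in> B" "w \<in> B"
            using region_saturated[OF sat Bsub] zw in_B[of a] in_B[of b] * by auto
          moreover have "c \<circ> linepath a b \<in> paths_in S (q z) (q w)" using seg[of a b] * zw by simp
          moreover have "path_image (c \<circ> linepath a b) \<subseteq> q ` B"
            using in_B * by (auto simp: path_image_compose closed_segment_eq_real_ivl)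
          ultimately obtain z1 w1 where "z1 \<in> cball 0 1" "w1 \<in> cball 0 1" "q z1 = q w1"
            "inv\<^bsub>\<pi>\<^sub>1\<^esub> (spoke w) \<otimes>\<^bsub>\<pi>\<^sub>1\<^esub> m (c \<circ> linepath a b) \<otimes>\<^bsub>\<pi>\<^sub>1\<^esub> spoke z = inv\<^bsub>\<pi>\<^sub>1\<^esub> (spoke w1) \<otimes>\<^bsub>\<pi>\<^sub>1\<^esub> spoke z1"
            using contract_path[OF B(1)] by metis
          then show "inv\<^bsub>\<pi>\<^sub>1\<^esub> (spoke w) \<otimes>\<^bsub>\<pi>\<^sub>1\<^esub> m (c \<circ> linepath a b) \<otimes>\<^bsub>\<pi>\<^sub>1\<^esub> spoke z \<in> K"
            using spoke_fibre[OF K E] by simp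
        qed
      qed (rule e(1))
    qed simp
    moreover have "q 1 = c 0" "q 1 = c 1" using c(1) by (auto simp: paths_in_def pathstart_def pathfinish_def)
    ultimately have "inv\<^bsub>\<pi>\<^sub>1\<^esub> (spoke 1) \<otimes>\<^bsub>\<pi>\<^sub>1\<^esub> m (c \<circ> linepath 0 1) \<otimes>\<^bsub>\<pi>\<^sub>1\<^esub> spoke 1 \<in> K"
      unfolding P_def by simp
    moreover have "spoke 1 = \<one>\<^bsub>\<pi>\<^sub>1\<^esub>" using q_in[of 1] by (simp add: spoke_def o_def)
    moreover have "c \<circ> linepath 0 1 = c" by (simp add: linepath_def o_def)
    ultimately show "x \<in> K" using c by simp
  qed
qed

end

section \<open>Homomorphisms out of the fundamental group\<close>

locale surface_labels = surface g S q + G: group G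
  for g :: nat and S :: "'p::t2_space set" and q :: "complex \<Rightarrow> 'p" and G :: "('h, 'c) monoid_scheme" +
  fixes a :: "edge \<Rightarrow> 'h"
  assumes labels: "\<forall>e\<in>edges g. a e \<in> carrier G" and face: "face_word G g a = \<one>\<^bsub>G\<^esub>"
begin

definition corner :: "int \<Rightarrow> 'h" where
  "corner j = corner_word G a (nat (j mod (4 * int g)))"

lemma corner_closed [simp]: "corner j \<in> carrier G"
proof -
  have "nat (j mod (4 * int g)) \<le> 4 * g"
    using g_pos pos_mod_bound[of "4 * int g" j] by linarith
  then show ?thesis unfolding corner_def by (rule G.corner_word_closed[OF labels])
qed

lemma corner_shift: "corner (j + 4 * int g) = corner j"
  by (simp add: corner_def)

text \<open>Only \<open>n = 4 * g\<close> needs an argument: there the index wraps round to 0, and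
  the two values agree by the face relation.\<close>

lemma corner_nat: "n \<le> 4 * g \<Longrightarrow> corner (int n) = corner_word G a n"
proof (cases "n = 4 * g")
  case True
  then show ?thesis
    using G.corner_word_face_word[OF labels, of g] face by (simp add: corner_def)
next
  case False
  moreover assume "n \<le> 4 * g"
  ultimately show ?thesis by (simp add: corner_def nat_mod_as_int)
qed

text \<open>Both sides are the label picked up along side \<open>k\<close>: sides \<open>k\<close>
  and \<open>k + 2\<close> carry inverse labels, and the right-hand side traverses side
  \<open>k + 2\<close> backwards.\<close>

lemma corner_sides:
  assumes "k < 4 * g" "k mod 4 < 2"
  shows "corner (int k + 1) \<otimes>\<^bsub>G\<^esub> inv\<^bsub>G\<^esub> (corner (int k)) = corner (int k + 2) \<otimes>\<^bsub>G\<^esub> inv\<^bsub>G\<^esub> (corner (int k + 3))"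
proof -
  define i where "i = k div 4"
  have i: "i < g" using assms by (auto simp: i_def)
  note ab = G.edge_label_closed[OF labels i]
  have le: "k \<le> 4 * g" "Suc k \<le> 4 * g" "Suc (Suc k) \<le> 4 * g" "Suc (Suc (Suc k)) \<le> 4 * g"
    using assms by presburger+
  have eq: "corner (int k + 1) = corner_word G a (Suc k)" "corner (int k + 2) = corner_word G a (Suc (Suc k))"
    "corner (int k + 3) = corner_word G a (Suc (Suc (Suc k)))" "corner (int k) = corner_word G a k"
    using corner_nat[OF le(1)] corner_nat[OF le(2)] corner_nat[OF le(3)] corner_nat[OF le(4)]
    by (simp_all add: add.commute)
  have gen: "(y \<otimes>\<^bsub>G\<^esub> u) \<otimes>\<^bsub>G\<^esub> inv\<^bsub>G\<^esub> u = w \<otimes>\<^bsub>G\<^esub> inv\<^bsub>G\<^esub> (inv\<^bsub>G\<^esub> y \<otimes>\<^bsub>G\<^esub> w)"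
    if "y \<in> carrier G" "u \<in> carrier G" "w \<in> carrier G" for y u w
  proof -
    have "w \<otimes>\<^bsub>G\<^esub> (inv\<^bsub>G\<^esub> w \<otimes>\<^bsub>G\<^esub> y) = y" using that by (simp flip: G.m_assoc)
    then show ?thesis using that by (simp add: G.m_assoc G.inv_mult_group)
  qed
  define c w where "c = corner_word G a k" and "w = corner_word G a (Suc (Suc k))"
  have cw: "c \<in> carrier G" "w \<in> carrier G"
    unfolding c_def w_def by (rule G.corner_word_closed[OF labels le(1)], rule G.corner_word_closed[OF labels le(3)])
  have "k = 4 * i \<or> k = Suc (4 * i)" using assms unfolding i_def by presburger
  then show ?thesis
  proof
    assume k: "k = 4 * i"
    have "Suc (Suc k) mod 4 = 2" "Suc (Suc k) div 4 = i" "k mod 4 = 0" "k div 4 = i" unfolding k by presburger+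
    then have "corner_word G a (Suc k) = inv\<^bsub>G\<^esub> (a (Alpha i)) \<otimes>\<^bsub>G\<^esub> c"
      "corner_word G a (Suc (Suc (Suc k))) = a (Alpha i) \<otimes>\<^bsub>G\<^esub> w"
      unfolding w_def c_def corner_word.simps(2)[of G a "Suc (Suc k)"] corner_word.simps(2)[of G a k] by simp_all
    then show ?thesis
      unfolding eq c_def[symmetric] w_def[symmetric] using gen[of "inv\<^bsub>G\<^esub> (a (Alpha i))" c w] ab cw by simp
  next
    assume k: "k = Suc (4 * i)"
    have "Suc (Suc k) mod 4 = 3" "Suc (Suc k) div 4 = i" "k mod 4 = 1" "k div 4 = i" unfolding k by presburger+
    then have "corner_word G a (Suc k) = a (Beta i) \<otimes>\<^bsub>G\<^esub> c"
      "corner_word G a (Suc (Suc (Suc k))) = inv\<^bsub>G\<^esub> (a (Beta i)) \<otimes>\<^bsub>G\<^esub> w"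
      unfolding w_def c_def corner_word.simps(2)[of G a "Suc (Suc k)"] corner_word.simps(2)[of G a k] by simp_all
    then show ?thesis
      unfolding eq c_def[symmetric] w_def[symmetric] using gen[of "a (Beta i)" c w] ab cw by simp
  qed
qed

text \<open>The label by which the fibre over a point of the polygon is identified with \<open>G\<close>: boundary points are transported to the base point
  along the spoke to the nearest corner on a fixed side.\<close>

definition side_corner :: "int \<Rightarrow> int" where
  "side_corner k = (if k mod 4 < 2 then k else k + 1)"

text \<open>On a side \<open>k\<close> with \<open>k mod 4 < 2\<close> the chosen corner is the
  start, on its partner \<open>k + 2\<close> it is the end \<open>k + 3\<close>. These corners are
  matched by the gluing, so the arcs to two glued points have the same projection.\<close>

definition boundary_label :: "real \<Rightarrow> 'h" where
  "boundary_label u = (if u \<in> \<int> then corner \<lfloor>u\<rfloor> else corner (side_corner \<lfloor>u\<rfloor>))"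

text \<open>Points of norm less than 1 are the only preimages of their images, so the trivial label
  can be used there. The jump at the boundary is harmless, as the trivialisation is purely
  set-theoretic.\<close>

definition transition :: "complex \<Rightarrow> 'h" where
  "transition z = (if norm z < 1 then \<one>\<^bsub>G\<^esub> else boundary_label (angle_coord g z))"

lemma floor_shift: "\<lfloor>u + 4 * real g\<rfloor> = \<lfloor>u\<rfloor> + 4 * int g"
  using floor_add_nat_shift[of u "4 * g" 0] by simp

lemma side_corner_shift: "corner (side_corner (k + 4 * int g)) = corner (side_corner k)"
proof -
  have "(k + 4 * int g) mod 4 = k mod 4" by presburger
  then show ?thesis using corner_shift[of k] corner_shift[of "k + 1"] by (simp add: side_corner_def algebra_simps)
qed

lemma boundary_label_shift: "boundary_label (u + 4 * real g) = boundary_label u"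
  using Ints_shift[of u "4 * g" 0] floor_shift[of u] corner_shift[of "\<lfloor>u\<rfloor>"] side_corner_shift[of "\<lfloor>u\<rfloor>"]
  by (simp add: boundary_label_def)

lemma transition_closed [simp]: "transition z \<in> carrier G"
  by (simp add: transition_def boundary_label_def)

lemma transition_pol: "transition (pol g 1 u) = boundary_label u"
  using periodic_angle_coord[of g boundary_label 1 u] g_pos boundary_label_shift by (simp add: transition_def)

lemma transition_corner: "j \<le> 4 * g \<Longrightarrow> transition (pol g 1 (real j)) = corner_word G a j"
  using corner_nat[of j] by (simp add: transition_pol boundary_label_def)

text \<open>On the polygon the section is locally constant; divided by \<open>transition\<close> it
  takes equal values at glued points, and so it descends to the surface.\<close>

definition flat_section :: "complex set \<Rightarrow> (complex \<Rightarrow> 'h) \<Rightarrow> bool" where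
  "flat_section B s \<longleftrightarrow> openin (top_of_set (cball 0 1)) B \<and> s \<in> B \<rightarrow> carrier G \<and>
     (\<forall>z\<in>B. \<exists>V. open V \<and> z \<in> V \<and> (\<forall>y\<in>V \<inter> B. s y = s z)) \<and>
     (\<forall>z z'. (z, z') \<in> side_pairing g \<longrightarrow> (z \<in> B \<longleftrightarrow> z' \<in> B) \<and>
        (z \<in> B \<longrightarrow> s z \<otimes>\<^bsub>G\<^esub> inv\<^bsub>G\<^esub> (transition z) = s z' \<otimes>\<^bsub>G\<^esub> inv\<^bsub>G\<^esub> (transition z')))"

lemma flat_section_ball: "flat_section (ball 0 1) (\<lambda>_. \<one>\<^bsub>G\<^esub>)"
proof -
  have "norm z = 1 \<and> norm z' = 1" if "(z, z') \<in> side_pairing g" for z z' :: complex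
    using pairing_cases[OF that] by (metis abs_one norm_pol)
  moreover have "openin (top_of_set (cball 0 1)) (ball (0::complex) 1)"
    by (metis ball_subset_cball open_ball open_subset)
  ultimately show ?thesis unfolding flat_section_def by (auto intro: exI[of _ UNIV])
qed

text \<open>A section that depends only on the number of the interval containing the angle is
  locally constant on the sectors, so just the comparison with the labels at glued points has to be
  supplied.\<close>

lemma flat_section_sector:
  assumes d: "d = 0 \<or> d = 1/2" and \<sigma>: "\<And>k. \<sigma> (k + 4 * int g) = \<sigma> k" "\<And>k. \<sigma> k \<in> carrier G"
    and pair: "\<And>k t. k < 4 * g \<Longrightarrow> k mod 4 < 2 \<Longrightarrow> t \<in> {0..1} \<Longrightarrow> real k + t - d \<notin> \<int> \<Longrightarrow>
      \<sigma> \<lfloor>real k + t - d\<rfloor> \<otimes>\<^bsub>G\<^esub> inv\<^bsub>G\<^esub> (boundary_label (real k + t)) =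
      \<sigma> \<lfloor>real k + 3 - t - d\<rfloor> \<otimes>\<^bsub>G\<^esub> inv\<^bsub>G\<^esub> (boundary_label (real k + 3 - t))"
  shows "flat_section (sector d) (\<lambda>z. \<sigma> \<lfloor>angle_coord g z - d\<rfloor>)"
proof -
  let ?s = "\<lambda>z. \<sigma> \<lfloor>angle_coord g z - d\<rfloor>"
  have s_pol: "?s (pol g r u) = \<sigma> \<lfloor>u - d\<rfloor>" if "r > 0" for r u
  proof (rule periodic_angle_coord[OF g_pos _ that, of "\<lambda>u. \<sigma> \<lfloor>u - d\<rfloor>"])
    show "\<sigma> \<lfloor>u + 4 * real g - d\<rfloor> = \<sigma> \<lfloor>u - d\<rfloor>" for u
      using floor_add_nat_shift[of u "4 * g" d] \<sigma>(1)[of "\<lfloor>u - d\<rfloor>"] by simp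
  qed
  have loc: "\<exists>V. open V \<and> z \<in> V \<and> (\<forall>y\<in>V \<inter> sector d. ?s y = ?s z)" if z: "z \<in> sector d" for z
  proof -
    obtain V U where V: "open V" "z \<in> V" "continuous_on V U"
      "\<forall>y\<in>V. y = pol g (norm y) (U y) \<and> y \<noteq> 0 \<and> U y - d \<notin> \<int> \<and> \<lfloor>U y - d\<rfloor> = \<lfloor>angle_coord g z - d\<rfloor>"
      by (rule sector_local[OF z])
    have "?s y = ?s z" if "y \<in> V" for y
    proof -
      have y: "y = pol g (norm y) (U y)" "norm y > 0" "\<lfloor>U y - d\<rfloor> = \<lfloor>angle_coord g z - d\<rfloor>" using V(4) that by auto
      then show ?thesis using s_pol[OF y(2), of "U y"] by simp
    qed
    then show ?thesis using V(1,2) by blast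
  qed
  have "?s z \<otimes>\<^bsub>G\<^esub> inv\<^bsub>G\<^esub> (transition z) = ?s z' \<otimes>\<^bsub>G\<^esub> inv\<^bsub>G\<^esub> (transition z')"
    if "(z, z') \<in> side_pairing g" and z: "z \<in> sector d" for z z'
  proof -
    obtain k t where kt: "k < 4 * g" "k mod 4 < 2" "t \<in> {0..1}" "z = pol g 1 (real k + t)" "z' = pol g 1 (real k + 3 - t)"
      by (rule pairing_cases[OF \<open>(z, z') \<in> side_pairing g\<close>])
    have "real k + t - d \<notin> \<int>" using z kt(4) sector_pol[of 1] by simp
    from pair[OF kt(1-3) this] show ?thesis
      using s_pol[of 1] by (simp add: kt(4,5) transition_pol)
  qed
  then show ?thesis
    unfolding flat_section_def using sector_open loc sector_pairing[OF d] \<sigma>(2) by blast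
qed

text \<open>In the interior of a side this section equals the label itself, so both quotients are
  trivial.\<close>

lemma flat_section_sides: "flat_section (sector 0) (\<lambda>z. corner (side_corner \<lfloor>angle_coord g z - 0\<rfloor>))"
proof (rule flat_section_sector)
  fix k t assume *: "k < 4 * g" "k mod 4 < 2" "t \<in> {0..1}" "real k + t - 0 \<notin> \<int>"
  have "real k + 3 - t \<notin> \<int>" using center_sides[of 0 t k] * by auto
  then show "corner (side_corner \<lfloor>real k + t - 0\<rfloor>) \<otimes>\<^bsub>G\<^esub> inv\<^bsub>G\<^esub> (boundary_label (real k + t)) =
      corner (side_corner \<lfloor>real k + 3 - t - 0\<rfloor>) \<otimes>\<^bsub>G\<^esub> inv\<^bsub>G\<^esub> (boundary_label (real k + 3 - t))"
    using * by (simp add: boundary_label_def)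
qed (use side_corner_shift in simp_all)

lemma boundary_label_side:
  assumes "k mod 4 < 2" "0 < t" "t < 1"
  shows "boundary_label (real k + t) = corner (int k)" "boundary_label (real k + 3 - t) = corner (int k + 3)"
proof -
  have f: "\<lfloor>real k + t\<rfloor> = int k" "\<lfloor>real k + 3 - t\<rfloor> = int k + 2"
    using assms by (auto intro!: floor_unique)
  have "real k + t \<notin> \<int>" "real k + 3 - t \<notin> \<int>"
    using f assms by (auto elim!: Ints_cases)
  moreover have "int k mod 4 < 2" "\<not> (int k + 2) mod 4 < 2" using assms(1) by presburger+
  ultimately show "boundary_label (real k + t) = corner (int k)" "boundary_label (real k + 3 - t) = corner (int k + 3)"
    by (simp_all add: boundary_label_def f side_corner_def add.assoc)
qed

lemma boundary_label_nat: "boundary_label (real k) = corner (int k)"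
  by (simp add: boundary_label_def)

text \<open>The section takes the value belonging to the nearest corner. On the half of a side that
  contains the chosen corner it equals the label. On the other open half the two quotients are those
  compared by \<open>corner_sides\<close>, and at the corners themselves they are trivial.\<close>

lemma flat_section_corners: "flat_section (sector (1/2)) (\<lambda>z. corner (\<lfloor>angle_coord g z - 1/2\<rfloor> + 1))"
proof (rule flat_section_sector)
  show "corner (k + 4 * int g + 1) = corner (k + 1)" for k
    using corner_shift[of "k + 1"] by (simp add: algebra_simps)
  fix k t assume kt: "k < 4 * g" "k mod 4 < 2" "t \<in> {0..1}" and n: "real k + t - 1/2 \<notin> \<int>"
  have "t \<noteq> 1/2"
  proof
    assume "t = 1/2"
    then have "real k + t - 1/2 = real k" by simp
    with n show False by simp
  qed
  then consider "t = 0" | "0 < t" "t < 1/2" | "1/2 < t" "t < 1" | "t = 1" using kt(3) by force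
  then show "corner (\<lfloor>real k + t - 1/2\<rfloor> + 1) \<otimes>\<^bsub>G\<^esub> inv\<^bsub>G\<^esub> (boundary_label (real k + t)) =
      corner (\<lfloor>real k + 3 - t - 1/2\<rfloor> + 1) \<otimes>\<^bsub>G\<^esub> inv\<^bsub>G\<^esub> (boundary_label (real k + 3 - t))"
  proof cases
    case 1
    have f: "\<lfloor>real k + t - 1/2\<rfloor> = int k - 1" "\<lfloor>real k + 3 - t - 1/2\<rfloor> = int k + 2"
      using 1 by (auto intro!: floor_unique)
    show ?thesis unfolding f using 1 boundary_label_nat[of k] boundary_label_nat[of "k + 3"] by (simp add: add.commute)
  next
    case 2
    have f: "\<lfloor>real k + t - 1/2\<rfloor> = int k - 1" "\<lfloor>real k + 3 - t - 1/2\<rfloor> = int k + 2"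
      using 2 by (auto intro!: floor_unique)
    show ?thesis unfolding f using boundary_label_side[OF kt(2), of t] 2 by (simp add: add.commute)
  next
    case 3
    have f: "\<lfloor>real k + t - 1/2\<rfloor> = int k" "\<lfloor>real k + 3 - t - 1/2\<rfloor> = int k + 1"
      using 3 by (auto intro!: floor_unique)
    show ?thesis unfolding f using boundary_label_side[OF kt(2), of t] 3 corner_sides[OF kt(1,2)] by (simp add: add.assoc)
  next
    case 4
    have f: "\<lfloor>real k + t - 1/2\<rfloor> = int k" "\<lfloor>real k + 3 - t - 1/2\<rfloor> = int k + 1"
      using 4 by (auto intro!: floor_unique)
    show ?thesis unfolding f using 4 boundary_label_nat[of "k + 1"] boundary_label_nat[of "k + 2"] by (simp add: add.commute)
  qed
qed simp_all

section \<open>The local system of a labelled polygon and its holonomy\<close>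

definition sections :: "(complex set \<times> (complex \<Rightarrow> 'h)) set" where
  "sections = {(B, s). flat_section B s}"

definition section_label :: "complex set \<times> (complex \<Rightarrow> 'h) \<Rightarrow> 'p \<Rightarrow> 'h" where
  "section_label = (\<lambda>(B, s) x. let z = SOME z. z \<in> B \<and> q z = x in s z \<otimes>\<^bsub>G\<^esub> inv\<^bsub>G\<^esub> (transition z))"

lemma sections_cover: "z \<in> cball 0 1 \<Longrightarrow> \<exists>B s. flat_section B s \<and> z \<in> B"
proof -
  assume z: "z \<in> cball 0 1"
  have "\<exists>B s. flat_section B s \<and> q z \<in> q ` B"
    using regions_cover[OF q_in[OF z]] flat_section_ball flat_section_sides flat_section_corners by blast
  then obtain B s where Bs: "flat_section B s" "q z \<in> q ` B" by blast
  have "\<forall>z z'. (z, z') \<in> side_pairing g \<longrightarrow> (z \<in> B \<longleftrightarrow> z' \<in> B)" "B \<subseteq> cball 0 1"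
    using Bs(1) openin_imp_subset unfolding flat_section_def by blast+
  from region_saturated[OF this z Bs(2)] show ?thesis using Bs by blast
qed

lemma flat_sectionD:
  assumes "flat_section B s"
  shows "\<forall>z z'. (z, z') \<in> side_pairing g \<longrightarrow> (z \<in> B \<longleftrightarrow> z' \<in> B)" "B \<subseteq> cball 0 1" "z \<in> B \<Longrightarrow> s z \<in> carrier G"
    "openin (top_of_set (cball 0 1)) B" "z \<in> B \<Longrightarrow> \<exists>V. open V \<and> z \<in> V \<and> (\<forall>y\<in>V \<inter> B. s y = s z)"
  using assms openin_imp_subset unfolding flat_section_def by blast+

text \<open>The gluing condition makes the quotient constant on fibres, so the preimage chosen in
  the definition may be replaced by any other in \<open>B\<close>.\<close>

lemma section_label_q:
  assumes Bs: "flat_section B s" and z: "z \<in> B"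
  shows "section_label (B, s) (q z) = s z \<otimes>\<^bsub>G\<^esub> inv\<^bsub>G\<^esub> (transition z)"
proof -
  define z' where "z' = (SOME z'. z' \<in> B \<and> q z' = q z)"
  have z': "z' \<in> B \<and> q z' = q z" unfolding z'_def by (rule someI[of _ z]) (use z in simp)
  let ?F = "\<lambda>z. s z \<otimes>\<^bsub>G\<^esub> inv\<^bsub>G\<^esub> (transition z)"
  have "(z' \<in> B \<longleftrightarrow> z \<in> B) \<and> (z' \<in> B \<longrightarrow> ?F z' = ?F z)"
  proof (rule fibre_invariant)
    show "(y \<in> B \<longleftrightarrow> y' \<in> B) \<and> (y \<in> B \<longrightarrow> ?F y = ?F y')" if "(y, y') \<in> side_pairing g" for y y'
      using Bs that unfolding flat_section_def by blast
  qed (use flat_sectionD(2)[OF Bs] z z' in auto)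
  then show ?thesis using z' by (simp add: section_label_def z'_def[symmetric])
qed

text \<open>In a quotient of two section labels the transitions cancel, and what is left is locally
  constant on the polygon before passing to the surface.\<close>

lemma local_system: "local_system G S sections (\<lambda>(B, s). q ` B) section_label"
proof (unfold_locales, goal_cases)
  case (1 i x)
  then obtain B s z where "i = (B, s)" "flat_section B s" "z \<in> B" "x = q z" by (auto simp: sections_def)
  then show ?case using section_label_q flat_sectionD(3) by simp
next
  case (2 i)
  then obtain B s where i: "i = (B, s)" "flat_section B s" by (auto simp: sections_def)
  show ?case unfolding i(1) prod.case
    by (rule region_open[OF flat_sectionD(1)[OF i(2)] flat_sectionD(4)[OF i(2)]])
next
  case (3 x)
  then obtain z where z: "z \<in> cball 0 1" "x = q z" using q_image by blast
  then obtain B s where "flat_section B s" "z \<in> B" using sections_cover by blast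
  then show ?case using z by (intro bexI[of _ "(B, s)"]) (auto simp: sections_def)
next
  case (4 i j x)
  then obtain B s B' s' where i: "i = (B, s)" "flat_section B s" and j: "j = (B', s')" "flat_section B' s'"
    by (auto simp: sections_def)
  let ?k = "section_label i x \<otimes>\<^bsub>G\<^esub> inv\<^bsub>G\<^esub> (section_label j x)"
  \<comment> \<open>The part of the polygon where the quotient has its value at \<open>x\<close>. It
    is open and saturated, so its image is the required neighbourhood.\<close>
  define C where "C = {z \<in> B \<inter> B'. s z \<otimes>\<^bsub>G\<^esub> inv\<^bsub>G\<^esub> (s' z) = ?k}"
  have label: "section_label i (q z) \<otimes>\<^bsub>G\<^esub> inv\<^bsub>G\<^esub> (section_label j (q z)) = s z \<otimes>\<^bsub>G\<^esub> inv\<^bsub>G\<^esub> (s' z)" if "z \<in> B \<inter> B'" for z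
  proof -
    have c: "s z \<in> carrier G" "s' z \<in> carrier G" using that flat_sectionD(3) i j by auto
    then have "inv\<^bsub>G\<^esub> (transition z) \<otimes>\<^bsub>G\<^esub> (transition z \<otimes>\<^bsub>G\<^esub> inv\<^bsub>G\<^esub> (s' z)) = inv\<^bsub>G\<^esub> (s' z)"
      by (simp flip: G.m_assoc)
    then show ?thesis
      using that c i j by (simp add: section_label_q G.inv_mult_group G.m_assoc)
  qed
  have sat: "z \<in> B \<inter> B'" if "z \<in> cball 0 1" "q z \<in> q ` B" "q z \<in> q ` B'" for z
    using that region_saturated[OF flat_sectionD(1,2)] i j by blast
  have "openin (top_of_set (cball 0 1)) C"
  proof (subst openin_subopen, intro ballI)
    fix z assume z: "z \<in> C"
    then have zB: "z \<in> B" "z \<in> B'" by (simp_all add: C_def)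
    obtain V where V: "open V" "z \<in> V" "\<forall>y\<in>V \<inter> B. s y = s z"
      using flat_sectionD(5)[OF i(2) zB(1)] by (elim exE conjE)
    obtain V' where V': "open V'" "z \<in> V'" "\<forall>y\<in>V' \<inter> B'. s' y = s' z"
      using flat_sectionD(5)[OF j(2) zB(2)] by (elim exE conjE)
    have "openin (top_of_set (cball 0 1)) (B \<inter> B' \<inter> (V \<inter> V'))"
      using flat_sectionD(4) i(2) j(2) V(1) V'(1) by (intro openin_Int_open openin_Int open_Int) auto
    moreover have "B \<inter> B' \<inter> (V \<inter> V') \<subseteq> C"
    proof
      fix y assume y: "y \<in> B \<inter> B' \<inter> (V \<inter> V')"
      then have "s y = s z" "s' y = s' z" using V(3) V'(3) by blast+
      then show "y \<in> C" using y z unfolding C_def mem_Collect_eq by simp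
    qed
    moreover have "z \<in> B \<inter> B' \<inter> (V \<inter> V')" using zB V(2) V'(2) by blast
    ultimately show "\<exists>T. openin (top_of_set (cball 0 1)) T \<and> z \<in> T \<and> T \<subseteq> C"
      by blast
  qed
  moreover have "z \<in> C" if zz: "z \<in> cball 0 1" "q z \<in> q ` C" for z
  proof -
    obtain y where y: "y \<in> C" "q z = q y" using zz(2) by blast
    then have "y \<in> B" "y \<in> B'" by (simp_all add: C_def)
    then have z: "z \<in> B \<inter> B'" using y(2) by (intro sat[OF zz(1)]) simp_all
    then have "s z \<otimes>\<^bsub>G\<^esub> inv\<^bsub>G\<^esub> (s' z) = ?k"
      using label[OF z] label[of y] y by (simp add: C_def)
    then show ?thesis using z by (simp add: C_def)
  qed
  ultimately have "openin (top_of_set S) (q ` C)"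
    using quotient_open[OF compact_cball q_cont] q_image by metis
  moreover have "x \<in> q ` C"
  proof -
    obtain z where z: "z \<in> B" "x = q z" using 4 i by auto
    then have "z \<in> B \<inter> B'" using 4 j sat[of z] flat_sectionD(2)[OF i(2)] by auto
    then have "z \<in> C" using label[of z] z by (simp add: C_def)
    then show ?thesis using z by blast
  qed
  moreover have "section_label i y \<otimes>\<^bsub>G\<^esub> inv\<^bsub>G\<^esub> (section_label j y) = ?k" if "y \<in> q ` C" for y
    using that label by (auto simp: C_def)
  ultimately show ?case by blast
qed

sublocale local_system G S sections "\<lambda>(B, s). q ` B" section_label
  by (rule local_system)

text \<open>Along a path in the polygon the inverse of \<open>transition\<close> is itself a
  parallel lift, since it differs from a section label by the locally constant value of the
  section.\<close>

lemma hol_polygon_path: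
  assumes \<gamma>: "path \<gamma>" "path_image \<gamma> \<subseteq> cball 0 1"
  shows "hol (q \<circ> \<gamma>) = transition (\<gamma> 1) \<otimes>\<^bsub>G\<^esub> inv\<^bsub>G\<^esub> (transition (\<gamma> 0))"
proof -
  have "flat {0..1} (q \<circ> \<gamma>) (\<lambda>t. inv\<^bsub>G\<^esub> (transition (\<gamma> t)))"
  proof (rule flatI)
    show "continuous_on {0..1} (q \<circ> \<gamma>)" "q \<circ> \<gamma> \<in> {0..1} \<rightarrow> S"
      using paths_in_q[OF \<gamma>] by (auto simp: paths_in_def path_def path_image_def)
    fix t :: real assume t: "t \<in> {0..1}"
    have "\<gamma> t \<in> path_image \<gamma>" using t by (simp add: path_image_def)
    then have \<gamma>t: "\<gamma> t \<in> cball 0 1" using \<gamma>(2) by blast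
    obtain B s where Bs: "flat_section B s" "\<gamma> t \<in> B" using sections_cover[OF \<gamma>t] by blast
    obtain V where V: "open V" "\<gamma> t \<in> V" "\<forall>y\<in>V \<inter> B. s y = s (\<gamma> t)"
      using flat_sectionD(5)[OF Bs] by blast
    have "openin (top_of_set (cball 0 1)) (B \<inter> V)"
      using flat_sectionD(4)[OF Bs(1)] V(1) by (intro openin_Int_open)
    then have "openin (top_of_set {0..1}) ({0..1} \<inter> \<gamma> -` (B \<inter> V))"
      using \<gamma> by (intro continuous_openin_preimage[of _ _ "cball 0 1"]) (auto simp: path_def path_image_def)
    then obtain V' where V': "open V'" "{0..1} \<inter> \<gamma> -` (B \<inter> V) = {0..1} \<inter> V'" by (auto simp: openin_open)
    have "(q \<circ> \<gamma>) y \<in> q ` B \<and> inv\<^bsub>G\<^esub> (transition (\<gamma> y)) = inv\<^bsub>G\<^esub> (s (\<gamma> t)) \<otimes>\<^bsub>G\<^esub> section_label (B, s) ((q \<circ> \<gamma>) y)"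
      if "y \<in> V' \<inter> {0..1}" for y
    proof -
      have y: "\<gamma> y \<in> B" "s (\<gamma> y) = s (\<gamma> t)" using V'(2) V(3) that by auto
      have "s (\<gamma> t) \<in> carrier G" using flat_sectionD(3)[OF Bs] .
      then show ?thesis using y Bs(1) by (simp add: section_label_q flip: G.m_assoc)
    qed
    moreover have "t \<in> {0..1} \<inter> \<gamma> -` (B \<inter> V)" using Bs(2) V(2) t by simp
    then have "t \<in> V'" unfolding V'(2) by simp
    ultimately have *: "open V' \<and> t \<in> V' \<and> (\<forall>y\<in>V' \<inter> {0..1}. (q \<circ> \<gamma>) y \<in> (case (B, s) of (B, s) \<Rightarrow> q ` B) \<and>
        inv\<^bsub>G\<^esub> (transition (\<gamma> y)) = inv\<^bsub>G\<^esub> (s (\<gamma> t)) \<otimes>\<^bsub>G\<^esub> section_label (B, s) ((q \<circ> \<gamma>) y))"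
      using V'(1) unfolding prod.case by blast
    have "(B, s) \<in> sections" "inv\<^bsub>G\<^esub> (s (\<gamma> t)) \<in> carrier G"
      using Bs(1) flat_sectionD(3)[OF Bs] by (simp_all add: sections_def)
    with * show "\<exists>i\<in>sections. \<exists>h\<in>carrier G. \<exists>V. open V \<and> t \<in> V \<and>
        (\<forall>y\<in>V \<inter> {0..1}. (q \<circ> \<gamma>) y \<in> (case i of (B, s) \<Rightarrow> q ` B) \<and> inv\<^bsub>G\<^esub> (transition (\<gamma> y)) = h \<otimes>\<^bsub>G\<^esub> section_label i ((q \<circ> \<gamma>) y))"
      by (intro bexI exI)
  qed simp
  from hol_eq[OF this] show ?thesis by simp
qed

text \<open>The holonomy along side \<open>k\<close> is the quotient of consecutive corner words.
  \<open>Beta i\<close> is side \<open>4i + 1\<close> and \<open>Alpha i\<close> is side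
  \<open>4i + 2\<close>, the sides whose labels occur without an inverse.\<close>

lemma rep_exists:
  obtains \<rho> where "\<rho> \<in> reps \<pi>\<^sub>1 G" "\<forall>e\<in>edges g. \<rho> (edge_class e) = a e"
proof -
  obtain \<rho> where \<rho>: "\<rho> \<in> reps \<pi>\<^sub>1 G" "\<forall>p\<in>paths_in S (q 1) (q 1). \<rho> (loop_class S p) = hol p"
    by (rule hol_rep[of "q 1"])
  have side: "hol (\<lambda>t. q (side g k t)) = corner_word G a (Suc k) \<otimes>\<^bsub>G\<^esub> inv\<^bsub>G\<^esub> (corner_word G a k)" if "Suc k \<le> 4 * g" for k
  proof -
    have "continuous_on {0..1} (\<lambda>t. real k + t)" by (intro continuous_intros)
    from hol_polygon_path[OF path_arc[OF this]] show ?thesis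
      using transition_corner[of k] transition_corner[of "Suc k"] that by (simp add: side_pol o_def add.commute)
  qed
  have "\<rho> (edge_class e) = a e" if e: "e \<in> edges g" for e
  proof -
    have "hol (std_graph g q e) = a e"
    proof (cases e)
      case (Alpha i)
      then have i: "i < g" using e by (auto simp: edges_def)
      have *: "Suc (Suc (4 * i)) mod 4 = 2" "Suc (Suc (4 * i)) div 4 = i" by presburger+
      have "corner_word G a (Suc (Suc (4 * i))) \<in> carrier G" using i by (intro G.corner_word_closed[OF labels]) auto
      then show ?thesis
        using side[of "Suc (Suc (4 * i))"] i G.edge_label_closed[OF labels i] Alpha * by (simp add: G.m_assoc)
    next
      case (Beta i)
      then have i: "i < g" using e by (auto simp: edges_def)
      have *: "Suc (4 * i) mod 4 = 1" "Suc (4 * i) div 4 = i" by presburger+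
      have "corner_word G a (Suc (4 * i)) \<in> carrier G" using i by (intro G.corner_word_closed[OF labels]) auto
      then show ?thesis
        using side[of "Suc (4 * i)"] i G.edge_label_closed[OF labels i] Beta * by (simp add: G.m_assoc)
    qed
    then show ?thesis using bspec[OF \<rho>(2) std_graph_in[OF e]] by simp
  qed
  then show thesis using \<rho>(1) that by blast
qed

end

context surface
begin

text \<open>Two homomorphisms agree on a subgroup, and here this subgroup contains a generating
  set.\<close>

lemma rep_unique:
  assumes G: "group G" and "\<rho> \<in> reps \<pi>\<^sub>1 G" "\<rho>' \<in> reps \<pi>\<^sub>1 G" "\<forall>e\<in>edges g. \<rho> (edge_class e) = \<rho>' (edge_class e)"
  shows "\<rho> = \<rho>'"
proof -
  interpret G: group G by fact
  interpret \<rho>: group_hom \<pi>\<^sub>1 G \<rho> using assms by unfold_locales (simp add: reps_def)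
  interpret \<rho>': group_hom \<pi>\<^sub>1 G \<rho>' using assms by unfold_locales (simp add: reps_def)
  let ?K = "{x \<in> carrier \<pi>\<^sub>1. \<rho> x = \<rho>' x}"
  have "subgroup ?K \<pi>\<^sub>1" by (rule pi1.subgroupI) auto
  then have "?K = carrier \<pi>\<^sub>1" using edge_class_closed assms(4) by (intro edge_classes_generate) auto
  then show ?thesis
    using assms by (intro extensionalityI[of _ "carrier \<pi>\<^sub>1"]) (auto simp: reps_def)
qed

lemma face_word_rep:
  assumes G: "group G" and "\<rho> \<in> reps \<pi>\<^sub>1 G"
  shows "face_word G g (\<lambda>e\<in>edges g. \<rho> (edge_class e)) = \<one>\<^bsub>G\<^esub>"
proof -
  interpret G: group G by fact
  interpret \<rho>: group_hom \<pi>\<^sub>1 G \<rho> using assms by unfold_locales (simp add: reps_def)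
  have "face_word G k (\<lambda>e\<in>edges g. \<rho> (edge_class e)) = \<rho> (face_word \<pi>\<^sub>1 k edge_class)" if "k \<le> g" for k
    using that
  proof (induction k)
    case (Suc k)
    have e: "Alpha k \<in> edges g" "Beta k \<in> edges g" using Suc by (auto simp: edges_def)
    then have "edge_class (Alpha k) \<in> carrier \<pi>\<^sub>1" "edge_class (Beta k) \<in> carrier \<pi>\<^sub>1" using edge_class_closed by blast+
    then show ?case
      using Suc e pi1.face_word_closed[OF edge_class_closed, of k] by (simp add: grp_commutator_def del: std_graph.simps)
  qed simp
  then show ?thesis using face_word_edge_class by simp
qed

end

section \<open>Simplicial groups\<close>

lemma hom_cong:
  assumes "f \<in> hom G K" "group G" "\<And>x. x \<in> carrier G \<Longrightarrow> f' x = f x"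
  shows "f' \<in> hom G K"
proof -
  interpret G: group G by fact
  show ?thesis using assms by (auto simp: hom_def)
qed

lemma DeltaI:
  assumes "\<theta> \<in> extensional {..m}" "\<And>i. i \<le> m \<Longrightarrow> \<theta> i \<le> n" "\<And>i j. i \<le> j \<Longrightarrow> j \<le> m \<Longrightarrow> \<theta> i \<le> \<theta> j"
  shows "\<theta> \<in> Delta m n"
  using assms by (auto simp: Delta_def PiE_def Pi_iff mono_on_def)

lemma DeltaD:
  assumes "\<theta> \<in> Delta m n"
  shows "\<theta> \<in> extensional {..m}" "i \<le> m \<Longrightarrow> \<theta> i \<le> n" "i \<le> j \<Longrightarrow> j \<le> m \<Longrightarrow> \<theta> i \<le> \<theta> j"
  using assms by (auto simp: Delta_def PiE_def Pi_iff mono_on_def)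

lemma codegeneracy_Delta: "i \<le> n \<Longrightarrow> codegeneracy n i \<in> Delta (Suc n) n"
  by (rule DeltaI) (auto simp: codegeneracy_def)

lemma coface_Delta: "coface n i \<in> Delta n (Suc n)"
  by (rule DeltaI) (auto simp: coface_def)

lemma simplicial_groupD:
  assumes "simplicial_group H"
  shows "group (grp H n)"
    and "\<theta> \<in> Delta m n \<Longrightarrow> x \<in> carrier (grp H n) \<Longrightarrow> gmap H m n \<theta> x \<in> carrier (grp H m)"
    and "x \<in> carrier (grp H n) \<Longrightarrow> gmap H n n (\<lambda>i\<in>{..n}. i) x = x"
    and "\<theta> \<in> Delta k m \<Longrightarrow> \<eta> \<in> Delta m n \<Longrightarrow> x \<in> carrier (grp H n) \<Longrightarrow>
      gmap H k n (compose {..k} \<eta> \<theta>) x = gmap H k m \<theta> (gmap H m n \<eta> x)"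
  using assms by (auto simp: simplicial_group_def simplicial_set_def underlying_sset_def Pi_iff)

text \<open>Every monotone map is a composite of cofaces and codegeneracies.\<close>

lemma gmap_hom:
  assumes H: "simplicial_group H" and "\<theta> \<in> Delta m n"
  shows "gmap H m n \<theta> \<in> hom (grp H n) (grp H m)"
  using assms(2)
proof (induction "m + n" arbitrary: m n \<theta> rule: less_induct)
  case less
  note \<theta> = DeltaD[OF less.prems]
  have comp: "gmap H m n \<theta> \<in> hom (grp H n) (grp H m)"
    if "\<theta>1 \<in> Delta m k" "\<theta>2 \<in> Delta k n" "\<theta> = compose {..m} \<theta>2 \<theta>1"
      "gmap H m k \<theta>1 \<in> hom (grp H k) (grp H m)" "gmap H k n \<theta>2 \<in> hom (grp H n) (grp H k)" for \<theta>1 \<theta>2 k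
  proof (rule hom_cong)
    show "gmap H m k \<theta>1 \<circ> gmap H k n \<theta>2 \<in> hom (grp H n) (grp H m)"
      using that by (auto intro: hom_compose)
  qed (use simplicial_groupD[OF H] that in auto)
  show ?case
  \<comment> \<open>A repeated value splits off a codegeneracy, a missed value a coface, and a map
    with neither is the identity. Each factorisation shortens one of the two ordinals, hence the
    induction on the sum \<open>m + n\<close>.\<close>
  proof (cases "\<exists>i<m. \<theta> i = \<theta> (Suc i)")
    case True
    then obtain i m' where i: "m = Suc m'" "i \<le> m'" "\<theta> i = \<theta> (Suc i)"
      by (metis less_Suc_eq_le not0_implies_Suc not_less_zero)
    define \<theta>' where "\<theta>' = (\<lambda>j\<in>{..m'}. \<theta> (if j \<le> i then j else Suc j))"
    have \<theta>': "\<theta>' \<in> Delta m' n"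
      by (rule DeltaI) (auto simp: \<theta>'_def i intro!: \<theta>)
    have "\<theta> = compose {..m} \<theta>' (codegeneracy m' i)"
    proof (rule extensionalityI[OF \<theta>(1)])
      fix j assume j: "j \<in> {..m}"
      show "\<theta> j = compose {..m} \<theta>' (codegeneracy m' i) j"
      proof (cases "j \<le> i")
        case False
        then obtain j' where j': "j = Suc j'" by (cases j) auto
        then have "j' = i \<or> i < j'" using False by auto
        then show ?thesis using False j i j' by (auto simp: compose_def codegeneracy_def \<theta>'_def)
      qed (use j i in \<open>auto simp: compose_def codegeneracy_def \<theta>'_def\<close>)
    qed auto
    then show ?thesis
    proof (rule comp[OF codegeneracy_Delta[OF i(2), folded i(1)] \<theta>'])
      show "gmap H m m' (codegeneracy m' i) \<in> hom (grp H m') (grp H m)"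
        using H i by (simp add: simplicial_group_def)
      show "gmap H m' n \<theta>' \<in> hom (grp H n) (grp H m')"
        by (rule less.hyps[OF _ \<theta>']) (use i in simp)
    qed
  next
    case False
    have strict: "\<theta> i < \<theta> (Suc i)" if "i < m" for i
      using \<theta>(3)[of i "Suc i"] False that by (metis Suc_leI le_add2 le_neq_implies_less plus_1_eq_Suc)
    \<comment> \<open>A strictly increasing map gains at least 1 in each step; once the map is also
      onto, this bounds its values from both sides.\<close>
    have grow: "\<theta> i + d \<le> \<theta> (i + d)" if "i + d \<le> m" for i d
      using that
    proof (induction d)
      case (Suc d)
      then show ?case using strict[of "i + d"] by simp
    qed simp
    show ?thesis
    proof (cases "\<exists>j\<le>n. j \<notin> \<theta> ` {..m}")
      case True
      then obtain j where j: "j \<le> n" "\<And>i. i \<le> m \<Longrightarrow> \<theta> i \<noteq> j" by auto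
      have "n \<noteq> 0" using j \<theta>(2)[of 0] by (metis le0 le_zero_eq)
      then obtain n' where n': "n = Suc n'" using not0_implies_Suc by blast
      define \<theta>' where "\<theta>' = (\<lambda>i\<in>{..m}. if \<theta> i < j then \<theta> i else \<theta> i - 1)"
      have \<theta>': "\<theta>' \<in> Delta m n'"
      proof (rule DeltaI)
        show "\<theta>' i \<le> n'" if "i \<le> m" for i
          using \<theta>(2)[OF that] j(1) n' that by (auto simp: \<theta>'_def)
        show "\<theta>' i \<le> \<theta>' k" if "i \<le> k" "k \<le> m" for i k
          using \<theta>(3)[OF that] j(2)[of i] j(2)[of k] that by (auto simp: \<theta>'_def)
      qed (simp add: \<theta>'_def)
      have "\<theta> = compose {..m} (coface n' j) \<theta>'"
      proof (rule extensionalityI[OF \<theta>(1)])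
        fix i assume i: "i \<in> {..m}"
        then have "\<theta> i < j \<or> j < \<theta> i" "\<theta> i \<le> Suc n'" using j(2)[of i] \<theta>(2)[of i] n' by auto
        then show "\<theta> i = compose {..m} (coface n' j) \<theta>' i"
          using i j(1) n' by (auto simp: compose_def coface_def \<theta>'_def)
      qed auto
      then show ?thesis
      proof (rule comp[OF \<theta>' coface_Delta[of n' j, folded n']])
        show "gmap H n' n (coface n' j) \<in> hom (grp H n) (grp H n')"
          using H j n' by (simp add: simplicial_group_def)
        show "gmap H m n' \<theta>' \<in> hom (grp H n') (grp H m)"
          by (rule less.hyps[OF _ \<theta>']) (use n' in simp)
      qed
    next
      case False
      then have "{..n} \<subseteq> \<theta> ` {..m}" by auto
      from card_mono[OF _ this] have "n \<le> m" using card_image_le[of "{..m}" \<theta>] by simp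
      have "m \<le> n" using grow[of 0 m] \<theta>(2)[of m] by simp
      with \<open>n \<le> m\<close> have mn: "m = n" by simp
      have "\<theta> = (\<lambda>i\<in>{..n}. i)"
      proof (rule extensionalityI[OF \<theta>(1)])
        fix i assume i: "i \<in> {..m}"
        then show "\<theta> i = (\<lambda>i\<in>{..n}. i) i"
          using grow[of 0 i] grow[of i "m - i"] \<theta>(2)[of m] mn by simp
      qed (simp add: mn)
      note id = this
      show ?thesis
        unfolding id mn
      proof (rule hom_cong)
        show "(\<lambda>x. x) \<in> hom (grp H n) (grp H n)" by (simp add: hom_def)
      qed (fact simplicial_groupD(1)[OF H] simplicial_groupD(3)[OF H])+
    qed
  qed
qed

section \<open>The protected object\<close>

definition label_tuples :: "('h, 'c) monoid_scheme \<Rightarrow> nat \<Rightarrow> (edge \<Rightarrow> 'h) set" where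
  "label_tuples G g = edges g \<rightarrow>\<^sub>E carrier G"

definition conj_orbit :: "('h, 'c) monoid_scheme \<Rightarrow> nat \<Rightarrow> (edge \<Rightarrow> 'h) \<Rightarrow> (edge \<Rightarrow> 'h) set" where
  "conj_orbit G g a = {conj_tuple G g h a | h. h \<in> carrier G}"

lemma conj_tuple_closed:
  assumes "group G" "h \<in> carrier G" "a \<in> label_tuples G g"
  shows "conj_tuple G g h a \<in> label_tuples G g"
proof -
  interpret G: group G by fact
  show ?thesis using assms by (auto simp: label_tuples_def conj_tuple_def)
qed

lemma conj_tuple_mult:
  assumes "group G" "h \<in> carrier G" "k \<in> carrier G" "a \<in> label_tuples G g"
  shows "conj_tuple G g k (conj_tuple G g h a) = conj_tuple G g (k \<otimes>\<^bsub>G\<^esub> h) a"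
  using assms by (auto simp: label_tuples_def conj_tuple_def restrict_def fun_eq_iff PiE_iff conj_conj[OF assms(1)])

lemma conj_tuple_one:
  assumes "group G" "a \<in> label_tuples G g"
  shows "conj_tuple G g \<one>\<^bsub>G\<^esub> a = a"
proof -
  interpret G: group G by fact
  show ?thesis
    using assms by (intro extensionalityI[of _ "edges g"]) (auto simp: label_tuples_def conj_tuple_def PiE_iff)
qed

lemma conj_orbit_conj:
  assumes "group G" "h \<in> carrier G" "a \<in> label_tuples G g"
  shows "conj_orbit G g (conj_tuple G g h a) = conj_orbit G g a"
proof -
  interpret G: group G by fact
  note c = conj_tuple_mult[OF assms(1,2) _ assms(3)]
  show ?thesis
  proof
    show "conj_orbit G g (conj_tuple G g h a) \<subseteq> conj_orbit G g a"
      unfolding conj_orbit_def using c assms(2) by auto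
    show "conj_orbit G g a \<subseteq> conj_orbit G g (conj_tuple G g h a)"
    proof
      fix b assume "b \<in> conj_orbit G g a"
      then obtain k where k: "k \<in> carrier G" "b = conj_tuple G g k a" by (auto simp: conj_orbit_def)
      then have "b = conj_tuple G g (k \<otimes>\<^bsub>G\<^esub> inv\<^bsub>G\<^esub> h) (conj_tuple G g h a)"
        using c[of "k \<otimes>\<^bsub>G\<^esub> inv\<^bsub>G\<^esub> h"] assms(2) by (simp add: G.m_assoc)
      then show "b \<in> conj_orbit G g (conj_tuple G g h a)"
        unfolding conj_orbit_def using k(1) assms(2) by blast
    qed
  qed
qed

lemma conj_orbit_self: "group G \<Longrightarrow> a \<in> label_tuples G g \<Longrightarrow> a \<in> conj_orbit G g a"
  unfolding conj_orbit_def using conj_tuple_one group.is_monoid monoid.one_closed by (metis (mono_tags, lifting) mem_Collect_eq)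

lemma cells_M_obj: "cells (M_obj H g) n = label_tuples (grp H n) g"
  by (simp add: M_obj_def sset_power_def underlying_sset_def label_tuples_def)

abbreviation M_rel :: "'h simplicial_group_data \<Rightarrow> nat \<Rightarrow> nat \<Rightarrow> ((edge \<Rightarrow> 'h) \<times> (edge \<Rightarrow> 'h)) set" where
  "M_rel H g n \<equiv> coeq_rel (sset_prod (underlying_sset H) (M_obj H g)) (M_obj H g)
     (\<lambda>n (h, a). conj_tuple (grp H n) g h a) (\<lambda>n (h, a). a) n"

text \<open>The generating pairs and their inverses are conjugations, and conjugations compose to
  conjugations. The generated equivalence therefore relates exactly the members of one
  orbit.\<close>

lemma M_rel_eq:
  assumes "group (grp H n)"
  shows "M_rel H g n = {(a, b). a \<in> label_tuples (grp H n) g \<and> b \<in> conj_orbit (grp H n) g a}" (is "_ = ?R")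
proof -
  let ?G = "grp H n"
  interpret G: group ?G by fact
  let ?M = "label_tuples ?G g"
  define R where "R = {(conj_tuple ?G g h a, a) | h a. h \<in> carrier ?G \<and> a \<in> ?M}"
  have rel: "M_rel H g n = (R \<union> R\<inverse>)\<^sup>* \<inter> ?M \<times> ?M"
  proof -
    have "{((\<lambda>(h, a). conj_tuple ?G g h a) x, (\<lambda>(h, a). a) x) | x. x \<in> carrier ?G \<times> ?M} = R"
      unfolding R_def by auto
    then show ?thesis
      unfolding coeq_rel_def cells_M_obj by (simp add: sset_prod_def underlying_sset_def cells_M_obj)
  qed
  have step: "b \<in> conj_orbit ?G g a \<and> b \<in> ?M" if ab: "(a, b) \<in> R \<union> R\<inverse>" for a b
  proof -
    from ab consider h where "h \<in> carrier ?G" "b \<in> ?M" "a = conj_tuple ?G g h b"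
      | h where "h \<in> carrier ?G" "a \<in> ?M" "b = conj_tuple ?G g h a" unfolding R_def by blast
    then show ?thesis
    proof cases
      case (1 h)
      then show ?thesis
        using conj_orbit_conj[OF assms 1(1,2)] conj_orbit_self[OF assms 1(2)] by simp
    next
      case (2 h)
      then show ?thesis using conj_tuple_closed[OF assms] by (auto simp: conj_orbit_def)
    qed
  qed
  have orbit_eq: "conj_orbit ?G g b = conj_orbit ?G g a" if ab: "b \<in> conj_orbit ?G g a" "a \<in> ?M" for a b
  proof -
    obtain h where "h \<in> carrier ?G" "b = conj_tuple ?G g h a" using ab(1) by (auto simp: conj_orbit_def)
    then show ?thesis using conj_orbit_conj[OF assms _ ab(2)] by simp
  qed
  have A: "b \<in> conj_orbit ?G g a \<and> b \<in> ?M" if "(a, b) \<in> (R \<union> R\<inverse>)\<^sup>*" "a \<in> ?M" for a b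
    using that
  proof (induction rule: rtrancl_induct)
    case base
    then show ?case using conj_orbit_self[OF assms] by simp
  next
    case (step y z)
    then show ?case using orbit_eq[of y a] \<open>\<And>a b. (a, b) \<in> R \<union> R\<inverse> \<Longrightarrow> b \<in> conj_orbit ?G g a \<and> b \<in> ?M\<close>[of y z] by simp
  qed
  have B: "(a, b) \<in> (R \<union> R\<inverse>)\<^sup>* \<inter> ?M \<times> ?M" if "a \<in> ?M" "b \<in> conj_orbit ?G g a" for a b
  proof -
    obtain h where h: "h \<in> carrier ?G" "b = conj_tuple ?G g h a" using \<open>b \<in> conj_orbit ?G g a\<close> by (auto simp: conj_orbit_def)
    then have "(b, a) \<in> R" "b \<in> ?M" using that(1) conj_tuple_closed[OF assms] by (auto simp: R_def)
    then show ?thesis using that(1) by auto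
  qed
  show ?thesis
    unfolding rel
  proof (intro equalityI subrelI)
    fix a b assume "(a, b) \<in> (R \<union> R\<inverse>)\<^sup>* \<inter> ?M \<times> ?M"
    then show "(a, b) \<in> ?R" using A[of a b] by simp
  next
    fix a b assume "(a, b) \<in> ?R"
    then show "(a, b) \<in> (R \<union> R\<inverse>)\<^sup>* \<inter> ?M \<times> ?M" by (intro B) simp_all
  qed
qed

lemma M_proj_eq:
  assumes "group (grp H n)" "a \<in> label_tuples (grp H n) g"
  shows "M_proj H g n a = conj_orbit (grp H n) g a"
  unfolding M_proj_def M_rel_eq[OF assms(1)] using assms(2) by auto

definition flat_tuples :: "('h, 'c) monoid_scheme \<Rightarrow> nat \<Rightarrow> (edge \<Rightarrow> 'h) set" where
  "flat_tuples G g = {a \<in> label_tuples G g. face_word G g a = \<one>\<^bsub>G\<^esub>}"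

lemma cells_M_inv:
  assumes "group (grp H n)"
  shows "cells (M_inv H g) n = conj_orbit (grp H n) g ` flat_tuples (grp H n) g"
proof -
  have "cells (M_coinv H g) n = flat_tuples (grp H n) g"
    by (auto simp: M_coinv_def sset_equaliser_def cells_M_obj flat_tuples_def)
  moreover have "M_proj H g n ` flat_tuples (grp H n) g = conj_orbit (grp H n) g ` flat_tuples (grp H n) g"
    by (rule image_cong) (auto simp: M_proj_eq[OF assms] flat_tuples_def)
  ultimately show ?thesis by (simp add: M_inv_def sset_image_def)
qed

text \<open>A structure map is a homomorphism and carries conjugation by \<open>h\<close> to
  conjugation by the image of \<open>h\<close>. Hence the image of an orbit, saturated under
  conjugation, is a single orbit.\<close>

lemma smap_M_inv:
  assumes H: "simplicial_group H" and \<theta>: "\<theta> \<in> Delta m n" and a: "a \<in> label_tuples (grp H n) g"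
  shows "smap (M_inv H g) m n \<theta> (conj_orbit (grp H n) g a) = conj_orbit (grp H m) g (\<lambda>e\<in>edges g. gmap H m n \<theta> (a e))"
proof -
  let ?f = "gmap H m n \<theta>" and ?s = "\<lambda>a. \<lambda>e\<in>edges g. gmap H m n \<theta> (a e)"
  interpret f: group_hom "grp H n" "grp H m" ?f
    using simplicial_groupD(1)[OF H] gmap_hom[OF H \<theta>] by (simp add: group_hom_def group_hom_axioms_def)
  have ae: "a e \<in> carrier (grp H n)" if "e \<in> edges g" for e using a that by (auto simp: label_tuples_def)
  have sa: "?s a \<in> label_tuples (grp H m) g" using ae by (auto simp: label_tuples_def)
  have sconj: "?s (conj_tuple (grp H n) g h a) = conj_tuple (grp H m) g (?f h) (?s a)" if "h \<in> carrier (grp H n)" for h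
    using ae that by (auto simp: conj_tuple_def fun_eq_iff)
  have "smap (M_inv H g) m n \<theta> (conj_orbit (grp H n) g a) = M_rel H g m `` (?s ` conj_orbit (grp H n) g a)"
    by (simp add: M_inv_def sset_image_def M_quot_def sset_coequaliser_def M_obj_def sset_power_def underlying_sset_def)
  also have "\<dots> = (\<Union>b\<in>?s ` conj_orbit (grp H n) g a. conj_orbit (grp H m) g b)"
  proof -
    have "b \<in> label_tuples (grp H m) g" if "b \<in> ?s ` conj_orbit (grp H n) g a" for b
      using that sconj conj_tuple_closed[OF f.H.group_axioms _ sa] by (auto simp: conj_orbit_def)
    then show ?thesis unfolding M_rel_eq[OF f.H.group_axioms] by blast
  qed
  also have "\<dots> = conj_orbit (grp H m) g (?s a)"
  proof -
    have "conj_orbit (grp H m) g b = conj_orbit (grp H m) g (?s a)" if b: "b \<in> ?s ` conj_orbit (grp H n) g a" for b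
    proof -
      obtain h where "h \<in> carrier (grp H n)" "b = ?s (conj_tuple (grp H n) g h a)"
        using b by (auto simp: conj_orbit_def)
      then show ?thesis using sconj conj_orbit_conj[OF f.H.group_axioms _ sa] by simp
    qed
    moreover have "?s a \<in> ?s ` conj_orbit (grp H n) g a"
      using conj_orbit_self[OF f.G.group_axioms a] by blast
    ultimately show ?thesis by blast
  qed
  finally show ?thesis .
qed

lemma smap_rep_sset:
  assumes P: "group P" and H: "simplicial_group H" and \<theta>: "\<theta> \<in> Delta m n" and \<rho>: "\<rho> \<in> reps P (grp H n)"
  shows "smap (rep_sset P H) m n \<theta> (rep_class P (grp H n) \<rho>)
    = rep_class P (grp H m) (compose (carrier P) (gmap H m n \<theta>) \<rho>)"
    and "compose (carrier P) (gmap H m n \<theta>) \<rho> \<in> reps P (grp H m)"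
proof -
  let ?f = "gmap H m n \<theta>" and ?c = "compose (carrier P) (gmap H m n \<theta>)"
  interpret f: group_hom "grp H n" "grp H m" ?f
    using simplicial_groupD(1)[OF H] gmap_hom[OF H \<theta>] by (simp add: group_hom_def group_hom_axioms_def)
  interpret P: group P by fact
  have \<rho>x: "\<rho> x \<in> carrier (grp H n)" if "x \<in> carrier P" for x using \<rho> that by (auto simp: reps_def hom_def)
  show c: "?c \<rho> \<in> reps P (grp H m)"
    using \<rho> \<rho>x by (auto simp: reps_def hom_def compose_def)
  have "?c \<rho>' \<in> rep_class P (grp H m) (?c \<rho>)" if \<rho>': "\<rho>' \<in> rep_class P (grp H n) \<rho>" for \<rho>'
  proof -
    obtain h where h: "h \<in> carrier (grp H n)" "\<rho>' = (\<lambda>x\<in>carrier P. h \<otimes>\<^bsub>grp H n\<^esub> \<rho> x \<otimes>\<^bsub>grp H n\<^esub> inv\<^bsub>grp H n\<^esub> h)"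
      using \<rho>' by (auto simp: rep_class_def)
    then have "?c \<rho>' = (\<lambda>x\<in>carrier P. ?f h \<otimes>\<^bsub>grp H m\<^esub> ?c \<rho> x \<otimes>\<^bsub>grp H m\<^esub> inv\<^bsub>grp H m\<^esub> (?f h))"
      using \<rho>x by (auto simp: compose_def fun_eq_iff)
    then show ?thesis unfolding rep_class_def using f.hom_closed[OF h(1)] by blast
  qed
  then have eq: "rep_class P (grp H m) (?c \<rho>') = rep_class P (grp H m) (?c \<rho>)" if "\<rho>' \<in> rep_class P (grp H n) \<rho>" for \<rho>'
    using rep_class_eq[OF P f.H.group_axioms c] that by blast
  have "(\<Union>\<rho>'\<in>rep_class P (grp H n) \<rho>. rep_class P (grp H m) (?c \<rho>')) = (\<Union>\<rho>'\<in>rep_class P (grp H n) \<rho>. rep_class P (grp H m) (?c \<rho>))"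
    using eq by (intro SUP_cong refl)
  then show "smap (rep_sset P H) m n \<theta> (rep_class P (grp H n) \<rho>) = rep_class P (grp H m) (?c \<rho>)"
    using rep_class_self[OF P f.G.group_axioms \<rho>] by (auto simp: rep_sset_def)
qed

lemma group_action_transport:
  assumes A: "group_action K E A" and f: "bij_betw f E E'"
  shows "group_action K E' (\<lambda>k. \<lambda>c\<in>E'. f (A k (inv_into E f c)))"
proof -
  interpret A: group_action K E A by fact
  interpret K: group K using A.group_hom by (simp add: group_hom_def)
  have inv: "inv_into E f c \<in> E" "f (inv_into E f c) = c" if "c \<in> E'" for c
    using f that by (auto simp: bij_betw_def intro: inv_into_into f_inv_into_f)
  have inv': "inv_into E f (f x) = x" "f x \<in> E'" if "x \<in> E" for x
    using f that by (auto simp: bij_betw_def)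
  have el: "A k x \<in> E" if "k \<in> carrier K" "x \<in> E" for k x
    using A.element_image[OF that] by simp
  show ?thesis
  proof (rule group_actionI[OF K.group_axioms], goal_cases)
    case (3 c)
    have "A \<one>\<^bsub>K\<^esub> x = x" if "x \<in> E" for x using A.id_eq_one that by (metis restrict_apply')
    then show ?case using inv[OF 3] 3 by simp
  next
    case (4 k l c)
    then show ?case using inv inv' el A.composition_rule by simp
  qed (use inv inv' el in auto)
qed

section \<open>Evaluation on the edges and the induced simplicial action\<close>

context surface
begin

abbreviation eval_tuple :: "((real \<Rightarrow> 'p) set \<Rightarrow> 'h) \<Rightarrow> edge \<Rightarrow> 'h" where
  "eval_tuple \<rho> \<equiv> \<lambda>e\<in>edges g. \<rho> (edge_class e)"

lemma eval_tuple_flat: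
  assumes "group G" "\<rho> \<in> reps \<pi>\<^sub>1 G"
  shows "eval_tuple \<rho> \<in> flat_tuples G g"
  using assms face_word_rep[OF assms] edge_class_closed
  by (auto simp: flat_tuples_def label_tuples_def reps_def hom_def simp del: std_graph.simps)

lemma eval_class_rep_class:
  assumes "group G" "\<rho> \<in> reps \<pi>\<^sub>1 G"
  shows "eval_class g S q (rep_class \<pi>\<^sub>1 G \<rho>) = conj_orbit G g (eval_tuple \<rho>)"
proof -
  have eq: "eval_tuple (\<lambda>x\<in>carrier \<pi>\<^sub>1. h \<otimes>\<^bsub>G\<^esub> \<rho> x \<otimes>\<^bsub>G\<^esub> inv\<^bsub>G\<^esub> h) = conj_tuple G g h (eval_tuple \<rho>)" for h
    using edge_class_closed by (auto simp: conj_tuple_def fun_eq_iff simp del: std_graph.simps)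
  show ?thesis
    unfolding eval_class_def rep_class_def conj_orbit_def setcompr_eq_image image_image eq by (rule refl)
qed

text \<open>Injectivity is generation by the edge classes: a conjugate is recognised by its values
  on the edges. Surjectivity is the existence of a representation by holonomy.\<close>

lemma eval_class_bij:
  assumes "group (grp H n)"
  shows "bij_betw (eval_class g S q) (rep_variety \<pi>\<^sub>1 (grp H n)) (cells (M_inv H g) n)"
proof -
  let ?G = "grp H n"
  interpret G: group ?G by fact
  note P = pi1.group_axioms
  have "inj_on (eval_class g S q) (rep_variety \<pi>\<^sub>1 ?G)"
  proof (rule inj_onI)
    fix C C' assume "C \<in> rep_variety \<pi>\<^sub>1 ?G" "C' \<in> rep_variety \<pi>\<^sub>1 ?G" and eq: "eval_class g S q C = eval_class g S q C'"
    then obtain \<rho> \<rho>' where \<rho>: "\<rho> \<in> reps \<pi>\<^sub>1 ?G" "C = rep_class \<pi>\<^sub>1 ?G \<rho>" and \<rho>': "\<rho>' \<in> reps \<pi>\<^sub>1 ?G" "C' = rep_class \<pi>\<^sub>1 ?G \<rho>'"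
      unfolding rep_variety_def by blast
    have "eval_tuple \<rho>' \<in> conj_orbit ?G g (eval_tuple \<rho>')"
      using eval_tuple_flat[OF assms \<rho>'(1)] by (intro conj_orbit_self[OF assms]) (simp add: flat_tuples_def)
    then have "eval_tuple \<rho>' \<in> conj_orbit ?G g (eval_tuple \<rho>)"
      using eq eval_class_rep_class[OF assms] \<rho> \<rho>' by simp
    then obtain h where h: "h \<in> carrier ?G" "eval_tuple \<rho>' = conj_tuple ?G g h (eval_tuple \<rho>)"
      by (auto simp: conj_orbit_def)
    let ?c = "\<lambda>x\<in>carrier \<pi>\<^sub>1. h \<otimes>\<^bsub>?G\<^esub> \<rho> x \<otimes>\<^bsub>?G\<^esub> inv\<^bsub>?G\<^esub> h"
    have "\<rho>' = ?c"
    proof (rule rep_unique[OF assms \<rho>'(1) rep_conj[OF P assms \<rho>(1) h(1)]], rule ballI)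
      fix e assume e: "e \<in> edges g"
      have "\<rho>' (edge_class e) = conj_tuple ?G g h (eval_tuple \<rho>) e"
        using fun_cong[OF h(2), of e] e by simp
      then show "\<rho>' (edge_class e) = ?c (edge_class e)"
        using e bspec[OF edge_class_closed e] by (simp add: conj_tuple_def del: std_graph.simps)
    qed
    then show "C = C'"
      using rep_class_conj[OF P assms \<rho>(1) h(1)] \<rho>(2) \<rho>'(2) by simp
  qed
  moreover have "eval_class g S q ` rep_variety \<pi>\<^sub>1 ?G = cells (M_inv H g) n"
    unfolding cells_M_inv[OF assms]
  proof (intro equalityI subsetI)
    fix c assume "c \<in> eval_class g S q ` rep_variety \<pi>\<^sub>1 ?G"
    then obtain \<rho> where "\<rho> \<in> reps \<pi>\<^sub>1 ?G" "c = eval_class g S q (rep_class \<pi>\<^sub>1 ?G \<rho>)"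
      unfolding rep_variety_def by blast
    then show "c \<in> conj_orbit ?G g ` flat_tuples ?G g"
      using eval_tuple_flat[OF assms] eval_class_rep_class[OF assms] by blast
  next
    fix c assume "c \<in> conj_orbit ?G g ` flat_tuples ?G g"
    then obtain a where a: "a \<in> flat_tuples ?G g" "c = conj_orbit ?G g a" by blast
    interpret L: surface_labels g S q ?G a
      by unfold_locales (use a in \<open>auto simp: flat_tuples_def label_tuples_def\<close>)
    obtain \<rho> where \<rho>: "\<rho> \<in> reps \<pi>\<^sub>1 ?G" "\<forall>e\<in>edges g. \<rho> (edge_class e) = a e" by (rule L.rep_exists)
    have "eval_tuple \<rho> = a"
      using \<rho>(2) a(1) by (intro extensionalityI[of _ "edges g"]) (auto simp: flat_tuples_def label_tuples_def PiE_iff)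
    then have "c = eval_class g S q (rep_class \<pi>\<^sub>1 ?G \<rho>)"
      using eval_class_rep_class[OF assms \<rho>(1)] a(2) by simp
    then show "c \<in> eval_class g S q ` rep_variety \<pi>\<^sub>1 ?G"
      using \<rho>(1) unfolding rep_variety_def by blast
  qed
  ultimately show ?thesis by (simp add: bij_betw_def)
qed

lemma eval_class_smap:
  assumes H: "simplicial_group H" and \<theta>: "\<theta> \<in> Delta k n" and C: "C \<in> rep_variety \<pi>\<^sub>1 (grp H n)"
  shows "eval_class g S q (smap (rep_sset \<pi>\<^sub>1 H) k n \<theta> C) = smap (M_inv H g) k n \<theta> (eval_class g S q C)"
proof -
  note G = simplicial_groupD(1)[OF H]
  obtain \<rho> where \<rho>: "\<rho> \<in> reps \<pi>\<^sub>1 (grp H n)" "C = rep_class \<pi>\<^sub>1 (grp H n) \<rho>"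
    using C unfolding rep_variety_def by blast
  note s = smap_rep_sset[OF pi1.group_axioms H \<theta> \<rho>(1)]
  have "eval_tuple (compose (carrier \<pi>\<^sub>1) (gmap H k n \<theta>) \<rho>) = (\<lambda>e\<in>edges g. gmap H k n \<theta> (eval_tuple \<rho> e))"
    using edge_class_closed by (auto simp: compose_def fun_eq_iff simp del: std_graph.simps)
  then show ?thesis
    unfolding \<rho>(2) s(1) eval_class_rep_class[OF G s(2)] eval_class_rep_class[OF G \<rho>(1)]
    using smap_M_inv[OF H \<theta>, of "eval_tuple \<rho>"] eval_tuple_flat[OF G \<rho>(1)] by (simp add: flat_tuples_def)
qed

lemma smap_rep_sset_closed:
  assumes H: "simplicial_group H" and \<theta>: "\<theta> \<in> Delta k n" and C: "C \<in> rep_variety \<pi>\<^sub>1 (grp H n)"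
  shows "smap (rep_sset \<pi>\<^sub>1 H) k n \<theta> C \<in> rep_variety \<pi>\<^sub>1 (grp H k)"
proof -
  obtain \<rho> where \<rho>: "\<rho> \<in> reps \<pi>\<^sub>1 (grp H n)" "C = rep_class \<pi>\<^sub>1 (grp H n) \<rho>"
    using C unfolding rep_variety_def by blast
  show ?thesis
    using smap_rep_sset[OF pi1.group_axioms H \<theta> \<rho>(1)] \<rho>(2) by (simp add: rep_variety_def)
qed

lemma eval_class_iso:
  assumes "simplicial_group H"
  shows "simplicial_iso (rep_sset \<pi>\<^sub>1 H) (M_inv H g) (\<lambda>n. eval_class g S q)"
  using eval_class_bij[OF simplicial_groupD(1)[OF assms]] eval_class_smap[OF assms]
  unfolding simplicial_iso_def simplicial_map_def
  by (auto simp: rep_sset_def bij_betw_def)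

text \<open>Mapping classes act by precomposition and structure maps by postcomposition, and these
  commute. The same automorphism represents the mapping class in all degrees.\<close>

lemma rep_action_smap:
  assumes H: "simplicial_group H" and \<theta>: "\<theta> \<in> Delta k n" and \<phi>: "\<phi> \<in> carrier (mcg S)" and C: "C \<in> rep_variety \<pi>\<^sub>1 (grp H n)"
  shows "rep_action S (q 1) (grp H k) \<phi> (smap (rep_sset \<pi>\<^sub>1 H) k n \<theta> C)
    = smap (rep_sset \<pi>\<^sub>1 H) k n \<theta> (rep_action S (q 1) (grp H n) \<phi> C)"
proof -
  note G = simplicial_groupD(1)[OF H] and P = pi1.group_axioms
  obtain \<rho> where \<rho>: "\<rho> \<in> reps \<pi>\<^sub>1 (grp H n)" "C = rep_class \<pi>\<^sub>1 (grp H n) \<rho>"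
    using C unfolding rep_variety_def by blast
  obtain \<sigma> where \<sigma>: "represents S (q 1) \<phi> \<sigma>" by (rule represents_exists[OF \<phi>])
  then have aut: "\<sigma> \<in> auto \<pi>\<^sub>1" using represents_iff[OF \<phi>] by simp
  let ?c = "compose (carrier \<pi>\<^sub>1)" and ?i = "inv_into (carrier \<pi>\<^sub>1) \<sigma>"
  have "?c (?c (gmap H k n \<theta>) \<rho>) ?i = ?c (gmap H k n \<theta>) (?c \<rho> ?i)"
    using autoD(2)[OF P aut] by (auto simp: compose_def fun_eq_iff)
  then show ?thesis
    unfolding \<rho>(2) smap_rep_sset(1)[OF P H \<theta> \<rho>(1)] rep_action_eq[OF G \<phi> \<sigma> \<rho>(1)]
      rep_action_eq[OF G \<phi> \<sigma> smap_rep_sset(2)[OF P H \<theta> \<rho>(1)]] smap_rep_sset(1)[OF P H \<theta> reps_compose_inv[OF P aut \<rho>(1)]]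
    by simp
qed

lemma induced_action_eval:
  assumes "group (grp H n)" "C \<in> rep_variety \<pi>\<^sub>1 (grp H n)"
  shows "induced_action g S q H \<phi> n (eval_class g S q C) = eval_class g S q (rep_action S (q 1) (grp H n) \<phi> C)"
  using assms(2) bij_betwE[OF eval_class_bij[OF assms(1)]]
  by (simp add: induced_action_def bij_betw_inv_into_left[OF eval_class_bij[OF assms(1)]])

lemma induced_simplicial_action:
  assumes H: "simplicial_group H"
  shows "simplicial_action (mcg S) (M_inv H g) (induced_action g S q H)"
  unfolding simplicial_action_def
proof (intro conjI allI ballI)
  note G = simplicial_groupD(1)[OF H]
  show act: "group_action (mcg S) (cells (M_inv H g) n) (\<lambda>\<phi>. induced_action g S q H \<phi> n)" for n
    using group_action_transport[OF group_action_rep_variety[OF G] eval_class_bij[OF G]]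
    by (simp add: induced_action_def)
  fix \<phi> assume \<phi>: "\<phi> \<in> carrier (mcg S)"
  show "simplicial_map (M_inv H g) (M_inv H g) (induced_action g S q H \<phi>)"
    unfolding simplicial_map_def
  proof (intro conjI allI ballI)
    show "induced_action g S q H \<phi> n \<in> cells (M_inv H g) n \<rightarrow> cells (M_inv H g) n" for n
      using group_action.element_image[OF act \<phi>] by auto
    fix k n \<theta> c assume \<theta>: "\<theta> \<in> Delta k n" and c: "c \<in> cells (M_inv H g) n"
    obtain C where C: "C \<in> rep_variety \<pi>\<^sub>1 (grp H n)" "c = eval_class g S q C"
      using eval_class_bij[OF G[of n]] c by (auto simp: bij_betw_def)
    have aC: "rep_action S (q 1) (grp H n) \<phi> C \<in> rep_variety \<pi>\<^sub>1 (grp H n)"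
      using group_action.element_image[OF group_action_rep_variety[OF G] \<phi> C(1)] by simp
    show "induced_action g S q H \<phi> k (smap (M_inv H g) k n \<theta> c) = smap (M_inv H g) k n \<theta> (induced_action g S q H \<phi> n c)"
      unfolding C(2) eval_class_smap[OF H \<theta> C(1), symmetric] induced_action_eval[OF G smap_rep_sset_closed[OF H \<theta> C(1)]]
        induced_action_eval[OF G C(1)] rep_action_smap[OF H \<theta> \<phi> C(1)] eval_class_smap[OF H \<theta> aC] by (rule refl)
  qed
qed

end

section \<open>Capping off the boundary\<close>

context surface
begin

abbreviation S_disc :: "'p set" where "S_disc \<equiv> S - disc q"

text \<open>The side pairing moves only points of norm 1, so the inner disc is saturated.\<close>

lemma q_in_disc:
  assumes "z \<in> cball 0 1"
  shows "q z \<in> disc q \<longleftrightarrow> norm z < 1/2"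
proof
  assume "q z \<in> disc q"
  moreover have "norm z = 1 \<and> norm z' = 1" if "(z, z') \<in> side_pairing g" for z z' :: complex
    using pairing_cases[OF that] by (metis abs_one norm_pol)
  then have "\<forall>z z'. (z, z') \<in> side_pairing g \<longrightarrow> (z \<in> ball (0::complex) (1/2) \<longleftrightarrow> z' \<in> ball 0 (1/2))" by fastforce
  ultimately have "z \<in> ball 0 (1/2)"
    using region_saturated[of "ball 0 (1/2)" z] assms by (simp add: disc_def subset_ball ball_subset_cball[THEN subset_trans[rotated]] subset_iff)
  then show "norm z < 1/2" by simp
qed (auto simp: disc_def)

lemma S_disc_eq: "S_disc = q ` (cball 0 1 - ball 0 (1/2))"
  using q_in_disc q_image by (auto simp: image_iff)

lemma S_closed: "closed S"
  using compact_continuous_image[OF q_cont compact_cball] q_image compact_imp_closed by auto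

lemma S_disc_closed: "closed S_disc"
  unfolding S_disc_eq
  by (intro compact_imp_closed compact_continuous_image continuous_on_subset[OF q_cont] compact_diff) auto

abbreviation closed_disc :: "'p set" where "closed_disc \<equiv> q ` cball 0 (1/2)"

lemma closed_disc: "closed closed_disc" "S = S_disc \<union> closed_disc" "S_disc \<inter> closed_disc \<subseteq> disc_boundary q"
  "disc_boundary q \<subseteq> S_disc" "disc q \<subseteq> closed_disc"
proof -
  have sub: "cball 0 (1/2) \<subseteq> cball (0::complex) 1" by auto
  show "closed closed_disc"
    by (intro compact_imp_closed compact_continuous_image continuous_on_subset[OF q_cont sub]) auto
  show "disc q \<subseteq> closed_disc" by (auto simp: disc_def)
  then show "S = S_disc \<union> closed_disc" using q_image sub by blast
  show "S_disc \<inter> closed_disc \<subseteq> disc_boundary q"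
  proof
    fix x assume "x \<in> S_disc \<inter> closed_disc"
    then obtain z where z: "norm z \<le> 1/2" "x = q z" "q z \<notin> disc q" by auto
    then have "norm z = 1/2" using q_in_disc[of z] by auto
    then show "x \<in> disc_boundary q" using z by (auto simp: disc_boundary_def)
  qed
  show "disc_boundary q \<subseteq> S_disc" using q_in_disc q_in by (auto simp: disc_boundary_def)
qed

lemma cap_in: "x \<in> S_disc \<Longrightarrow> cap S q f x = f x" "x \<in> disc q \<Longrightarrow> x \<in> S \<Longrightarrow> cap S q f x = x"
  by (auto simp: cap_def)

lemma cap_closed:
  assumes "f ` S_disc \<subseteq> S_disc" "x \<in> S"
  shows "cap S q f x \<in> S"
  using assms by (auto simp: cap_def)

text \<open>Two closed pieces cover the surface. They overlap only in the boundary circle of the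
  disc, where \<open>f\<close> is already the identity.\<close>

lemma cap_continuous:
  assumes f: "continuous_on S_disc f" "\<forall>x\<in>disc_boundary q. f x = x"
  shows "continuous_on S (cap S q f)"
proof -
  have "continuous_on S_disc (cap S q f)"
    by (rule continuous_on_eq[OF f(1)]) (simp add: cap_in)
  moreover have "continuous_on closed_disc (cap S q f)"
  proof (rule continuous_on_eq[OF continuous_on_id])
    fix x assume x: "x \<in> closed_disc"
    then have "x \<in> S" using closed_disc(2) by blast
    then show "x = cap S q f x"
      using x f(2) closed_disc(3) by (auto simp: cap_def)
  qed
  ultimately show ?thesis
    using continuous_on_closed_Un[OF S_disc_closed closed_disc(1)] closed_disc(2) by metis
qed

lemma cap_compose:
  assumes "h ` S_disc \<subseteq> S_disc"
  shows "cap S q (compose S_disc f h) = compose S (cap S q f) (cap S q h)"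
  using assms by (auto simp: cap_def compose_def fun_eq_iff)

lemma cap_id: "cap S q (\<lambda>x\<in>S_disc. x) = (\<lambda>x\<in>S. x)"
  by (auto simp: cap_def fun_eq_iff)

lemma disc_homeoD:
  assumes "f \<in> carrier (homeo_group_disc S q)"
  shows "f \<in> Bij S_disc" "homeomorphic_map (top_of_set S_disc) (top_of_set S_disc) f" "\<forall>x\<in>disc_boundary q. f x = x"
    "orientation_preserving S (cap S q f)" "f ` S_disc = S_disc" "continuous_on S_disc f"
  using assms homeomorphic_map_continuous_on[of S_disc f] by (auto simp: homeo_group_disc_def)

lemma cap_continuous_map:
  assumes "homeomorphic_map (top_of_set S_disc) (top_of_set S_disc) f" "\<forall>x\<in>disc_boundary q. f x = x"
  shows "continuous_map (top_of_set S) (top_of_set S) (cap S q f)"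
  using cap_continuous[of f] cap_closed[of f] homeomorphic_map_continuous_on[OF assms(1)] assms(2)
  by (simp add: Pi_iff)

lemma inv_into_disc:
  assumes "f \<in> Bij S_disc" "x \<in> S_disc"
  shows "inv_into S_disc f (f x) = x" "f (inv_into S_disc f x) = x" "inv_into S_disc f x \<in> S_disc"
proof -
  have inj: "inj_on f S_disc" and im: "f ` S_disc = S_disc" using assms(1) unfolding Bij_def bij_betw_def by blast+
  show "inv_into S_disc f (f x) = x" by (rule inv_into_f_f[OF inj assms(2)])
  have x: "x \<in> f ` S_disc" unfolding im by (rule assms(2))
  show "f (inv_into S_disc f x) = x" by (rule f_inv_into_f[OF x])
  show "inv_into S_disc f x \<in> S_disc" by (rule inv_into_into[OF x])
qed

lemma cap_inverse:
  assumes f: "f \<in> Bij S_disc"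
  shows "compose S (cap S q (\<lambda>x\<in>S_disc. inv_into S_disc f x)) (cap S q f) = (\<lambda>x\<in>S. x)"
    "compose S (cap S q f) (cap S q (\<lambda>x\<in>S_disc. inv_into S_disc f x)) = (\<lambda>x\<in>S. x)"
proof -
  have im: "f ` S_disc \<subseteq> S_disc" "(\<lambda>x\<in>S_disc. inv_into S_disc f x) ` S_disc \<subseteq> S_disc"
    using f inv_into_disc(3)[OF f] by (auto simp: Bij_def bij_betw_def)
  show "compose S (cap S q (\<lambda>x\<in>S_disc. inv_into S_disc f x)) (cap S q f) = (\<lambda>x\<in>S. x)"
    unfolding cap_compose[OF im(1), symmetric] cap_id[symmetric] Bij_compose_restrict_eq[OF f] ..
  have "compose S_disc f (\<lambda>x\<in>S_disc. inv_into S_disc f x) = (\<lambda>x\<in>S_disc. x)"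
    using inv_into_disc(2)[OF f] by (auto simp: compose_def fun_eq_iff)
  then show "compose S (cap S q f) (cap S q (\<lambda>x\<in>S_disc. inv_into S_disc f x)) = (\<lambda>x\<in>S. x)"
    unfolding cap_compose[OF im(2), symmetric] cap_id[symmetric] by simp
qed

lemma subgroup_homeo_group_disc: "subgroup (carrier (homeo_group_disc S q)) (BijGroup S_disc)"
proof (rule subgroup_BijGroup)
  show "(\<lambda>x\<in>S_disc. x) \<in> carrier (homeo_group_disc S q)"
    using id_homeo[of S_disc] closed_disc(4)
    by (auto simp: homeo_group_disc_def id_Bij cap_id intro!: orientation_preserving_id)
  fix f assume "f \<in> carrier (homeo_group_disc S q)"
  note f = disc_homeoD[OF this]
  show "compose S_disc f h \<in> carrier (homeo_group_disc S q)" if "h \<in> carrier (homeo_group_disc S q)" for h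
  proof -
    note h = disc_homeoD[OF that]
    have "orientation_preserving S (cap S q f \<circ> cap S q h)"
      using f h by (intro orientation_preserving_compose cap_continuous_map)
    moreover have "cap S q (compose S_disc f h) x = (cap S q f \<circ> cap S q h) x" if "x \<in> S" for x
      using that h(5) by (subst cap_compose) (auto simp: compose_def)
    ultimately have "orientation_preserving S (cap S q (compose S_disc f h))"
      using orientation_preserving_cong by blast
    moreover have "compose S_disc f h x = x" if "x \<in> disc_boundary q" for x
      using that f(3) h(3) closed_disc(4) by (auto simp: compose_def)
    ultimately show ?thesis
      using f h by (simp add: homeo_group_disc_def compose_Bij homeomorphic_map_compose_restrict)
  qed
  let ?i = "\<lambda>x\<in>S_disc. inv_into S_disc f x"
  have i: "homeomorphic_map (top_of_set S_disc) (top_of_set S_disc) ?i" by (rule homeomorphic_map_inv_into[OF f(2)])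
  have bd: "\<forall>x\<in>disc_boundary q. ?i x = x"
  proof
    fix x assume x: "x \<in> disc_boundary q"
    then have "x \<in> S_disc" "f x = x" using closed_disc(4) f(3) by auto
    then show "?i x = x" using inv_into_disc(1)[OF f(1) \<open>x \<in> S_disc\<close>] by simp
  qed
  have "orientation_preserving S (cap S q ?i)"
  proof (rule orientation_preserving_left_inverse[OF cap_continuous_map[OF f(2,3)] cap_continuous_map[OF i bd] f(4)])
    show "cap S q ?i (cap S q f x) = x" if "x \<in> S" for x
      using fun_cong[OF cap_inverse(1)[OF f(1)], of x] that by (simp add: compose_def)
  qed
  then show "?i \<in> carrier (homeo_group_disc S q)"
    using i bd f(1) by (simp add: homeo_group_disc_def restrict_inv_into_Bij)
qed (auto simp: homeo_group_disc_def)

lemma homeo_group_disc_eq: "homeo_group_disc S q = (BijGroup S_disc)\<lparr>carrier := carrier (homeo_group_disc S q)\<rparr>"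
  by (simp add: homeo_group_disc_def)

lemma group_homeo_group_disc: "group (homeo_group_disc S q)"
  by (subst homeo_group_disc_eq, rule subgroup.subgroup_is_group[OF subgroup_homeo_group_disc group_BijGroup])

lemma homeo_group_disc_inv:
  assumes "f \<in> carrier (homeo_group_disc S q)"
  shows "inv\<^bsub>homeo_group_disc S q\<^esub> f = (\<lambda>x\<in>S_disc. inv_into S_disc f x)"
  using group.m_inv_consistent[OF group_BijGroup subgroup_homeo_group_disc assms]
    inv_BijGroup[OF disc_homeoD(1)[OF assms]] homeo_group_disc_eq by metis

lemma homeo_group_disc_mult:
  assumes "f \<in> carrier (homeo_group_disc S q)" "h \<in> carrier (homeo_group_disc S q)"
  shows "f \<otimes>\<^bsub>homeo_group_disc S q\<^esub> h = compose S_disc f h"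
  using disc_homeoD(1)[OF assms(1)] disc_homeoD(1)[OF assms(2)] by (simp add: homeo_group_disc_def BijGroup_def)

lemma cap_homeo:
  assumes "f \<in> carrier (homeo_group_disc S q)"
  shows "cap S q f \<in> carrier (homeo_group S)"
proof -
  interpret D: group "homeo_group_disc S q" by (rule group_homeo_group_disc)
  note f = disc_homeoD[OF assms]
  let ?i = "\<lambda>x\<in>S_disc. inv_into S_disc f x"
  have "?i \<in> carrier (homeo_group_disc S q)"
    using D.inv_closed[OF assms] by (simp add: homeo_group_disc_inv[OF assms])
  note i = disc_homeoD[OF this]
  have inv: "cap S q ?i (cap S q f x) = x" "cap S q f (cap S q ?i x) = x" if "x \<in> S" for x
    using fun_cong[OF cap_inverse(1)[OF f(1)], of x] fun_cong[OF cap_inverse(2)[OF f(1)], of x] that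
    by (simp_all only: compose_def restrict_apply' that)
  have "homeomorphic_maps (top_of_set S) (top_of_set S) (cap S q f) (cap S q ?i)"
    unfolding homeomorphic_maps_def topspace_euclidean_subtopology
    using cap_continuous_map[OF f(2,3)] cap_continuous_map[OF i(2,3)] inv by blast
  then have homeo: "homeomorphic_map (top_of_set S) (top_of_set S) (cap S q f)"
    using homeomorphic_map_maps by blast
  moreover from this have "cap S q f \<in> Bij S"
    by (auto simp: Bij_def cap_def bij_betw_def homeomorphic_eq_everything_map)
  ultimately show ?thesis using f(4) by (simp add: homeo_group_def)
qed

lemma cap_mult:
  assumes "f \<in> carrier (homeo_group_disc S q)" "h \<in> carrier (homeo_group_disc S q)"
  shows "cap S q (f \<otimes>\<^bsub>homeo_group_disc S q\<^esub> h) = cap S q f \<otimes>\<^bsub>homeo_group S\<^esub> cap S q h"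
  using disc_homeoD(5)[OF assms(2)]
  by (simp add: homeo_group_disc_mult[OF assms] homeo_group_mult[OF cap_homeo[OF assms(1)] cap_homeo[OF assms(2)]] cap_compose)

lemma cap_inv:
  assumes "f \<in> carrier (homeo_group_disc S q)"
  shows "cap S q (inv\<^bsub>homeo_group_disc S q\<^esub> f) = inv\<^bsub>homeo_group S\<^esub> (cap S q f)"
proof -
  interpret D: group "homeo_group_disc S q" by (rule group_homeo_group_disc)
  interpret G: group "homeo_group S" by (rule group_homeo_group)
  have "cap S q (inv\<^bsub>homeo_group_disc S q\<^esub> f) \<otimes>\<^bsub>homeo_group S\<^esub> cap S q f = \<one>\<^bsub>homeo_group S\<^esub>"
    using cap_mult[OF D.inv_closed[OF assms] assms] assms cap_id
    by (simp add: homeo_group_one) (simp add: homeo_group_disc_def BijGroup_def)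
  then show ?thesis
    using G.inv_equality cap_homeo[OF assms] cap_homeo[OF D.inv_closed[OF assms]] by simp
qed

text \<open>The homotopy fixes the boundary circle at all times, so it extends by the identity over
  the disc.\<close>

lemma cap_null:
  assumes "n \<in> homeo_null_disc S q"
  shows "cap S q n \<in> homeo_null S"
proof -
  have n: "n \<in> carrier (homeo_group_disc S q)" using assms by (simp add: homeo_null_disc_def)
  obtain K where K: "continuous_map (prod_topology (top_of_set {0..1::real}) (top_of_set S_disc)) (top_of_set S_disc) K"
      "\<And>x. K (0, x) = n x" "\<And>x. K (1, x) = x" "\<And>t x. t \<in> {0..1} \<Longrightarrow> x \<in> disc_boundary q \<Longrightarrow> K (t, x) = x"
    using assms unfolding homeo_null_disc_def homotopic_with_def by auto
  have Kc: "continuous_on ({0..1} \<times> S_disc) K" and KS: "\<And>t x. t \<in> {0..1} \<Longrightarrow> x \<in> S_disc \<Longrightarrow> K (t, x) \<in> S_disc"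
    using K(1) by (auto simp: Pi_iff)
  define K' where "K' = (\<lambda>y :: real \<times> 'p. if snd y \<in> disc q then snd y else K y)"
  have "continuous_on ({0..1} \<times> S_disc) K'"
    by (rule continuous_on_eq[OF Kc]) (auto simp: K'_def)
  moreover have "continuous_on ({0..1} \<times> closed_disc) K'"
  proof (rule continuous_on_eq[of _ snd])
    fix y assume y: "y \<in> {0..1::real} \<times> closed_disc"
    then have "snd y \<in> closed_disc" by auto
    then have "snd y \<in> disc q \<or> snd y \<in> disc_boundary q" using closed_disc(2,3) by blast
    then show "snd y = K' y" using y K(4)[of "fst y" "snd y"] by (auto simp: K'_def)
  qed (intro continuous_intros)
  ultimately have "continuous_on ({0..1} \<times> S_disc \<union> {0..1} \<times> closed_disc) K'"
    by (intro continuous_on_closed_Un closed_Times S_disc_closed closed_disc(1)) auto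
  moreover have "{0..1::real} \<times> S_disc \<union> {0..1} \<times> closed_disc = {0..1} \<times> S" using closed_disc(2) by blast
  ultimately have cont: "continuous_on ({0..1} \<times> S) K'" by simp
  have in_S: "K' (t, x) \<in> S" if "t \<in> {0..1}" "x \<in> S" for t x
    using KS[of t x] that by (auto simp: K'_def)
  have "homotopic_self S (\<lambda>x. K' (0, x)) (\<lambda>x. K' (1, x))"
    unfolding homotopic_with_def using cont in_S by (intro exI[of _ K']) (auto simp: Pi_iff)
  then have "homotopic_self S (cap S q n) id"
    by (rule homotopic_self_cong[THEN iffD1, rotated 2]) (auto simp: K'_def cap_def K)
  then show ?thesis using cap_homeo[OF n] by (simp add: homeo_null_def)
qed

text \<open>Capping is multiplicative and sends maps homotopic to the identity to such maps, so all
  representatives contribute the same coset to the union.\<close>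

lemma cap_class_coset:
  assumes f: "f \<in> carrier (homeo_group_disc S q)"
  shows "cap_class S q (homeo_null_disc S q #>\<^bsub>homeo_group_disc S q\<^esub> f) = homeo_null S #>\<^bsub>homeo_group S\<^esub> cap S q f"
proof -
  interpret D: group "homeo_group_disc S q" by (rule group_homeo_group_disc)
  interpret N: normal "homeo_null S" "homeo_group S" by (rule normal_homeo_null)
  let ?C = "homeo_null S #>\<^bsub>homeo_group S\<^esub> cap S q f"
  have eq: "homeo_null S #>\<^bsub>homeo_group S\<^esub> cap S q f' = ?C"
    if "f' \<in> homeo_null_disc S q #>\<^bsub>homeo_group_disc S q\<^esub> f" for f'
  proof -
    obtain n where n: "n \<in> homeo_null_disc S q" "f' = n \<otimes>\<^bsub>homeo_group_disc S q\<^esub> f"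
      using \<open>f' \<in> _\<close> by (auto simp: r_coset_def)
    then have nc: "n \<in> carrier (homeo_group_disc S q)" by (simp add: homeo_null_disc_def)
    have "homeo_null S #>\<^bsub>homeo_group S\<^esub> cap S q f' = homeo_null S #>\<^bsub>homeo_group S\<^esub> cap S q n #>\<^bsub>homeo_group S\<^esub> cap S q f"
      unfolding n(2) cap_mult[OF nc f]
      using N.coset_mult_assoc[OF N.subset cap_homeo[OF nc] cap_homeo[OF f]] by simp
    also have "homeo_null S #>\<^bsub>homeo_group S\<^esub> cap S q n = homeo_null S"
      using N.rcos_const[OF N.is_group cap_null[OF n(1)]] .
    finally show ?thesis .
  qed
  have "homotopic_with (\<lambda>h. \<forall>x\<in>disc_boundary q. h x = x) (top_of_set S_disc) (top_of_set S_disc) (\<lambda>x\<in>S_disc. x) id"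
    using closed_disc(4) homeomorphic_imp_continuous_map[OF id_homeo[of S_disc]]
    by (intro homotopic_with_equal) auto
  then have "\<one>\<^bsub>homeo_group_disc S q\<^esub> \<in> homeo_null_disc S q"
    using D.one_closed by (simp add: homeo_null_disc_def) (simp add: homeo_group_disc_def BijGroup_def)
  then have "f \<in> homeo_null_disc S q #>\<^bsub>homeo_group_disc S q\<^esub> f"
    using f by (force simp: r_coset_def)
  then have "(\<Union>f'\<in>homeo_null_disc S q #>\<^bsub>homeo_group_disc S q\<^esub> f. ?C) = ?C" by blast
  moreover have "cap_class S q (homeo_null_disc S q #>\<^bsub>homeo_group_disc S q\<^esub> f) = (\<Union>f'\<in>homeo_null_disc S q #>\<^bsub>homeo_group_disc S q\<^esub> f. ?C)"
    unfolding cap_class_def using eq by (intro SUP_cong refl)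
  ultimately show ?thesis by simp
qed

end

section \<open>Edge slides\<close>

text \<open>Serves to state the invariant of a sequence of slides that every listed end belongs to
  an edge of the graph. Together with \<open>slide_order_set\<close> it guarantees that the darts of
  each slide are labelled.\<close>

fun end_edge :: "edge_end \<Rightarrow> edge" where
  "end_edge (Src e) = e"
| "end_edge (Tgt e) = e"

lemma end_edge_dart [simp]: "end_edge (dart_src x) = fst x" "end_edge (dart_tgt x) = fst x"
  by (cases x; simp)+

lemma slide_order_set:
  assumes "slide_order x y L L'"
  shows "set L' = set L" "dart_src x \<in> set L" "dart_tgt y \<in> set L" "fst x \<noteq> fst y"
proof -
  obtain us ws us' ws' where L: "L = us @ [dart_src x, dart_tgt y] @ ws"
    "us @ [dart_src x] @ ws = us' @ [dart_tgt x] @ ws'" "L' = us' @ [dart_tgt y, dart_tgt x] @ ws'"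
    using assms unfolding slide_order_def by blast
  have "set L' = insert (dart_tgt y) (set (us' @ [dart_tgt x] @ ws'))" unfolding L(3) by auto
  also have "\<dots> = set L" unfolding L(2)[symmetric] L(1) by auto
  finally show "set L' = set L" .
  show "dart_src x \<in> set L" "dart_tgt y \<in> set L" unfolding L(1) by auto
  show "fst x \<noteq> fst y" using assms by (simp add: slide_order_def)
qed

lemma std_order_edges: "end_edge ` set (std_order g) \<subseteq> edges g"
  by (auto simp: std_order_def edges_def)

text \<open>A slide controls only the image of the open triangle. By continuity the image of the
  closed triangle then stays in the closed set \<open>S\<close>.\<close>

lemma triangle_closure: "convex hull {0, 1, \<i>} \<subseteq> closure (interior (convex hull {0, 1, \<i>}))"
proof -
  let ?T = "convex hull {0, 1, \<i>}" and ?U = "{z. 0 < Re z} \<inter> {z. 0 < Im z} \<inter> {z. Re z + Im z < 1}"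
  have "?U \<subseteq> ?T"
  proof
    fix z assume z: "z \<in> ?U"
    have "z = (1 - Re z - Im z) *\<^sub>R 0 + Re z *\<^sub>R 1 + Im z *\<^sub>R \<i>" by (simp add: complex_eq_iff)
    then show "z \<in> ?T"
      unfolding convex_hull_3 using z
      by (intro CollectI exI[of _ "1 - Re z - Im z"] exI[of _ "Re z"] exI[of _ "Im z"]) auto
  qed
  moreover have "open ?U"
    by (intro open_Int open_Collect_less) (auto intro!: continuous_intros)
  ultimately have "?U \<subseteq> interior ?T" by (rule interior_maximal)
  moreover have "Complex (1/4) (1/4) \<in> ?U" by simp
  ultimately have "interior ?T \<noteq> {}" by blast
  then have "closure (interior ?T) = closure ?T" by (intro convex_closure_interior) auto
  then show ?thesis using closure_subset by blast
qed

context surface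
begin

definition graph_labels :: "((real \<Rightarrow> 'p) set \<Rightarrow> 'h) \<Rightarrow> (edge \<Rightarrow> real \<Rightarrow> 'p) \<Rightarrow> edge \<Rightarrow> 'h" where
  "graph_labels \<rho> \<Gamma> = (\<lambda>e\<in>edges g. \<rho> (m (\<Gamma> e)))"

definition graph_loops :: "(edge \<Rightarrow> real \<Rightarrow> 'p) \<Rightarrow> bool" where
  "graph_loops \<Gamma> \<longleftrightarrow> (\<forall>e\<in>edges g. \<Gamma> e \<in> paths_in S (q 1) (q 1))"

lemma embedded_graph_loops: "embedded_graph g S q \<Gamma> \<Longrightarrow> graph_loops \<Gamma>"
  by (auto simp: embedded_graph_def graph_loops_def paths_in_def simple_path_def)

lemma dart_path_loop:
  assumes "graph_loops \<Gamma>" "fst x \<in> edges g"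
  shows "dart_path \<Gamma> x \<in> paths_in S (q 1) (q 1)"
  using assms by (cases x) (auto simp: graph_loops_def intro: paths_in_reverse)

text \<open>In the swept triangle the hypotenuse from 0 to 1 to \<i> is replaced by the direct
  segment from 0 to \<i>: the slid edge runs first along \<open>y\<close> and then along
  \<open>x\<close>, which is the product of the class of \<open>x\<close> with that of
  \<open>y\<close>.\<close>

lemma slide_graph_class:
  assumes "slide_graph g S q x y \<Gamma> \<Gamma>'" "fst x \<in> edges g" "fst y \<in> edges g"
  shows "m (dart_path \<Gamma>' y) = m (dart_path \<Gamma> x) \<otimes>\<^bsub>\<pi>\<^sub>1\<^esub> m (dart_path \<Gamma> y)"
proof -
  let ?T = "convex hull {0, 1, \<i>}"
  obtain \<tau> where \<tau>: "continuous_on ?T \<tau>" "\<tau> ` interior ?T \<subseteq> S - disc q - cilium q - (\<Union>e\<in>edges g. path_image (\<Gamma> e) \<union> path_image (\<Gamma>' e))"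
    "\<forall>t\<in>{0..1}. \<tau> (linepath 0 1 t) = dart_path \<Gamma> y t \<and> \<tau> (linepath 1 \<i> t) = dart_path \<Gamma> x t \<and> \<tau> (linepath 0 \<i> t) = dart_path \<Gamma>' y t"
    using assms(1) unfolding slide_graph_def by blast
  have loops: "graph_loops \<Gamma>" "graph_loops \<Gamma>'"
    using assms(1) embedded_graph_loops by (auto simp: slide_graph_def)
  have "closure (interior ?T) \<subseteq> ?T"
    by (intro closure_minimal interior_subset compact_imp_closed compact_convex_hull) auto
  then have "\<tau> ` closure (interior ?T) \<subseteq> S"
    using \<tau>(1,2) S_closed by (intro image_closure_subset) (auto intro: continuous_on_subset)
  then have S: "\<tau> ` ?T \<subseteq> S" using triangle_closure by blast
  have seg: "path_image (linepath a b) \<subseteq> ?T" if "a \<in> {0, 1, \<i>}" "b \<in> {0, 1, \<i>}" for a b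
    unfolding path_image_linepath using that by (intro closed_segment_subset convex_convex_hull hull_inc)
  have side: "m (\<tau> \<circ> linepath a b) = m p" if "p \<in> paths_in S (q 1) (q 1)" "\<forall>t\<in>{0..1}. \<tau> (linepath a b t) = p t" for a b p
    using loopify_cong[OF that(1), of "\<tau> \<circ> linepath a b"] that(2) by simp
  have "m (\<tau> \<circ> linepath 0 \<i>) = m (\<tau> \<circ> (linepath 0 1 +++ linepath 1 \<i>))"
    using seg by (intro loopify_convex[OF convex_convex_hull \<tau>(1) S]) (auto simp: path_image_join simp del: path_image_linepath)
  also have "\<dots> = m (\<tau> \<circ> linepath 1 \<i>) \<otimes>\<^bsub>\<pi>\<^sub>1\<^esub> m (\<tau> \<circ> linepath 0 1)"
    unfolding path_compose_join
    using loopify_join paths_in_convex[OF \<tau>(1) S path_linepath seg[of 0 1]] paths_in_convex[OF \<tau>(1) S path_linepath seg[of 1 \<i>]]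
    by simp
  finally show ?thesis
    using side[OF dart_path_loop[OF loops(1) assms(3)], of 0 1] side[OF dart_path_loop[OF loops(1) assms(2)], of 1 \<i>]
      side[OF dart_path_loop[OF loops(2) assms(3)], of 0 \<i>] \<tau>(3) by simp
qed

lemma dart_label_graph:
  assumes "group_hom \<pi>\<^sub>1 G \<rho>" "graph_loops \<Gamma>" "fst x \<in> edges g"
  shows "dart_label G (graph_labels \<rho> \<Gamma>) x = \<rho> (m (dart_path \<Gamma> x))"
proof -
  interpret \<rho>: group_hom \<pi>\<^sub>1 G \<rho> by fact
  have "\<Gamma> (fst x) \<in> paths_in S (q 1) (q 1)" using assms by (simp add: graph_loops_def)
  then show ?thesis
    using assms(3) loopify_reverse[of "\<Gamma> (fst x)"] by (cases x) (auto simp: graph_labels_def)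
qed

lemma set_dart_label_graph:
  assumes \<rho>: "group_hom \<pi>\<^sub>1 G \<rho>" and "graph_loops \<Gamma>'" "fst y \<in> edges g" "\<forall>e. e \<noteq> fst y \<longrightarrow> \<Gamma>' e = \<Gamma> e"
  shows "set_dart_label G (graph_labels \<rho> \<Gamma>) y (\<rho> (m (dart_path \<Gamma>' y))) = graph_labels \<rho> \<Gamma>'"
proof -
  interpret \<rho>: group_hom \<pi>\<^sub>1 G \<rho> by fact
  obtain e b where y: "y = (e, b)" by (cases y)
  have "\<Gamma>' e \<in> paths_in S (q 1) (q 1)" using assms y by (simp add: graph_loops_def)
  then have "(if b then \<rho> (m (dart_path \<Gamma>' y)) else inv\<^bsub>G\<^esub> (\<rho> (m (dart_path \<Gamma>' y)))) = \<rho> (m (\<Gamma>' e))"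
    using loopify_reverse[of "\<Gamma>' e"] by (simp add: y)
  then show ?thesis
    using assms(3,4) y by (intro ext) (auto simp: graph_labels_def restrict_def)
qed

text \<open>The labels of a graph under a homomorphism change by the same formula as the classes of
  its edges. An inverse slide is treated by exchanging the roles of the two graphs and solving for
  the old class.\<close>

lemma slide_step_labels:
  assumes \<rho>: "group_hom \<pi>\<^sub>1 G \<rho>" and step: "slide_step g S q s (L, \<Gamma>) (L', \<Gamma>')"
    and L: "end_edge ` set L \<subseteq> edges g"
  shows "slide_aut G s (graph_labels \<rho> \<Gamma>) = graph_labels \<rho> \<Gamma>' \<and> end_edge ` set L' \<subseteq> edges g"
proof (cases s)
  case (Slide x y)
  interpret \<rho>: group_hom \<pi>\<^sub>1 G \<rho> by fact
  have ord: "slide_order x y L L'" and gr: "slide_graph g S q x y \<Gamma> \<Gamma>'" using step Slide by auto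
  note ord = slide_order_set[OF ord]
  have xy: "fst x \<in> edges g" "fst y \<in> edges g" using ord(2,3) L by (auto simp: image_subset_iff)
  have loops: "graph_loops \<Gamma>" "graph_loops \<Gamma>'" and same: "\<forall>e. e \<noteq> fst y \<longrightarrow> \<Gamma>' e = \<Gamma> e"
    using gr embedded_graph_loops by (auto simp: slide_graph_def)
  have c: "m (dart_path \<Gamma> x) \<in> carrier \<pi>\<^sub>1" "m (dart_path \<Gamma> y) \<in> carrier \<pi>\<^sub>1"
    by (rule loopify_closed[OF dart_path_loop[OF loops(1) xy(1)]], rule loopify_closed[OF dart_path_loop[OF loops(1) xy(2)]])
  have "slide_aut G s (graph_labels \<rho> \<Gamma>) = set_dart_label G (graph_labels \<rho> \<Gamma>) y (\<rho> (m (dart_path \<Gamma>' y)))"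
    using slide_graph_class[OF gr xy] c dart_label_graph[OF \<rho> loops(1)] xy by (simp add: Slide)
  then show ?thesis
    using set_dart_label_graph[OF \<rho> loops(2) xy(2) same] ord(1) L by simp
next
  case (Unslide x y)
  interpret \<rho>: group_hom \<pi>\<^sub>1 G \<rho> by fact
  have ord: "slide_order x y L' L" and gr: "slide_graph g S q x y \<Gamma>' \<Gamma>" using step Unslide by auto
  note ord = slide_order_set[OF ord]
  have L': "end_edge ` set L' \<subseteq> edges g" using ord(1) L by simp
  have xy: "fst x \<in> edges g" "fst y \<in> edges g" using ord(2,3) L' by (auto simp: image_subset_iff)
  have loops: "graph_loops \<Gamma>" "graph_loops \<Gamma>'" and same: "\<forall>e. e \<noteq> fst y \<longrightarrow> \<Gamma>' e = \<Gamma> e"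
    using gr embedded_graph_loops by (auto simp: slide_graph_def)
  \<comment> \<open>The edge \<open>x\<close> is not the one that moves, so its class may be
    computed in either graph.\<close>
  have x: "dart_path \<Gamma>' x = dart_path \<Gamma> x" using same ord(4) by (cases x) auto
  have c: "m (dart_path \<Gamma>' x) \<in> carrier \<pi>\<^sub>1" "m (dart_path \<Gamma>' y) \<in> carrier \<pi>\<^sub>1"
    by (rule loopify_closed[OF dart_path_loop[OF loops(2) xy(1)]], rule loopify_closed[OF dart_path_loop[OF loops(2) xy(2)]])
  have "\<rho> (m (dart_path \<Gamma>' y)) = inv\<^bsub>G\<^esub> (\<rho> (m (dart_path \<Gamma> x))) \<otimes>\<^bsub>G\<^esub> \<rho> (m (dart_path \<Gamma> y))"
    using slide_graph_class[OF gr xy] c x by (simp flip: \<rho>.H.m_assoc)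
  then have "slide_aut G s (graph_labels \<rho> \<Gamma>) = set_dart_label G (graph_labels \<rho> \<Gamma>) y (\<rho> (m (dart_path \<Gamma>' y)))"
    using dart_label_graph[OF \<rho> loops(1)] xy by (simp add: Unslide)
  then show ?thesis
    using set_dart_label_graph[OF \<rho> loops(2) xy(2) same] L' by simp
qed

text \<open>Each automorphism is applied to the labels of the graph reached so far, so the steps
  chain in the order of the sequence.\<close>

lemma slide_steps_labels:
  assumes \<rho>: "group_hom \<pi>\<^sub>1 G \<rho>" and "slide_steps g S q ss (L, \<Gamma>) (L', \<Gamma>')" "end_edge ` set L \<subseteq> edges g"
  shows "fold (slide_aut G) ss (graph_labels \<rho> \<Gamma>) = graph_labels \<rho> \<Gamma>'"
  using assms(2,3)
proof (induction ss arbitrary: L \<Gamma>)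
  case (Cons s ss)
  then obtain L1 \<Gamma>1 where s: "slide_step g S q s (L, \<Gamma>) (L1, \<Gamma>1)" "slide_steps g S q ss (L1, \<Gamma>1) (L', \<Gamma>')"
    by auto
  from slide_step_labels[OF \<rho> s(1) Cons.prems(2)] show ?case
    using Cons.IH[OF s(2)] by simp
qed simp

text \<open>A sequence of slides realises the inverse of \<open>f\<close>, and \<open>\<phi> \<triangleright> [\<rho>] = [\<rho> \<circ> \<sigma>\<inverse>]\<close> contains another inverse: both sides
  evaluate \<open>\<rho>\<close> on the image of the standard graph under \<open>f\<close>.\<close>

lemma induced_action_slides:
  assumes H: "simplicial_group H" and r: "realises g S q ss \<phi>" and c: "c \<in> cells (M_inv H g) n"
  shows "induced_action g S q H (cap_class S q \<phi>) n c = slides_induced H ss n c"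
proof -
  let ?G = "grp H n" and ?D = "homeo_group_disc S q" and ?M = "homeo_group S"
  interpret D: group ?D by (rule group_homeo_group_disc)
  interpret M: group ?M by (rule group_homeo_group)
  note G = simplicial_groupD(1)[OF H, of n] and P = pi1.group_axioms
  obtain \<Gamma> f where steps: "slide_steps g S q ss (std_order g, std_graph g q) (std_order g, \<Gamma>)"
    and f: "f \<in> carrier ?D" and f_graph: "\<forall>e\<in>edges g. \<forall>t\<in>{0..1}. f (std_graph g q e t) = \<Gamma> e t"
    and f_cilium: "\<forall>x\<in>cilium q. f x = x" and \<phi>: "\<phi> = homeo_null_disc S q #>\<^bsub>?D\<^esub> (inv\<^bsub>?D\<^esub> f)"
    using r unfolding realises_def by blast
  define F where "F = cap S q f"
  have F: "F \<in> carrier ?M" unfolding F_def by (rule cap_homeo[OF f])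
  define \<psi> where "\<psi> = homeo_null S #>\<^bsub>?M\<^esub> (inv\<^bsub>?M\<^esub> F)"
  have \<psi>: "cap_class S q \<phi> = \<psi>"
    unfolding \<phi> \<psi>_def F_def cap_class_coset[OF D.inv_closed[OF f]] cap_inv[OF f] ..
  have F': "inv\<^bsub>?M\<^esub> F \<in> carrier ?M" using F by simp
  have \<psi>_in: "\<psi> \<in> carrier (mcg S)" unfolding \<psi>_def by (rule mcg_classI[OF F'])
  have F'\<psi>: "inv\<^bsub>?M\<^esub> F \<in> \<psi>"
  proof -
    interpret N: normal "homeo_null S" ?M by (rule normal_homeo_null)
    show ?thesis unfolding \<psi>_def using M.rcos_self[OF F' N.subgroup_axioms] .
  qed
  have v: "q 1 \<notin> disc q" using q_in_disc[of 1] by simp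
  \<comment> \<open>The base point is an end of the cilium, which \<open>f\<close> fixes. The
    constant path can therefore serve as the transport path of the inverse of
    \<open>F\<close>.\<close>
  have Fv: "F (q 1) = q 1"
  proof -
    have "q 1 \<in> cilium q" by (auto simp: cilium_def)
    then show ?thesis using f_cilium v v_in by (simp add: F_def cap_def)
  qed
  note FF = homeo_group_apply[OF F]
  have F'v: "(inv\<^bsub>?M\<^esub> F) (q 1) = q 1" using FF(2)[OF v_in] Fv by simp
  have "(\<lambda>_. q 1) \<in> paths_in S (q 1) ((inv\<^bsub>?M\<^esub> F) (q 1))" unfolding F'v by (rule paths_in_const[OF v_in])
  then obtain \<sigma> where \<sigma>: "\<sigma> \<in> auto \<pi>\<^sub>1" "pushes (inv\<^bsub>?M\<^esub> F) (\<lambda>_. q 1) \<sigma>"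
    by (rule pushes_auto_exists[OF F'])
  then have rep: "represents S (q 1) \<psi> \<sigma>" unfolding represents_iff[OF \<psi>_in] using F'\<psi> by blast
  \<comment> \<open>\<open>\<sigma>\<close> is induced by the inverse of \<open>F\<close>, so its
    inverse is induced by \<open>F\<close> itself.\<close>
  have \<sigma>_inv: "inv_into (carrier \<pi>\<^sub>1) \<sigma> (m p) = m (F \<circ> p)" if p: "p \<in> paths_in S (q 1) (q 1)" for p
  proof -
    have Fp: "F \<circ> p \<in> paths_in S (q 1) (q 1)" using paths_in_homeo[OF F p] Fv by simp
    have "m ((inv\<^bsub>?M\<^esub> F) \<circ> (F \<circ> p)) = m p"
      by (rule loopify_cong[OF p, symmetric]) (use FF(2) paths_in_mem[OF p] in simp)
    then have "\<sigma> (m (F \<circ> p)) = m p"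
      using \<sigma>(2) Fp v_in loopify_closed[OF p] by (simp add: pushes_def)
    then show ?thesis using autoD(4)[OF P \<sigma>(1) loopify_closed[OF Fp]] by simp
  qed
  obtain C where C: "C \<in> rep_variety \<pi>\<^sub>1 ?G" "c = eval_class g S q C"
    using eval_class_bij[OF G] c by (auto simp: bij_betw_def)
  obtain \<rho> where \<rho>: "\<rho> \<in> reps \<pi>\<^sub>1 ?G" "C = rep_class \<pi>\<^sub>1 ?G \<rho>"
    using C(1) unfolding rep_variety_def by blast
  let ?\<rho>\<sigma> = "compose (carrier \<pi>\<^sub>1) \<rho> (inv_into (carrier \<pi>\<^sub>1) \<sigma>)"
  let ?k = "\<lambda>h \<rho>. \<lambda>x\<in>carrier \<pi>\<^sub>1. h \<otimes>\<^bsub>?G\<^esub> \<rho> x \<otimes>\<^bsub>?G\<^esub> inv\<^bsub>?G\<^esub> h"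
  have std_labels: "graph_labels \<rho>' (std_graph g q) = eval_tuple \<rho>'" for \<rho>' :: "(real \<Rightarrow> 'p) set \<Rightarrow> 'a"
    unfolding graph_labels_def using loopify_loop[OF std_graph_in] by (auto simp: fun_eq_iff simp del: std_graph.simps)
  have \<Gamma>_class: "m (\<Gamma> e) = m (F \<circ> std_graph g q e) \<and> m (F \<circ> std_graph g q e) \<in> carrier \<pi>\<^sub>1" if e: "e \<in> edges g" for e
  proof -
    note p = std_graph_in[OF e]
    have Fp: "F \<circ> std_graph g q e \<in> paths_in S (q 1) (q 1)" using paths_in_homeo[OF F p] Fv by simp
    have "m (F \<circ> std_graph g q e) = m (\<Gamma> e)"
    proof (rule loopify_cong[OF Fp])
      fix t :: real assume t: "t \<in> {0..1}"
      \<comment> \<open>Edges are images of boundary arcs of the polygon and so avoid the disc,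
        where capping replaces \<open>f\<close>.\<close>
      have "\<exists>z\<in>cball 0 1. std_graph g q e t = q z \<and> norm z = 1"
        by (cases e) (auto simp: side_pol intro!: exI[of _ "pol g 1 _"])
      then have "std_graph g q e t \<notin> disc q" using q_in_disc by force
      then show "(F \<circ> std_graph g q e) t = \<Gamma> e t"
        using f_graph e t paths_in_mem[OF p t] by (simp add: F_def cap_def del: std_graph.simps)
    qed
    then show ?thesis using loopify_closed[OF Fp] by simp
  qed
  have labels: "graph_labels (?k h \<rho>) \<Gamma> = eval_tuple (?k h ?\<rho>\<sigma>)" for h
    unfolding graph_labels_def
  proof (rule restrict_ext)
    fix e assume e: "e \<in> edges g"
    note p = std_graph_in[OF e]
    have "?\<rho>\<sigma> (edge_class e) = \<rho> (m (F \<circ> std_graph g q e))"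
      using \<sigma>_inv[OF p] bspec[OF edge_class_closed e] loopify_loop[OF p] by (simp add: compose_def del: std_graph.simps)
    then show "?k h \<rho> (m (\<Gamma> e)) = ?k h ?\<rho>\<sigma> (edge_class e)"
      using \<Gamma>_class[OF e] bspec[OF edge_class_closed e] by (simp del: std_graph.simps)
  qed
  \<comment> \<open>Every conjugate of \<open>\<rho>\<close> is again a homomorphism, so the
    computation of labels applies to each member of the orbit with the same conjugating
    element.\<close>
  have fold: "fold (slide_aut ?G) ss (eval_tuple (?k h \<rho>)) = eval_tuple (?k h ?\<rho>\<sigma>)" if "h \<in> carrier ?G" for h
  proof -
    have "group_hom \<pi>\<^sub>1 ?G (?k h \<rho>)"
      using rep_conj[OF P G \<rho>(1) that] G P by (simp add: group_hom_def group_hom_axioms_def reps_def)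
    from slide_steps_labels[OF this steps std_order_edges] show ?thesis
      unfolding std_labels labels .
  qed
  have "slides_induced H ss n c = (\<lambda>h. fold (slide_aut ?G) ss (eval_tuple (?k h \<rho>))) ` carrier ?G"
    unfolding slides_induced_def C(2) \<rho>(2) eval_class_def rep_class_def setcompr_eq_image image_image Collect_mem_eq ..
  also have "\<dots> = (\<lambda>h. eval_tuple (?k h ?\<rho>\<sigma>)) ` carrier ?G"
    using fold by (rule image_cong[OF refl])
  also have "\<dots> = eval_class g S q (rep_class \<pi>\<^sub>1 ?G ?\<rho>\<sigma>)"
    unfolding eval_class_def rep_class_def setcompr_eq_image image_image Collect_mem_eq ..
  also have "\<dots> = induced_action g S q H (cap_class S q \<phi>) n c"
    unfolding \<psi> C(2) induced_action_eval[OF G C(1)] unfolding \<rho>(2) rep_action_eq[OF G \<psi>_in rep \<rho>(1)] ..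
  finally show ?thesis ..
qed

end

theorem corollary8p2:
  fixes H :: "'h simplicial_group_data"
    and S :: "'p::t2_space set" and q :: "complex \<Rightarrow> 'p" and g :: nat
  assumes "simplicial_group H"
    and "closed_surface g S q"
  shows "(\<forall>n. group_action (mcg S) (rep_variety (pi1 S (vertex q)) (grp H n))
              (rep_action S (vertex q) (grp H n))) \<and>
         simplicial_iso (rep_sset (pi1 S (vertex q)) H) (M_inv H g) (\<lambda>n. eval_class g S q) \<and>
         simplicial_action (mcg S) (M_inv H g) (induced_action g S q H) \<and>
         (\<forall>\<phi>\<in>carrier (mcg_disc S q). \<forall>ss. realises g S q ss \<phi> \<longrightarrow>
            (\<forall>n. \<forall>c\<in>cells (M_inv H g) n.
               induced_action g S q H (cap_class S q \<phi>) n c = slides_induced H ss n c)) \<and>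
         (\<forall>A. edge_slide_action g S q H A \<longrightarrow>
            (\<forall>\<psi>\<in>carrier (mcg S). \<forall>n. \<forall>c\<in>cells (M_inv H g) n.
               A \<psi> n c = induced_action g S q H \<psi> n c))"
proof -
  interpret surface g S q by unfold_locales (rule assms(2))
  note G = simplicial_groupD(1)[OF assms(1)]
  have slides: "induced_action g S q H (cap_class S q \<phi>) n c = slides_induced H ss n c"
    if "realises g S q ss \<phi>" "c \<in> cells (M_inv H g) n" for \<phi> ss n c
    by (rule induced_action_slides[OF assms(1) that])
  have "A \<psi> n c = induced_action g S q H \<psi> n c"
    if A: "edge_slide_action g S q H A" and \<psi>: "\<psi> \<in> carrier (mcg S)" and c: "c \<in> cells (M_inv H g) n" for A \<psi> n c
  proof -
    \<comment> \<open>For each mapping class \<open>edge_slide_action\<close> supplies a lift and a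
      sequence realising it, and on such a sequence the comparison is already established.\<close>
    obtain \<phi> ss where "cap_class S q \<phi> = \<psi>" "realises g S q ss \<phi>"
      "\<forall>n. \<forall>c\<in>cells (M_inv H g) n. A \<psi> n c = slides_induced H ss n c"
      using bspec[OF A[unfolded edge_slide_action_def] \<psi>] by (elim bexE exE conjE)
    then show ?thesis using slides[of ss \<phi> c n] c by simp
  qed
  then show ?thesis
    by (intro conjI allI ballI impI group_action_rep_variety[OF G] eval_class_iso[OF assms(1)]
        induced_simplicial_action[OF assms(1)] slides)
qed

end
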